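(* Let $k,d\ge1$ be integers. There exist constants $C_1,C_\eta>0$ depending only on $k$ and $d$ such that the following holds. Let $\mathcal{L} u = (-1)^k \sum_{|\sigma|=|\gamma|=k} D^{\sigma}(a_{\sigma \gamma} D^{\gamma} u)$ be self-adjoint on $D\subset\mathbb{R}^d$ with $a_{\sigma \gamma} \in L^{\infty}(D)$ for all $|\sigma|= |\gamma| = k$. Assume that for every $x \in D$: (i) (boundedness) there is a nonnegative $\theta_{k,\max}$ (independent of $x$) such that $\sum_{|\sigma|= |\gamma|= k} a_{\sigma \gamma}(x) \zeta_{\sigma} \zeta_{\gamma} \le \theta_{k,\max} \sum_{|\sigma| = k} \zeta_{\sigma}^2$ for all $\zeta=(\zeta_\sigma)_{|\sigma|=k} \in \mathbb{R}^{\binom{k+d-1}{k}}$; (ii) (strong ellipticity) there is $\theta_{k,\min} > 0$ (independent of $x$) such that $\sum_{|\sigma| = |\gamma| = k} a_{\sigma \gamma}(x) \zeta_{\sigma} \zeta_{\gamma} \ge \theta_{k,\min} \sum_{|\sigma| = k} \zeta_{\sigma}^2$ for all $\zeta \in \mathbb{R}^{\binom{k+d-1}{k}}$. Then for any $1\le i \le m$, $1\le q\le Q$ and $r>0$, $$\|\psi_{i,q}\|_{H(D \cap (B(x_i,r))^c)}^2 \le \exp\left(1 - \frac{r}{l h} \right) \|\psi_{i,q}\|_{H(D)}^2$$ whenever $\sqrt{l^2-1} \ge (e-1) C_{\eta} C_p (C_1 + C(k,d,\delta)) \sqrt{\theta_{k,\max}/\theta_{k,\min}}$.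
   Context: Notation: $|u|_{p,2,S}^2=\sum_{|\sigma|=p}\int_S|D^\sigma u|^2$. $B(x,r)$ is the ball of center $x$ and radius $r$. Setting: $D\subset\mathbb{R}^d$ is a bounded domain. The bilinear form of $\mathcal{L}$ is $B(u,v)=\sum_{|\sigma|=|\gamma|=k}\int_D a_{\sigma\gamma}D^\sigma u\,D^\gamma v$ on $H_0^k(D)$. Self-adjoint means $B$ is symmetric on $H_0^k(D)$. $H=H_0^k(D)$ with $\|u\|_H^2=B(u,u)$. For $S\subset D$ the local energy norm is $\|\psi\|_{H(S)}^2=\sum_{|\sigma|=|\gamma|=k}\int_S a_{\sigma\gamma}D^\sigma\psi\,D^\gamma\psi$. Partition: $D$ is divided into elements $\tau_1,\dots,\tau_m$ (triangles or quadrilaterals in 2D, tetrahedra or hexahedra in 3D), $h_i$ is the diameter of $\tau_i$, $h=\max_i h_i$ is the mesh size, and the partition is regular: the maximum diameter $\rho_i$ of a ball inscribed in $\tau_i$ satisfies $\rho_i/h_i\ge\delta$ for all $i$, with a fixed $\delta>0$. The point $x_i\in\tau_i$ satisfies $B(x_i,\delta h_i/2)\subset\tau_i$. Basis functions: $\mathcal{P}_{k-1}(\tau_i)$ is the space of $d$-variate polynomials of degree at most $k-1$ on $\tau_i$, $Q=\binom{k+d-1}{d}$ is its dimension, and $\{\phi_{i,q}\}_{q=1}^Q$ is a basis of it (extended by zero to $D$) with $\int_{\tau_i}\phi_{i,q}\phi_{i,q'}=|\tau_i|\delta_{q,q'}$. $\psi_{i,q}$ is the unique minimizer of $\|\psi\|_H^2$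 over $\psi\in H_0^k(D)$ subject to $\int_D\psi\,\phi_{j,q'}=\delta_{iq,jq'}$ for all $1\le j\le m$, $1\le q'\le Q$. Constants: $C_p$ is a constant (uniform over the elements) such that $|u-\Pi_iu|_{p,2,\tau_i}\le C_ph^{k-p}_{i}|u|_{k,2,\tau_i}$, hence also $\le C_p h^{k-p}|u|_{k,2,\tau_i}$, for all $u\in H^k(D)$, all $i$ and all integers $0\le p\le k$, where $\Pi_i$ is the $L^2(\tau_i)$-orthogonal projection onto $\mathcal{P}_{k-1}(\tau_i)$. $C(k,d,\delta)$ is a constant depending only on $k,d,\delta$ such that, for every $t>0$ and every bounded open $\Omega\subset\mathbb{R}^d$ of diameter at most $t$ containing a ball of radius $\delta t/2$, every $u\in H_0^k(\Omega)$ for which $(-1)^k\sum_{|\sigma|=k}D^{2\sigma}u$ (weakly) equals a polynomial $p$ of degree at most $k-1$ satisfies $\|p\|_{L^2(\Omega)}\le C(k,d,\delta)t^{-k}|u|_{k,2,\Omega}$. *)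

theory Defs
  imports "HOL-Analysis.Analysis"
begin

type_synonym 'n multiindex = "'n \<Rightarrow> nat"

definition mi_order :: "'n::finite multiindex \<Rightarrow> nat" where
  "mi_order \<sigma> = (\<Sum>i\<in>UNIV. \<sigma> i)"

definition multiindices :: "nat \<Rightarrow> 'n::finite multiindex set" where
  "multiindices k = {\<sigma>. mi_order \<sigma> = k}"

definition partial_deriv :: "'n::finite \<Rightarrow> (real^'n \<Rightarrow> real) \<Rightarrow> real^'n \<Rightarrow> real" where
  "partial_deriv i f x = frechet_derivative f (at x) (axis i 1)"

definition smooth :: "(real^'n::finite \<Rightarrow> real) \<Rightarrow> bool" where
  "smooth f \<longleftrightarrow> (\<forall>is x. foldr partial_deriv is f differentiable (at x))"

text \<open>The classical derivative of multi-index \<open>\<sigma>\<close>. The order of differentiation is an arbitrary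
  choice; it is immaterial for smooth functions, the only ones to which this is applied.\<close>

definition mi_deriv ::
  "'n::finite multiindex \<Rightarrow> (real^'n \<Rightarrow> real) \<Rightarrow> real^'n \<Rightarrow> real" where
  "mi_deriv \<sigma> f = foldr partial_deriv (SOME is. \<forall>i. count_list is i = \<sigma> i) f"

definition test_functions :: "(real^'n::finite) set \<Rightarrow> (real^'n \<Rightarrow> real) set" where
  "test_functions \<Omega> =
     {\<phi>. smooth \<phi> \<and> compact (closure {x. \<phi> x \<noteq> 0}) \<and> closure {x. \<phi> x \<noteq> 0} \<subseteq> \<Omega>}"

definition locally_integrable_on ::
  "(real^'n::finite) set \<Rightarrow> (real^'n \<Rightarrow> real) \<Rightarrow> bool" where
  "locally_integrable_on \<Omega> u \<longleftrightarrow>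
     (\<forall>K. compact K \<and> K \<subseteq> \<Omega> \<longrightarrow> u absolutely_integrable_on K)"

definition square_integrable_on ::
  "(real^'n::finite) set \<Rightarrow> (real^'n \<Rightarrow> real) \<Rightarrow> bool" where
  "square_integrable_on \<Omega> u \<longleftrightarrow>
     set_borel_measurable lebesgue \<Omega> u \<and> set_integrable lebesgue \<Omega> (\<lambda>x. (u x)\<^sup>2)"

definition essentially_bounded_on ::
  "(real^'n::finite) set \<Rightarrow> (real^'n \<Rightarrow> real) \<Rightarrow> bool" where
  "essentially_bounded_on \<Omega> u \<longleftrightarrow>
     set_borel_measurable lebesgue \<Omega> u \<and> (\<exists>M. AE x in lebesgue. x \<in> \<Omega> \<longrightarrow> \<bar>u x\<bar> \<le> M)"

definition is_weak_deriv ::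
  "(real^'n::finite) set \<Rightarrow> 'n multiindex \<Rightarrow> (real^'n \<Rightarrow> real) \<Rightarrow> (real^'n \<Rightarrow> real) \<Rightarrow> bool" where
  "is_weak_deriv \<Omega> \<sigma> u g \<longleftrightarrow>
     locally_integrable_on \<Omega> u \<and> locally_integrable_on \<Omega> g \<and>
     (\<forall>\<phi>\<in>test_functions \<Omega>.
        (LINT x:\<Omega>|lebesgue. u x * mi_deriv \<sigma> \<phi> x)
          = (-1) ^ mi_order \<sigma> * (LINT x:\<Omega>|lebesgue. g x * \<phi> x))"

text \<open>A representative of the weak derivative in the open set \<open>\<Omega>\<close>: determined up to a null subset
  of \<open>\<Omega>\<close>, arbitrary outside \<open>\<Omega>\<close>.\<close>

definition weak_deriv ::
  "(real^'n::finite) set \<Rightarrow> 'n multiindex \<Rightarrow> (real^'n \<Rightarrow> real) \<Rightarrow> real^'n \<Rightarrow> real" where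
  "weak_deriv \<Omega> \<sigma> u = (SOME g. is_weak_deriv \<Omega> \<sigma> u g)"

text \<open>\<open>|u|\<^bsub>p,2,S\<^esub>\<close> for a function \<open>u\<close> on the open set \<open>\<Omega>\<close>, in which the weak derivatives are taken;
  \<open>S\<close> is contained in \<open>\<Omega>\<close> up to a null set.\<close>

definition sobolev_seminorm ::
  "(real^'n::finite) set \<Rightarrow> nat \<Rightarrow> (real^'n) set \<Rightarrow> (real^'n \<Rightarrow> real) \<Rightarrow> real" where
  "sobolev_seminorm \<Omega> p S u =
     sqrt (\<Sum>\<sigma>\<in>multiindices p. LINT x:S|lebesgue. (weak_deriv \<Omega> \<sigma> u x)\<^sup>2)"

definition sobolev_space :: "nat \<Rightarrow> (real^'n::finite) set \<Rightarrow> (real^'n \<Rightarrow> real) set" where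
  "sobolev_space k \<Omega> =
     {u. square_integrable_on \<Omega> u \<and>
         (\<forall>\<sigma>. mi_order \<sigma> \<le> k \<longrightarrow> (\<exists>g. square_integrable_on \<Omega> g \<and> is_weak_deriv \<Omega> \<sigma> u g))}"

definition sobolev_norm :: "nat \<Rightarrow> (real^'n::finite) set \<Rightarrow> (real^'n \<Rightarrow> real) \<Rightarrow> real" where
  "sobolev_norm k \<Omega> u = sqrt (\<Sum>p\<le>k. (sobolev_seminorm \<Omega> p \<Omega> u)\<^sup>2)"

definition sobolev_space_0 :: "nat \<Rightarrow> (real^'n::finite) set \<Rightarrow> (real^'n \<Rightarrow> real) set" where
  "sobolev_space_0 k \<Omega> =
     {u \<in> sobolev_space k \<Omega>.
        \<forall>\<epsilon>>0. \<exists>\<phi>\<in>test_functions \<Omega>. sobolev_norm k \<Omega> (\<lambda>x. u x - \<phi> x) < \<epsilon>}"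

text \<open>Polynomial functions in \<open>CARD('n)\<close> variables of total degree at most \<open>n\<close>.\<close>

definition polys :: "nat \<Rightarrow> (real^'n::finite \<Rightarrow> real) set" where
  "polys n = range (\<lambda>c x. \<Sum>\<sigma> | mi_order \<sigma> \<le> n. c \<sigma> * (\<Prod>i\<in>UNIV. (x $ i) ^ \<sigma> i))"

definition is_L2_projection ::
  "nat \<Rightarrow> (real^'n::finite) set \<Rightarrow> (real^'n \<Rightarrow> real) \<Rightarrow> (real^'n \<Rightarrow> real) \<Rightarrow> bool" where
  "is_L2_projection n S u P \<longleftrightarrow>
     P \<in> polys n \<and> (\<forall>g\<in>polys n. (LINT x:S|lebesgue. (u x - P x) * g x) = 0)"

text \<open>Coefficients \<open>a \<sigma> \<gamma> x\<close> matter only for \<open>\<sigma>, \<gamma>\<close> of order \<open>k\<close> and \<open>x \<in> D\<close>.\<close>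

type_synonym 'n coeffs = "'n multiindex \<Rightarrow> 'n multiindex \<Rightarrow> real^'n \<Rightarrow> real"

text \<open>The bilinear form of
  \<open>u \<mapsto> (-1)\<^sup>k \<Sum> D\<^sup>\<sigma> (a \<sigma> \<gamma> D\<^sup>\<gamma> u)\<close>, sum over \<open>\<sigma>, \<gamma>\<close> of order \<open>k\<close>.\<close>

definition bilinear_form ::
  "nat \<Rightarrow> (real^'n::finite) set \<Rightarrow> 'n coeffs \<Rightarrow> (real^'n \<Rightarrow> real) \<Rightarrow> (real^'n \<Rightarrow> real) \<Rightarrow> real" where
  "bilinear_form k D a u v =
     (\<Sum>\<sigma>\<in>multiindices k. \<Sum>\<gamma>\<in>multiindices k.
        LINT x:D|lebesgue. a \<sigma> \<gamma> x * weak_deriv D \<sigma> u x * weak_deriv D \<gamma> v x)"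

definition self_adjoint_form :: "nat \<Rightarrow> (real^'n::finite) set \<Rightarrow> 'n coeffs \<Rightarrow> bool" where
  "self_adjoint_form k D a \<longleftrightarrow>
     (\<forall>u\<in>sobolev_space_0 k D. \<forall>v\<in>sobolev_space_0 k D.
        bilinear_form k D a u v = bilinear_form k D a v u)"

text \<open>The squared local energy norm \<open>\<parallel>\<psi>\<parallel>\<^sup>2\<close> on \<open>S \<subseteq> D\<close>.\<close>

definition local_energy ::
  "nat \<Rightarrow> (real^'n::finite) set \<Rightarrow> 'n coeffs \<Rightarrow> (real^'n) set \<Rightarrow> (real^'n \<Rightarrow> real) \<Rightarrow> real" where
  "local_energy k D a S \<psi> =
     (\<Sum>\<sigma>\<in>multiindices k. \<Sum>\<gamma>\<in>multiindices k.
        LINT x:S|lebesgue. a \<sigma> \<gamma> x * weak_deriv D \<sigma> \<psi> x * weak_deriv D \<gamma> \<psi> x)"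

definition bounded_above_form ::
  "nat \<Rightarrow> (real^'n::finite) set \<Rightarrow> 'n coeffs \<Rightarrow> real \<Rightarrow> bool" where
  "bounded_above_form k D a \<theta> \<longleftrightarrow>
     (\<forall>x\<in>D. \<forall>\<zeta>. (\<Sum>\<sigma>\<in>multiindices k. \<Sum>\<gamma>\<in>multiindices k. a \<sigma> \<gamma> x * \<zeta> \<sigma> * \<zeta> \<gamma>)
        \<le> \<theta> * (\<Sum>\<sigma>\<in>multiindices k. (\<zeta> \<sigma>)\<^sup>2))"

definition strongly_elliptic ::
  "nat \<Rightarrow> (real^'n::finite) set \<Rightarrow> 'n coeffs \<Rightarrow> real \<Rightarrow> bool" where
  "strongly_elliptic k D a \<theta> \<longleftrightarrow>
     (\<forall>x\<in>D. \<forall>\<zeta>. (\<Sum>\<sigma>\<in>multiindices k. \<Sum>\<gamma>\<in>multiindices k. a \<sigma> \<gamma> x * \<zeta> \<sigma> * \<zeta> \<gamma>)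
        \<ge> \<theta> * (\<Sum>\<sigma>\<in>multiindices k. (\<zeta> \<sigma>)\<^sup>2))"

text \<open>The largest diameter of a ball contained in \<open>S\<close> (attained if \<open>S\<close> is compact and nonempty).\<close>

definition inscribed_diameter :: "(real^'n::finite) set \<Rightarrow> real" where
  "inscribed_diameter S = Sup {2 * s | s z. 0 \<le> s \<and> cball z s \<subseteq> S}"

text \<open>Division of \<open>D\<close> into closed elements \<open>\<tau> 1, \<dots>, \<tau> m\<close>. The shape of the elements is left open
  (no fixed list of polytopes makes sense in arbitrary dimension); they are required to overlap in
  null sets only.\<close>

definition partition_of :: "(real^'n::finite) set \<Rightarrow> nat \<Rightarrow> (nat \<Rightarrow> (real^'n) set) \<Rightarrow> bool" where
  "partition_of D m \<tau> \<longleftrightarrow>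
     (\<forall>i\<in>{1..m}. compact (\<tau> i) \<and> interior (\<tau> i) \<subseteq> D \<and> negligible (frontier (\<tau> i))) \<and>
     (\<Union>i\<in>{1..m}. \<tau> i) = closure D \<and>
     (\<forall>i\<in>{1..m}. \<forall>j\<in>{1..m}. i \<noteq> j \<longrightarrow> interior (\<tau> i) \<inter> interior (\<tau> j) = {})"

definition mesh_size :: "nat \<Rightarrow> (nat \<Rightarrow> (real^'n::finite) set) \<Rightarrow> real" where
  "mesh_size m \<tau> = (MAX i\<in>{1..m}. diameter (\<tau> i))"

definition regular_partition ::
  "(real^'n::finite) set \<Rightarrow> nat \<Rightarrow> (nat \<Rightarrow> (real^'n) set) \<Rightarrow> real \<Rightarrow> bool" where
  "regular_partition D m \<tau> \<delta> \<longleftrightarrow>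
     partition_of D m \<tau> \<and> (\<forall>i\<in>{1..m}. inscribed_diameter (\<tau> i) / diameter (\<tau> i) \<ge> \<delta>)"

definition poly_dim :: "'n::finite itself \<Rightarrow> nat \<Rightarrow> nat" where
  "poly_dim _ k = (k + CARD('n) - 1) choose CARD('n)"

text \<open>\<open>\<phi> i 1, \<dots>, \<phi> i Q\<close> is a basis of the polynomials of degree at most \<open>k - 1\<close> on \<open>\<tau> i\<close>,
  extended by zero, orthogonal with squared norm \<open>|\<tau> i|\<close>.\<close>

definition local_poly_basis ::
  "nat \<Rightarrow> nat \<Rightarrow> (nat \<Rightarrow> (real^'n::finite) set) \<Rightarrow> (nat \<Rightarrow> nat \<Rightarrow> real^'n \<Rightarrow> real) \<Rightarrow> bool" where
  "local_poly_basis k m \<tau> \<phi> \<longleftrightarrow>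
     (let Q = poly_dim TYPE('n) k in
       \<forall>i\<in>{1..m}.
         (\<forall>q\<in>{1..Q}. \<exists>p\<in>polys (k - 1). \<phi> i q = (\<lambda>x. if x \<in> \<tau> i then p x else 0)) \<and>
         (\<forall>p\<in>polys (k - 1). \<exists>!c. (\<forall>q. q \<notin> {1..Q} \<longrightarrow> c q = 0) \<and>
            (\<forall>x\<in>\<tau> i. p x = (\<Sum>q\<in>{1..Q}. c q * \<phi> i q x))) \<and>
         (\<forall>q\<in>{1..Q}. \<forall>q'\<in>{1..Q}.
            (LINT x:\<tau> i|lebesgue. \<phi> i q x * \<phi> i q' x)
              = (if q = q' then measure lebesgue (\<tau> i) else 0)))"

definition admissible ::
  "nat \<Rightarrow> (real^'n::finite) set \<Rightarrow> nat \<Rightarrow> (nat \<Rightarrow> nat \<Rightarrow> real^'n \<Rightarrow> real) \<Rightarrow> nat \<Rightarrow> nat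
     \<Rightarrow> (real^'n \<Rightarrow> real) set" where
  "admissible k D m \<phi> i q =
     {\<psi> \<in> sobolev_space_0 k D.
        \<forall>j\<in>{1..m}. \<forall>q'\<in>{1..poly_dim TYPE('n) k}.
          (LINT x:D|lebesgue. \<psi> x * \<phi> j q' x) = (if i = j \<and> q = q' then 1 else 0)}"

definition is_basis_minimizer ::
  "nat \<Rightarrow> (real^'n::finite) set \<Rightarrow> 'n coeffs \<Rightarrow> nat \<Rightarrow> (nat \<Rightarrow> nat \<Rightarrow> real^'n \<Rightarrow> real)
     \<Rightarrow> nat \<Rightarrow> nat \<Rightarrow> (real^'n \<Rightarrow> real) \<Rightarrow> bool" where
  "is_basis_minimizer k D a m \<phi> i q \<psi> \<longleftrightarrow>
     \<psi> \<in> admissible k D m \<phi> i q \<and>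
     (\<forall>v\<in>admissible k D m \<phi> i q. bilinear_form k D a \<psi> \<psi> \<le> bilinear_form k D a v v)"

definition projection_constant ::
  "nat \<Rightarrow> (real^'n::finite) set \<Rightarrow> nat \<Rightarrow> (nat \<Rightarrow> (real^'n) set) \<Rightarrow> real \<Rightarrow> bool" where
  "projection_constant k D m \<tau> C \<longleftrightarrow>
     (\<forall>u\<in>sobolev_space k D. \<forall>i\<in>{1..m}. \<forall>p\<le>k. \<forall>P. is_L2_projection (k - 1) (\<tau> i) u P \<longrightarrow>
        sobolev_seminorm D p (\<tau> i) (\<lambda>x. u x - P x)
          \<le> C * diameter (\<tau> i) ^ (k - p) * sobolev_seminorm D k (\<tau> i) u)"

text \<open>\<open>u\<close> is a weak solution of \<open>(-1)\<^sup>k \<Sum> D\<^sup>2\<^sup>\<sigma> u = p\<close> in \<open>\<Omega>\<close>, sum over \<open>\<sigma>\<close> of order \<open>k\<close>.\<close>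

definition weak_polyharmonic_eq ::
  "nat \<Rightarrow> (real^'n::finite) set \<Rightarrow> (real^'n \<Rightarrow> real) \<Rightarrow> (real^'n \<Rightarrow> real) \<Rightarrow> bool" where
  "weak_polyharmonic_eq k \<Omega> u p \<longleftrightarrow>
     (\<forall>\<phi>\<in>test_functions \<Omega>.
        (\<Sum>\<sigma>\<in>multiindices k. LINT x:\<Omega>|lebesgue. weak_deriv \<Omega> \<sigma> u x * mi_deriv \<sigma> \<phi> x)
          = (LINT x:\<Omega>|lebesgue. p x * \<phi> x))"

definition inverse_estimate_constant :: "'n::finite itself \<Rightarrow> nat \<Rightarrow> real \<Rightarrow> real \<Rightarrow> bool" where
  "inverse_estimate_constant _ k \<delta> C \<longleftrightarrow>
     (\<forall>t>0. \<forall>\<Omega>::(real^'n) set. \<forall>u p.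
        open \<Omega> \<and> bounded \<Omega> \<and> diameter \<Omega> \<le> t \<and> (\<exists>z. ball z (\<delta> * t / 2) \<subseteq> \<Omega>) \<and>
        u \<in> sobolev_space_0 k \<Omega> \<and> p \<in> polys (k - 1) \<and> weak_polyharmonic_eq k \<Omega> u p \<longrightarrow>
        sqrt (LINT x:\<Omega>|lebesgue. (p x)\<^sup>2) \<le> C / t ^ k * sobolev_seminorm \<Omega> k \<Omega> u)"

end

theory Submission
  imports Defs
begin

text \<open>Let \<open>\<psi> = \<psi>\<^bsub>i,q\<^esub>\<close> and let \<open>\<eta>\<close> be a cutoff that vanishes near \<open>x i\<close> and equals \<open>1\<close> outside a larger ball, with
  transition in an annulus of width about \<open>l h\<close>. By minimality, \<open>\<L> \<psi>\<close> is a polynomial \<open>p\<^sub>j\<close> of degree less than \<open>k\<close> on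
  each element, so \<open>B(\<psi>, \<eta> \<psi>) = \<Sum>\<^sub>j \<integral> p\<^sub>j \<eta> \<psi>\<close>. As \<open>\<psi>\<close> is orthogonal to such polynomials on \<open>\<tau>\<^sub>j\<close> for \<open>j \<noteq> i\<close>, only
  the elements in the annulus contribute, and there \<open>\<eta>\<close> may be replaced by its oscillation, of size \<open>1 / l\<close>. Expanding
  \<open>B(\<psi>, \<eta> \<psi>)\<close> by the Leibniz rule leaves the energy outside the annulus plus commutator terms carrying derivatives of
  \<open>\<eta>\<close>, which the projection estimate also makes of size \<open>1 / l\<close> times the energy in the annulus. To bound \<open>p\<^sub>j\<close>, solve
  \<open>(-1)\<^sup>k \<Sum> D\<^sup>2\<^sup>\<sigma> w = p\<^sub>j\<close> in the interior of \<open>\<tau>\<^sub>j\<close>: then \<open>|w|\<^sub>k\<^sup>2 = \<integral> p\<^sub>j w = B(\<psi>, w)\<close> bounds \<open>|w|\<^sub>k\<close> by the energy of \<open>\<psi>\<close>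
  on \<open>\<tau>\<^sub>j\<close>, and the inverse estimate applies to \<open>w\<close>. Hence the energy outside a ball drops by a factor \<open>exp (- 1)\<close> with
  each increase of the radius by \<open>l h\<close>.\<close>

section \<open>Smooth functions and test functions\<close>

text \<open>The rate comes from hole filling. With E(R) the energy outside the ball of radius R, all
  error terms live in an annulus, so the estimate reads E(R + l h) \<le> M (E(R) - E(R + l h)). Once
  M \<le> 1 / (e - 1), moving the negative term to the left yields the factor exp (-1); this is the
  origin of e - 1. Two obstacles shape the proof. Symmetry of the coefficients is given only through
  the form on all of D, so on a single element Cauchy-Schwarz with \<open>\<theta>max\<close> is
  applied to the symmetrized form \<open>Es\<close>, which agrees with the bilinear form on D. The
  constants \<open>Cp\<close> and \<open>C\<close> carry no sign; it is extracted from the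
  inequalities that they satisfy. Elements of H_0^k are handled through sequences of test functions:
  products with cutoffs, the solution of the auxiliary problem and its extension by zero to D are
  all obtained in this way. That solution minimizes the Dirichlet functional; the Poincare
  inequality and completeness of L2 give the limit. The constants are C1 = 1 and
  \<open>C\<^sub>\<eta> = 2 * K1 K + 4\<close>, where K bounds the scaled derivatives of the
  cutoff.\<close>

lemma partial_deriv_eqI: "(f has_derivative f') (at x) \<Longrightarrow> partial_deriv i f x = f' (axis i 1)"
  unfolding partial_deriv_def by (drule frechet_derivative_at) simp

abbreviation diffable :: "(real^'n::finite \<Rightarrow> real) \<Rightarrow> bool" where
  "diffable f \<equiv> \<forall>x. f differentiable (at x)"

lemma diffableD: "f differentiable (at x) \<Longrightarrow> (f has_derivative frechet_derivative f (at x)) (at x)"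
  by (simp add: frechet_derivative_works)

lemma partial_deriv_add:
  assumes "diffable f" "diffable g"
  shows "partial_deriv i (\<lambda>x. f x + g x) = (\<lambda>x. partial_deriv i f x + partial_deriv i g x)"
proof
  fix x
  show "partial_deriv i (\<lambda>x. f x + g x) x = partial_deriv i f x + partial_deriv i g x"
    using assms partial_deriv_eqI[OF has_derivative_add[OF diffableD diffableD], of f x g i]
    by (simp add: partial_deriv_def)
qed

lemma partial_deriv_mult:
  assumes "diffable f" "diffable g"
  shows "partial_deriv i (\<lambda>x. f x * g x) = (\<lambda>x. partial_deriv i f x * g x + f x * partial_deriv i g x)"
proof
  fix x
  show "partial_deriv i (\<lambda>x. f x * g x) x = partial_deriv i f x * g x + f x * partial_deriv i g x"
    using assms partial_deriv_eqI[OF has_derivative_mult[OF diffableD diffableD], of f x g i]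
    by (simp add: partial_deriv_def)
qed

lemma partial_deriv_const: "partial_deriv i (\<lambda>x. c) = (\<lambda>x. 0)"
  by (rule ext, rule partial_deriv_eqI[THEN trans, OF has_derivative_const]) simp

lemma partial_deriv_coord: "partial_deriv i (\<lambda>x::real^'n::finite. x $ j) = (\<lambda>x. if i = j then 1 else 0)"
proof
  fix x :: "real^'n"
  have "((\<lambda>x. x $ j) has_derivative (\<lambda>x. x $ j)) (at x)" for x :: "real^'n"
    by (intro bounded_linear_imp_has_derivative bounded_linear_vec_nth)
  from partial_deriv_eqI[OF this]
  show "partial_deriv i (\<lambda>x. x $ j) x = (if i = j then 1 else 0)" by (simp add: axis_def)
qed

lemma diffable_comp:
  assumes "\<And>t. (F has_real_derivative F' t) (at t)" "diffable g"
  shows "diffable (\<lambda>x. F (g x))"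
    and "partial_deriv i (\<lambda>x. F (g x)) = (\<lambda>x. F' (g x) * partial_deriv i g x)"
proof -
  have *: "((\<lambda>x. F (g x)) has_derivative (\<lambda>h. F' (g x) * frechet_derivative g (at x) h)) (at x)" for x
    using has_derivative_compose[OF diffableD, of g x F "\<lambda>h. F' (g x) * h"] assms
    by (auto simp: has_field_derivative_def)
  then show "diffable (\<lambda>x. F (g x))" by (auto simp: differentiable_def)
  show "partial_deriv i (\<lambda>x. F (g x)) = (\<lambda>x. F' (g x) * partial_deriv i g x)"
    using partial_deriv_eqI[OF *] by (auto simp: partial_deriv_def)
qed

abbreviation pderivs :: "'n::finite list \<Rightarrow> (real^'n \<Rightarrow> real) \<Rightarrow> real^'n \<Rightarrow> real" where
  "pderivs is \<equiv> foldr partial_deriv is"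

lemma smooth_partial_deriv:
  assumes "smooth f" shows "smooth (partial_deriv i f)"
  unfolding smooth_def
proof (intro allI)
  fix "is" x
  have "pderivs (is @ [i]) f differentiable (at x)"
    using assms unfolding smooth_def by blast
  then show "pderivs is (partial_deriv i f) differentiable (at x)" by simp
qed

lemma smooth_pderivs: "smooth f \<Longrightarrow> smooth (pderivs is f)"
  by (induction "is") (auto intro: smooth_partial_deriv)

lemma smooth_diffable: "smooth f \<Longrightarrow> diffable f"
  unfolding smooth_def by (auto dest: spec[of _ "[]"])

lemma smooth_continuous: "smooth f \<Longrightarrow> continuous_on S f"
  by (meson smooth_diffable differentiable_imp_continuous_on differentiable_at_imp_differentiable_on)

lemma smooth_measurable: "smooth f \<Longrightarrow> f \<in> borel_measurable borel"
  by (meson smooth_continuous borel_measurable_continuous_onI)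

text \<open>Smoothness is the largest property that implies differentiability and is stable under
  partial derivatives, so exhibiting an invariant is enough.\<close>

lemma smooth_coinduct:
  assumes "R f" "\<And>f. R f \<Longrightarrow> diffable f" "\<And>f i. R f \<Longrightarrow> R (partial_deriv i f)"
  shows "smooth f"
proof -
  have "R (pderivs is f)" for "is"
    by (induction "is") (auto simp: assms)
  then show ?thesis unfolding smooth_def using assms(2) by blast
qed

lemma smooth_const: "smooth (\<lambda>x. c)"
  by (rule smooth_coinduct[where R = "\<lambda>f. \<exists>c. f = (\<lambda>x. c)"]) (auto simp: partial_deriv_const)

lemma smooth_coord: "smooth (\<lambda>x. x $ j)"
  by (rule smooth_coinduct[where R = "\<lambda>f. f = (\<lambda>x. x $ j) \<or> (\<exists>c. f = (\<lambda>x. c))"])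
    (auto simp: partial_deriv_const partial_deriv_coord
      intro: bounded_linear_imp_differentiable bounded_linear_vec_nth)

lemma smooth_add: "smooth f \<Longrightarrow> smooth g \<Longrightarrow> smooth (\<lambda>x. f x + g x)"
proof (rule smooth_coinduct[where R = "\<lambda>h. \<exists>f g. smooth f \<and> smooth g \<and> h = (\<lambda>x. f x + g x)"], goal_cases)
  case 1 then show ?case by blast
next
  case (2 h) then show ?case by (auto dest!: smooth_diffable)
next
  case (3 h i)
  then obtain f g where "smooth f" "smooth g" "h = (\<lambda>x. f x + g x)" by blast
  then show ?case
    by (intro exI[of _ "partial_deriv i f"] exI[of _ "partial_deriv i g"])
      (auto intro: smooth_partial_deriv simp: partial_deriv_add smooth_diffable)
qed

text \<open>A partial derivative of a product is a sum of two products, so the shape of a product is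
  not invariant under differentiation. Counting the available derivatives allows an induction on the
  order instead.\<close>

primrec smooth_upto :: "nat \<Rightarrow> (real^'n::finite \<Rightarrow> real) \<Rightarrow> bool" where
  "smooth_upto 0 f \<longleftrightarrow> diffable f"
| "smooth_upto (Suc n) f \<longleftrightarrow> diffable f \<and> (\<forall>i. smooth_upto n (partial_deriv i f))"

lemma smooth_upto_diffable: "smooth_upto n f \<Longrightarrow> diffable f"
  by (cases n) auto

lemma smooth_upto_Suc: "smooth_upto (Suc n) f \<Longrightarrow> smooth_upto n f"
proof (induction n arbitrary: f)
  case (Suc n)
  then have "diffable f" "\<And>i. smooth_upto (Suc n) (partial_deriv i f)"
    unfolding smooth_upto.simps(2)[of "Suc n"] by blast+
  then show ?case using Suc.IH by simp
qed simp

lemma smooth_imp_smooth_upto: "smooth f \<Longrightarrow> smooth_upto n f"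
  by (induction n arbitrary: f) (auto dest: smooth_diffable intro: smooth_partial_deriv)

lemma smooth_upto_imp_smooth:
  assumes "\<And>n. smooth_upto n f" shows "smooth f"
proof (rule smooth_coinduct[where R = "\<lambda>f. \<forall>n. smooth_upto n f"], goal_cases)
  case 1 then show ?case using assms by blast
next
  case (2 f) then show ?case using smooth_upto_diffable by blast
next
  case (3 f i) then show ?case using smooth_upto.simps(2) by blast
qed

lemma smooth_upto_add: "smooth_upto n f \<Longrightarrow> smooth_upto n g \<Longrightarrow> smooth_upto n (\<lambda>x. f x + g x)"
  by (induction n arbitrary: f g) (auto simp: partial_deriv_add)

lemma smooth_upto_mult: "smooth_upto n f \<Longrightarrow> smooth_upto n g \<Longrightarrow> smooth_upto n (\<lambda>x. f x * g x)"
proof (induction n arbitrary: f g)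
  case (Suc n)
  have "smooth_upto n f" "smooth_upto n g" using Suc.prems smooth_upto_Suc by blast+
  with Suc show ?case by (auto simp: partial_deriv_mult intro!: smooth_upto_add)
qed auto

lemma smooth_mult: "smooth f \<Longrightarrow> smooth g \<Longrightarrow> smooth (\<lambda>x. f x * g x)"
  by (rule smooth_upto_imp_smooth) (simp add: smooth_upto_mult smooth_imp_smooth_upto)

text \<open>\<open>F\<close> is a tower of successive derivatives and \<open>m\<close> stays free:
  the chain rule turns level \<open>m\<close> into level \<open>Suc m\<close> times a smooth factor,
  so the induction needs the claim at every level.\<close>

lemma smooth_comp:
  assumes F: "\<And>m t. (F m has_real_derivative F (Suc m) t) (at t)" and g: "smooth g"
  shows "smooth (\<lambda>x. F m (g x))"
proof (rule smooth_upto_imp_smooth)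
  fix n
  show "smooth_upto n (\<lambda>x. F m (g x))"
  proof (induction n arbitrary: m)
    case 0
    show ?case using diffable_comp(1)[OF F smooth_diffable[OF g]] by simp
  next
    case (Suc n)
    show ?case
      using diffable_comp[OF F smooth_diffable[OF g]] Suc
        smooth_imp_smooth_upto[OF smooth_partial_deriv[OF g]]
      by (auto intro!: smooth_upto_mult)
  qed
qed

lemma smooth_cmult: "smooth f \<Longrightarrow> smooth (\<lambda>x. c * f x)"
  by (intro smooth_mult smooth_const)

lemma smooth_diff: "smooth f \<Longrightarrow> smooth g \<Longrightarrow> smooth (\<lambda>x. f x - g x)"
  using smooth_add[of f "\<lambda>x. (-1) * g x"] smooth_cmult[of g "-1"] by simp

lemma smooth_sum: "(\<And>i. i \<in> A \<Longrightarrow> smooth (f i)) \<Longrightarrow> smooth (\<lambda>x. \<Sum>i\<in>A. f i x)"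
  by (induction A rule: infinite_finite_induct) (auto intro: smooth_const smooth_add)

lemma smooth_prod: "(\<And>i. i \<in> A \<Longrightarrow> smooth (f i)) \<Longrightarrow> smooth (\<lambda>x. \<Prod>i\<in>A. f i x)"
  by (induction A rule: infinite_finite_induct) (auto intro: smooth_const smooth_mult)

section \<open>Linearity and the Leibniz rule for iterated derivatives\<close>

lemma pderivs_add:
  assumes "smooth f" "smooth g"
  shows "pderivs is (\<lambda>x. f x + g x) = (\<lambda>x. pderivs is f x + pderivs is g x)"
  by (induction "is") (auto simp: partial_deriv_add smooth_diffable smooth_pderivs assms)

lemma partial_deriv_cmult:
  assumes "diffable f" shows "partial_deriv i (\<lambda>x. c * f x) = (\<lambda>x. c * partial_deriv i f x)"
  using partial_deriv_mult[of "\<lambda>x. c" f i] assms by (simp add: partial_deriv_const)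

lemma pderivs_cmult:
  assumes "smooth f"
  shows "pderivs is (\<lambda>x. c * f x) = (\<lambda>x. c * pderivs is f x)"
  by (induction "is") (auto simp: partial_deriv_cmult smooth_diffable smooth_pderivs assms)

lemma pderivs_diff:
  assumes "smooth f" "smooth g"
  shows "pderivs is (\<lambda>x. f x - g x) = (\<lambda>x. pderivs is f x - pderivs is g x)"
  using pderivs_add[OF assms(1) smooth_cmult[OF assms(2), of "-1"], of "is"]
    pderivs_cmult[OF assms(2), of "is" "-1"] by simp

lemma pderivs_zero: "pderivs is (\<lambda>x. 0) = (\<lambda>x. 0)"
  by (induction "is") (auto simp: partial_deriv_const)

lemma pderivs_sum:
  assumes "finite A" "\<And>i. i \<in> A \<Longrightarrow> smooth (f i)"
  shows "pderivs is (\<lambda>x. \<Sum>i\<in>A. f i x) = (\<lambda>x. \<Sum>i\<in>A. pderivs is (f i) x)"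
  using assms
  by (induction A) (auto simp: pderivs_zero pderivs_add smooth_sum)

text \<open>Each direction goes to the first or to the second factor. This enumerates the Leibniz
  formula with one summand per choice and no binomial coefficients.\<close>

primrec splits :: "'a list \<Rightarrow> ('a list \<times> 'a list) list" where
  "splits [] = [([], [])]"
| "splits (i # is) = map (\<lambda>(a, b). (i # a, b)) (splits is) @ map (\<lambda>(a, b). (a, i # b)) (splits is)"

lemma partial_deriv_sum_list:
  assumes "\<And>c. c \<in> set cs \<Longrightarrow> smooth (g c)"
  shows "smooth (\<lambda>x. \<Sum>c\<leftarrow>cs. g c x)"
    and "partial_deriv i (\<lambda>x. \<Sum>c\<leftarrow>cs. g c x) = (\<lambda>x. \<Sum>c\<leftarrow>cs. partial_deriv i (g c) x)"
proof -
  have "smooth (\<lambda>x. \<Sum>c\<leftarrow>cs. g c x) \<and>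
     partial_deriv i (\<lambda>x. \<Sum>c\<leftarrow>cs. g c x) = (\<lambda>x. \<Sum>c\<leftarrow>cs. partial_deriv i (g c) x)"
    using assms
    by (induction cs) (auto simp: partial_deriv_const smooth_const smooth_add partial_deriv_add smooth_diffable)
  then show "smooth (\<lambda>x. \<Sum>c\<leftarrow>cs. g c x)"
     "partial_deriv i (\<lambda>x. \<Sum>c\<leftarrow>cs. g c x) = (\<lambda>x. \<Sum>c\<leftarrow>cs. partial_deriv i (g c) x)" by auto
qed

lemma pderivs_mult:
  assumes "smooth f" "smooth g"
  shows "pderivs is (\<lambda>x. f x * g x) = (\<lambda>x. \<Sum>(a, b)\<leftarrow>splits is. pderivs a f x * pderivs b g x)"
proof (induction "is")
  case (Cons i "is")
  have "pderivs (i # is) (\<lambda>x. f x * g x)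
    = partial_deriv i (\<lambda>x. \<Sum>c\<leftarrow>splits is. pderivs (fst c) f x * pderivs (snd c) g x)"
    using Cons by (simp add: case_prod_beta)
  also have "\<dots> = (\<lambda>x. \<Sum>c\<leftarrow>splits is. pderivs (i # fst c) f x * pderivs (snd c) g x
      + pderivs (fst c) f x * pderivs (i # snd c) g x)"
    by (subst partial_deriv_sum_list(2))
      (auto simp: smooth_mult smooth_pderivs assms partial_deriv_mult smooth_diffable)
  finally show ?case by (simp add: sum_list_addf o_def case_prod_beta)
qed simp

text \<open>Isolates the Leibniz term in which no derivative falls on the first factor. When that
  factor is a cutoff, the other terms form the commutator, and each of them contains at least one
  derivative of the cutoff.\<close>

lemma splits_head:
  "\<exists>ss. splits is = ss @ [([], is)] \<and> (\<forall>(a, b)\<in>set ss. a \<noteq> [] \<and> length a + length b = length is)"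
proof (induction "is")
  case (Cons i "is")
  then obtain ss where "splits is = ss @ [([], is)]"
    "\<forall>(a, b)\<in>set ss. a \<noteq> [] \<and> length a + length b = length is" by blast
  then show ?case
    by (intro exI[of _ "map (\<lambda>(a, b). (i # a, b)) (splits is) @ map (\<lambda>(a, b). (a, i # b)) ss"]) auto
qed simp

section \<open>Symmetry of mixed partial derivatives\<close>

lemma line_deriv:
  assumes "smooth f"
  shows "((\<lambda>t. f (y + t *\<^sub>R axis i 1)) has_real_derivative partial_deriv i f (y + t *\<^sub>R axis i 1)) (at t)"
proof -
  have g: "((\<lambda>t. y + t *\<^sub>R axis i 1) has_derivative (\<lambda>h. h *\<^sub>R axis i 1)) (at t)"
    by (auto intro!: derivative_eq_intros)
  let ?f' = "frechet_derivative f (at (y + t *\<^sub>R axis i 1))"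
  have f: "(f has_derivative ?f') (at (y + t *\<^sub>R axis i 1))"
    using assms smooth_diffable diffableD by blast
  have "((\<lambda>t. f (y + t *\<^sub>R axis i 1)) has_derivative (\<lambda>h. ?f' (h *\<^sub>R axis i 1))) (at t)"
    using has_derivative_compose[OF g f] .
  moreover have "?f' (h *\<^sub>R axis i 1) = partial_deriv i f (y + t *\<^sub>R axis i 1) * h" for h
    using linear_scale[OF has_derivative_linear[OF f], of h "axis i 1"] by (simp add: partial_deriv_def)
  ultimately show ?thesis by (simp add: has_field_derivative_def)
qed

text \<open>The mean value theorem is applied in direction \<open>i\<close> to the increment of
  \<open>f\<close> in direction \<open>j\<close>, and then in direction \<open>j\<close> to the
  partial derivative that results.\<close>

lemma second_difference:
  assumes f: "smooth f" and h: "0 < h"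
  obtains \<xi> \<zeta> where "0 < \<xi>" "\<xi> < h" "0 < \<zeta>" "\<zeta> < h"
    "f (x + h *\<^sub>R axis i 1 + h *\<^sub>R axis j 1) - f (x + h *\<^sub>R axis i 1) - f (x + h *\<^sub>R axis j 1) + f x
      = h * h * partial_deriv j (partial_deriv i f) (x + \<xi> *\<^sub>R axis i 1 + \<zeta> *\<^sub>R axis j 1)"
proof -
  let ?g = "\<lambda>u. f (x + h *\<^sub>R axis j 1 + u *\<^sub>R axis i 1) - f (x + u *\<^sub>R axis i 1)"
  let ?g' = "\<lambda>u. partial_deriv i f (x + h *\<^sub>R axis j 1 + u *\<^sub>R axis i 1) - partial_deriv i f (x + u *\<^sub>R axis i 1)"
  have "\<exists>z. 0 < z \<and> z < h \<and> ?g h - ?g 0 = (h - 0) * ?g' z"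
    by (rule MVT2[OF h]) (intro DERIV_diff line_deriv[OF f])
  then obtain \<xi> where \<xi>: "0 < \<xi>" "\<xi> < h" "?g h - ?g 0 = h * ?g' \<xi>" by auto
  let ?k = "\<lambda>v. partial_deriv i f (x + \<xi> *\<^sub>R axis i 1 + v *\<^sub>R axis j 1)"
  let ?k' = "\<lambda>v. partial_deriv j (partial_deriv i f) (x + \<xi> *\<^sub>R axis i 1 + v *\<^sub>R axis j 1)"
  have "\<exists>z. 0 < z \<and> z < h \<and> ?k h - ?k 0 = (h - 0) * ?k' z"
    by (rule MVT2[OF h]) (intro line_deriv[OF smooth_partial_deriv[OF f]])
  then obtain \<zeta> where \<zeta>: "0 < \<zeta>" "\<zeta> < h" "?k h - ?k 0 = h * ?k' \<zeta>" by auto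
  have "?g' \<xi> = ?k h - ?k 0" by (simp add: algebra_simps)
  with \<xi> \<zeta> have "?g h - ?g 0 = h * (h * ?k' \<zeta>)" by simp
  then show ?thesis
    by (intro that[OF \<xi>(1,2) \<zeta>(1,2)]) (simp add: algebra_simps)
qed

text \<open>The second difference is symmetric in the two directions, so the two mixed derivatives
  share a value at points within distance 2 h of \<open>x\<close>. Both are continuous, and h tends
  to 0.\<close>

lemma partial_deriv_commute:
  fixes f :: "real^'n::finite \<Rightarrow> real"
  assumes f: "smooth f"
  shows "partial_deriv i (partial_deriv j f) = partial_deriv j (partial_deriv i f)"
proof
  fix x
  let ?G = "partial_deriv i (partial_deriv j f)" and ?H = "partial_deriv j (partial_deriv i f)"
  define h where "h n = inverse (real (Suc n))" for n
  have h: "h n > 0" for n by (simp add: h_def)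
  have "\<exists>y z. ?G y = ?H z \<and> dist y x \<le> 2 * h n \<and> dist z x \<le> 2 * h n" for n
  proof -
    have dist: "dist (x + a *\<^sub>R axis p 1 + b *\<^sub>R axis q 1) x \<le> 2 * h n"
      if "0 < a" "a < h n" "0 < b" "b < h n" for a b and p q :: 'n
    proof -
      have "norm (a *\<^sub>R axis p (1::real) + b *\<^sub>R axis q 1) \<le> a + b"
        using that by (intro norm_triangle_le) auto
      then show ?thesis using that by (simp add: dist_norm add.assoc)
    qed
    obtain \<xi> \<zeta> where 1: "0 < \<xi>" "\<xi> < h n" "0 < \<zeta>" "\<zeta> < h n"
      "f (x + h n *\<^sub>R axis i 1 + h n *\<^sub>R axis j 1) - f (x + h n *\<^sub>R axis i 1) - f (x + h n *\<^sub>R axis j 1) + f x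
      = h n * h n * ?H (x + \<xi> *\<^sub>R axis i 1 + \<zeta> *\<^sub>R axis j 1)"
      by (rule second_difference[OF f h[of n], of x i j])
    obtain \<xi>' \<zeta>' where 2: "0 < \<xi>'" "\<xi>' < h n" "0 < \<zeta>'" "\<zeta>' < h n"
      "f (x + h n *\<^sub>R axis j 1 + h n *\<^sub>R axis i 1) - f (x + h n *\<^sub>R axis j 1) - f (x + h n *\<^sub>R axis i 1) + f x
      = h n * h n * ?G (x + \<xi>' *\<^sub>R axis j 1 + \<zeta>' *\<^sub>R axis i 1)"
      by (rule second_difference[OF f h[of n], of x j i])
    have "x + h n *\<^sub>R axis i 1 + h n *\<^sub>R axis j 1 = x + h n *\<^sub>R axis j 1 + h n *\<^sub>R axis i 1"
      by (simp add: algebra_simps)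
    then have "f (x + h n *\<^sub>R axis i 1 + h n *\<^sub>R axis j 1) = f (x + h n *\<^sub>R axis j 1 + h n *\<^sub>R axis i 1)"
      by (rule arg_cong)
    with 1(5) 2(5) have "h n * h n * ?H (x + \<xi> *\<^sub>R axis i 1 + \<zeta> *\<^sub>R axis j 1) =
       h n * h n * ?G (x + \<xi>' *\<^sub>R axis j 1 + \<zeta>' *\<^sub>R axis i 1)" by linarith
    then have "?G (x + \<xi>' *\<^sub>R axis j 1 + \<zeta>' *\<^sub>R axis i 1) = ?H (x + \<xi> *\<^sub>R axis i 1 + \<zeta> *\<^sub>R axis j 1)"
      using h[of n] by simp
    with dist[OF 1(1-4)] dist[OF 2(1-4)] show ?thesis by blast
  qed
  then obtain y z where yz: "\<And>n. ?G (y n) = ?H (z n)" "\<And>n. dist (y n) x \<le> 2 * h n" "\<And>n. dist (z n) x \<le> 2 * h n"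
    by metis
  have h0: "(\<lambda>n. 2 * h n) \<longlonglongrightarrow> 0"
    unfolding h_def using tendsto_mult_right_zero[OF LIMSEQ_inverse_real_of_nat] .
  have "(\<lambda>n. dist (y n) x) \<longlonglongrightarrow> 0" "(\<lambda>n. dist (z n) x) \<longlonglongrightarrow> 0"
    by (auto intro!: tendsto_sandwich[OF _ _ tendsto_const h0] simp: yz)
  then have y: "y \<longlonglongrightarrow> x" and z: "z \<longlonglongrightarrow> x"
    by (simp_all add: tendsto_dist_iff[of _ x])
  have c: "isCont ?G x" "isCont ?H x"
    using f by (auto intro!: continuous_on_interior[of UNIV] smooth_continuous smooth_partial_deriv)
  have "(\<lambda>n. ?G (y n)) \<longlonglongrightarrow> ?G x" "(\<lambda>n. ?H (z n)) \<longlonglongrightarrow> ?H x"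
    using isCont_tendsto_compose[OF c(1) y] isCont_tendsto_compose[OF c(2) z] .
  then show "?G x = ?H x" using yz(1) LIMSEQ_unique by simp
qed

lemma pderivs_append_commute:
  assumes "smooth f" shows "pderivs (a @ i # b) f = pderivs (i # a @ b) f"
  by (induction a) (auto simp: partial_deriv_commute assms smooth_pderivs)

lemma pderivs_perm:
  assumes "smooth f" "mset is = mset js" shows "pderivs is f = pderivs js f"
  using assms(2)
proof (induction "is" arbitrary: js)
  case (Cons i "is")
  then have "i \<in> set js" by (metis list.set_intros(1) mset_eq_setD)
  then obtain a b where js: "js = a @ i # b" by (meson split_list)
  with Cons.prems have "mset is = mset (a @ b)" by simp
  from Cons.IH[OF this] show ?case
    using pderivs_append_commute[OF assms(1), of a i b] by (simp add: js)
qed simp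

section \<open>Multi-indices as lists of directions\<close>

definition mi_list :: "'n::finite multiindex \<Rightarrow> 'n list" where
  "mi_list \<sigma> = (SOME is. \<forall>i. count_list is i = \<sigma> i)"

lemma mi_deriv_eq: "mi_deriv \<sigma> f = pderivs (mi_list \<sigma>) f"
  by (simp add: mi_deriv_def mi_list_def)

text \<open>The choice in \<open>mi_list\<close> always has a witness: over a finite index type
  every multi-index is a multiset, and every multiset is enumerated by some list.\<close>

lemma count_mi_list: "count_list (mi_list \<sigma>) = (\<sigma> :: 'n::finite multiindex)"
proof -
  obtain "is" where "mset is = Abs_multiset \<sigma>" using ex_mset by blast
  then have "\<forall>i. count_list is i = \<sigma> i"
    by (simp add: Abs_multiset_inverse flip: count_mset)
  then have "\<exists>is. \<forall>i. count_list is i = \<sigma> i" by blast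
  from someI_ex[OF this] show ?thesis by (auto simp: mi_list_def)
qed

lemma length_mi_list: "length (mi_list \<sigma>) = mi_order \<sigma>"
  using sum_count_set[of "mi_list \<sigma>" UNIV] by (simp add: mi_order_def count_mi_list)

lemma mi_order_count_list: "mi_order (count_list is) = length is"
  using sum_count_set[of "is" UNIV] by (simp add: mi_order_def)

text \<open>By symmetry of mixed derivatives the order chosen inside \<open>mi_deriv\<close> does
  not matter; this lets a list produced by the Leibniz rule be read as a multi-index.\<close>

lemma mi_deriv_count_list:
  assumes "smooth f" shows "mi_deriv (count_list is) f = pderivs is f"
  unfolding mi_deriv_eq
proof (rule pderivs_perm[OF assms])
  show "mset (mi_list (count_list is)) = mset is"
    by (rule multiset_eqI) (simp add: count_mset count_mi_list)
qed

lemma finite_multiindices: "finite (multiindices k)"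
proof -
  have "multiindices k \<subseteq> PiE UNIV (\<lambda>_::'a. {..k})"
  proof
    fix \<sigma> :: "'a multiindex" assume "\<sigma> \<in> multiindices k"
    then have "\<sigma> i \<le> k" for i
      using member_le_sum[of i UNIV \<sigma>] by (simp add: multiindices_def mi_order_def)
    then show "\<sigma> \<in> PiE UNIV (\<lambda>_. {..k})" by auto
  qed
  then show ?thesis by (rule finite_subset) (simp add: finite_PiE)
qed

lemma multiindices_nonempty: "multiindices k \<noteq> ({} :: 'n::finite multiindex set)"
  using mi_order_count_list[of "replicate k (undefined::'n)"] by (auto simp: multiindices_def)

lemma partial_deriv_locally_const:
  assumes "open U" "\<And>y. y \<in> U \<Longrightarrow> f y = c" "x \<in> U"
  shows "partial_deriv i f x = 0"
proof -
  have "(f has_derivative (\<lambda>_. 0)) (at x)"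
    by (rule has_derivative_transform_within_open[of "\<lambda>_. c" _ _ _ U]) (use assms in auto)
  from partial_deriv_eqI[OF this] show ?thesis .
qed

lemma pderivs_locally_const:
  assumes "open U" "\<And>y. y \<in> U \<Longrightarrow> f y = c" "x \<in> U" "is \<noteq> []"
  shows "pderivs is f x = 0"
  using assms(3,4)
proof (induction "is" arbitrary: x)
  case (Cons i "is")
  show ?case
  proof (cases "is = []")
    case True
    then show ?thesis using partial_deriv_locally_const[OF assms(1,2) Cons.prems(1)] by simp
  next
    case False
    then have "\<And>y. y \<in> U \<Longrightarrow> pderivs is f y = 0" using Cons.IH by blast
    from partial_deriv_locally_const[OF assms(1) this Cons.prems(1)] show ?thesis by simp
  qed
qed simp

section \<open>Supports and the algebra of test functions\<close>

abbreviation supp :: "(real^'n::finite \<Rightarrow> real) \<Rightarrow> (real^'n) set" where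
  "supp f \<equiv> closure {x. f x \<noteq> 0}"

lemma not_in_supp: "x \<notin> supp f \<Longrightarrow> f x = 0"
  using closure_subset[of "{x. f x \<noteq> 0}"] by auto

lemma pderivs_eq_0_outside:
  assumes "x \<notin> supp f" shows "pderivs is f x = 0"
proof (cases "is = []")
  case True
  with assms show ?thesis by (auto dest: not_in_supp)
next
  case False
  show ?thesis
    by (rule pderivs_locally_const[of "- supp f" f 0]) (use assms False in \<open>auto dest: not_in_supp\<close>)
qed

lemma test_functionI:
  assumes "smooth f" "compact K" "K \<subseteq> \<Omega>" "\<And>x. x \<notin> K \<Longrightarrow> f x = 0"
  shows "f \<in> test_functions \<Omega>"
proof -
  have "supp f \<subseteq> K"
    using assms by (intro closure_minimal compact_imp_closed) auto
  moreover have "compact (supp f)"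
    using \<open>supp f \<subseteq> K\<close> compact_Int_closed[OF assms(2), of "supp f"] by (simp add: Int_absorb1)
  ultimately show ?thesis
    using assms(1,3) unfolding test_functions_def by auto
qed

lemma test_functionD:
  assumes "f \<in> test_functions \<Omega>"
  shows "smooth f" "compact (supp f)" "supp f \<subseteq> \<Omega>" "\<And>x. x \<notin> supp f \<Longrightarrow> f x = 0"
  using assms not_in_supp[of _ f] unfolding test_functions_def by blast+

lemma test_function_pderivs: "f \<in> test_functions \<Omega> \<Longrightarrow> pderivs is f \<in> test_functions \<Omega>"
  by (rule test_functionI[where K = "supp f"])
    (auto intro: test_functionD(1,2) smooth_pderivs pderivs_eq_0_outside dest: test_functionD(3)
      simp del: compact_closure)

lemma test_function_mi_deriv: "f \<in> test_functions \<Omega> \<Longrightarrow> mi_deriv \<sigma> f \<in> test_functions \<Omega>"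
  by (simp add: mi_deriv_eq test_function_pderivs)

lemma test_function_zero: "(\<lambda>x. 0) \<in> test_functions \<Omega>"
  by (rule test_functionI[where K = "{}"]) (auto simp: smooth_const)

lemma test_function_add:
  "f \<in> test_functions \<Omega> \<Longrightarrow> g \<in> test_functions \<Omega> \<Longrightarrow> (\<lambda>x. f x + g x) \<in> test_functions \<Omega>"
proof (rule test_functionI[where K = "supp f \<union> supp g"])
  fix x assume "x \<notin> supp f \<union> supp g"
  then show "f x + g x = 0" using not_in_supp[of x f] not_in_supp[of x g] by auto
qed (auto intro: smooth_add test_functionD(1,2) dest: test_functionD(3) simp del: compact_closure)

lemma test_function_smooth_mult:
  "smooth g \<Longrightarrow> f \<in> test_functions \<Omega> \<Longrightarrow> (\<lambda>x. g x * f x) \<in> test_functions \<Omega>"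
  by (rule test_functionI[where K = "supp f"])
    (auto intro: smooth_mult test_functionD(1,2) dest: not_in_supp test_functionD(3) simp del: compact_closure)

lemma test_function_cmult: "f \<in> test_functions \<Omega> \<Longrightarrow> (\<lambda>x. c * f x) \<in> test_functions \<Omega>"
  by (intro test_function_smooth_mult smooth_const)

lemma test_function_diff:
  "f \<in> test_functions \<Omega> \<Longrightarrow> g \<in> test_functions \<Omega> \<Longrightarrow> (\<lambda>x. f x - g x) \<in> test_functions \<Omega>"
  using test_function_add[OF _ test_function_cmult, of f \<Omega> g "-1"] by simp

lemma test_function_mono: "f \<in> test_functions \<Omega> \<Longrightarrow> \<Omega> \<subseteq> \<Omega>' \<Longrightarrow> f \<in> test_functions \<Omega>'"
  by (auto simp: test_functions_def)

lemma mi_deriv_add: "smooth f \<Longrightarrow> smooth g \<Longrightarrow> mi_deriv \<sigma> (\<lambda>x. f x + g x) = (\<lambda>x. mi_deriv \<sigma> f x + mi_deriv \<sigma> g x)"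
  by (simp add: mi_deriv_eq pderivs_add)

lemma mi_deriv_diff: "smooth f \<Longrightarrow> smooth g \<Longrightarrow> mi_deriv \<sigma> (\<lambda>x. f x - g x) = (\<lambda>x. mi_deriv \<sigma> f x - mi_deriv \<sigma> g x)"
  by (simp add: mi_deriv_eq pderivs_diff)

lemma mi_deriv_cmult: "smooth f \<Longrightarrow> mi_deriv \<sigma> (\<lambda>x. c * f x) = (\<lambda>x. c * mi_deriv \<sigma> f x)"
  by (simp add: mi_deriv_eq pderivs_cmult)

section \<open>Bump functions and cutoffs\<close>

text \<open>The family p(1/t) exp(-1/t) is closed under differentiation: in the variable s = 1/t the
  polynomial p becomes s^2 (p - p'). Its members extend by 0 to a smooth function on the
  line.\<close>

definition flat :: "real poly \<Rightarrow> real \<Rightarrow> real" where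
  "flat p t = (if t > 0 then poly p (1 / t) * exp (- (1 / t)) else 0)"

lemma poly_exp_tendsto_0: "((\<lambda>x::real. poly p x * exp (- x)) \<longlongrightarrow> 0) at_top"
proof -
  have "((\<lambda>x::real. \<Sum>i\<le>degree p. coeff p i * (x ^ i / exp x)) \<longlongrightarrow> (\<Sum>i\<le>degree p. coeff p i * 0)) at_top"
    by (intro tendsto_sum tendsto_mult tendsto_const tendsto_power_div_exp_0)
  then show ?thesis
    by (simp add: poly_altdef exp_minus sum_distrib_right divide_inverse mult.assoc)
qed

lemma flat_tendsto_0: "(flat p \<longlongrightarrow> 0) (at 0)"
proof -
  have "((\<lambda>t. poly p (1 / t) * exp (- (1 / t))) \<longlongrightarrow> 0) (at_right (0::real))"
    using filterlim_compose[OF poly_exp_tendsto_0 filterlim_inverse_at_top_right]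
    by (simp add: inverse_eq_divide)
  then have "(flat p \<longlongrightarrow> 0) (at_right 0)"
    by (rule Lim_transform_eventually) (auto simp: flat_def eventually_at_filter)
  moreover have "(flat p \<longlongrightarrow> 0) (at_left 0)"
    by (rule Lim_transform_eventually[OF tendsto_const]) (auto simp: flat_def eventually_at_filter)
  ultimately show ?thesis by (simp add: filterlim_at_split)
qed

lemma flat_deriv:
  "(flat p has_real_derivative flat (pCons 0 (pCons 0 (p - pderiv p))) t) (at t)"
proof -
  consider "t > 0" | "t < 0" | "t = 0" by linarith
  then show ?thesis
  proof cases
    case 1
    have "((\<lambda>t. poly p (1 / t) * exp (- (1 / t))) has_real_derivative
        flat (pCons 0 (pCons 0 (p - pderiv p))) t) (at t)"
      using 1 by (auto intro!: derivative_eq_intros DERIV_chain2[OF poly_DERIV] simp: flat_def field_simps power2_eq_square)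
    then show ?thesis
      by (rule has_field_derivative_transform_within_open[of _ _ _ "{0<..}"])
        (use 1 in \<open>auto simp: flat_def\<close>)
  next
    case 2
    have "((\<lambda>t. 0) has_real_derivative flat (pCons 0 (pCons 0 (p - pderiv p))) t) (at t)"
      using 2 by (auto simp: flat_def)
    then show ?thesis
      by (rule has_field_derivative_transform_within_open[of _ _ _ "{..<0}"])
        (use 2 in \<open>auto simp: flat_def\<close>)
  next
    case 3
    \<comment> \<open>Dividing by h multiplies the polynomial by its variable, so the difference
      quotient at 0 is again a flat function and tends to 0.\<close>
    have "flat (pCons 0 p) h = (flat p (0 + h) - flat p 0) / h" if "h \<noteq> 0" for h
      using that by (auto simp: flat_def)
    then have "((\<lambda>h. (flat p (0 + h) - flat p 0) / h) \<longlongrightarrow> 0) (at 0)"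
      by (intro Lim_transform_eventually[OF flat_tendsto_0[of "pCons 0 p"]])
        (auto simp: eventually_at_filter)
    then show ?thesis by (simp add: 3 DERIV_def flat_def)
  qed
qed

primrec flat_poly :: "nat \<Rightarrow> real poly" where
  "flat_poly 0 = 1"
| "flat_poly (Suc m) = pCons 0 (pCons 0 (flat_poly m - pderiv (flat_poly m)))"

lemma flat_tower: "(flat (flat_poly m) has_real_derivative flat (flat_poly (Suc m)) t) (at t)"
  using flat_deriv[of "flat_poly m"] by simp

lemma flat1: "flat 1 t = (if t > 0 then exp (- (1 / t)) else 0)"
  by (simp add: flat_def)

lemma flat1_bounds: "0 \<le> flat 1 t" "flat 1 t \<le> 1"
  by (auto simp: flat1)

text \<open>For growing \<open>n\<close> these bumps tend to the indicator of the open box while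
  staying between 0 and 1. Testing against them recovers integrals over boxes by dominated
  convergence.\<close>

definition box_bump :: "real^'n::finite \<Rightarrow> real^'n \<Rightarrow> nat \<Rightarrow> real^'n \<Rightarrow> real" where
  "box_bump a b n x = (\<Prod>i\<in>UNIV. flat 1 (real n * (x $ i - a $ i)) * flat 1 (real n * (b $ i - x $ i)))"

lemma box_bump_smooth: "smooth (box_bump a b n)"
proof -
  have "smooth (\<lambda>x. flat (flat_poly 0) (g x))" if "smooth g" for g :: "real^'n \<Rightarrow> real"
    by (rule smooth_comp[where F = "\<lambda>m. flat (flat_poly m)", OF flat_tower that])
  then have *: "smooth (\<lambda>x. flat 1 (g x))" if "smooth g" for g :: "real^'n \<Rightarrow> real"
    using that by simp
  show ?thesis unfolding box_bump_def[abs_def]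
    by (intro smooth_prod smooth_mult * smooth_cmult smooth_diff smooth_coord smooth_const)
qed

lemma box_bump_bounds: "0 \<le> box_bump a b n x" "box_bump a b n x \<le> 1"
  unfolding box_bump_def by (auto intro!: prod_nonneg prod_le_1 mult_le_one simp: flat1_bounds)

lemma box_bump_outside: "x \<notin> box a b \<Longrightarrow> box_bump a b n x = 0"
  unfolding box_bump_def by (auto simp: mem_box_cart flat1 zero_less_mult_iff)

lemma box_bump_test: "cbox a b \<subseteq> \<Omega> \<Longrightarrow> box_bump a b n \<in> test_functions \<Omega>"
  by (rule test_functionI[where K = "cbox a b"])
    (auto simp: box_bump_smooth intro!: box_bump_outside dest: subsetD[OF box_subset_cbox])

lemma box_bump_tendsto: "(\<lambda>n. box_bump a b n x) \<longlonglongrightarrow> indicator (box a b) x"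
proof (cases "x \<in> box a b")
  case True
  have *: "(\<lambda>n. flat 1 (real n * s)) \<longlonglongrightarrow> 1" if s: "s > 0" for s
  proof -
    have "(\<lambda>n. exp (- (inverse s * (1 / real n)))) \<longlonglongrightarrow> exp (- (inverse s * 0))"
      by (intro tendsto_intros lim_1_over_n)
    then have "(\<lambda>n. exp (- (inverse s * (1 / real n)))) \<longlonglongrightarrow> 1" by simp
    then show ?thesis
      by (rule Lim_transform_eventually)
        (use s in \<open>auto simp: flat1 field_simps intro!: eventually_sequentiallyI[of 1]\<close>)
  qed
  have "(\<lambda>n. box_bump a b n x) \<longlonglongrightarrow> (\<Prod>i\<in>(UNIV::'a set). 1 * 1)"
    unfolding box_bump_def using True by (intro tendsto_prod tendsto_mult *) (auto simp: mem_box_cart)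
  with True show ?thesis by simp
qed (simp add: box_bump_outside)

text \<open>One-variable counterpart of \<open>smooth_upto\<close>. The derivative is only asserted
  to exist, which lets quotients be treated without formulas for their higher derivatives.\<close>

primrec smooth1_upto :: "nat \<Rightarrow> (real \<Rightarrow> real) \<Rightarrow> bool" where
  "smooth1_upto 0 f = True"
| "smooth1_upto (Suc n) f = (\<exists>f'. (\<forall>t. (f has_real_derivative f' t) (at t)) \<and> smooth1_upto n f')"

lemma smooth1_upto_Suc: "smooth1_upto (Suc n) f \<Longrightarrow> smooth1_upto n f"
proof (induction n arbitrary: f)
  case (Suc n)
  then show ?case unfolding smooth1_upto.simps(2)[of "Suc n" f] by (auto simp del: smooth1_upto.simps(2) simp: smooth1_upto.simps(2)[of n f])
qed simp

lemma smooth1_upto_add: "smooth1_upto n f \<Longrightarrow> smooth1_upto n g \<Longrightarrow> smooth1_upto n (\<lambda>t. f t + g t)"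
proof (induction n arbitrary: f g)
  case (Suc n)
  then obtain f' g' where "\<forall>t. (f has_real_derivative f' t) (at t)" "smooth1_upto n f'"
    "\<forall>t. (g has_real_derivative g' t) (at t)" "smooth1_upto n g'" by auto
  with Suc.IH show ?case by (auto intro!: exI[of _ "\<lambda>t. f' t + g' t"] DERIV_add)
qed simp

lemma smooth1_upto_mult: "smooth1_upto n f \<Longrightarrow> smooth1_upto n g \<Longrightarrow> smooth1_upto n (\<lambda>t. f t * g t)"
proof (induction n arbitrary: f g)
  case (Suc n)
  then obtain f' g' where fg: "\<forall>t. (f has_real_derivative f' t) (at t)" "smooth1_upto n f'"
    "\<forall>t. (g has_real_derivative g' t) (at t)" "smooth1_upto n g'" by auto
  have "smooth1_upto n f" "smooth1_upto n g" using Suc.prems smooth1_upto_Suc by blast+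
  then have "smooth1_upto n (\<lambda>t. f' t * g t + g' t * f t)"
    by (intro smooth1_upto_add Suc.IH fg)
  moreover have "\<forall>t. ((\<lambda>t. f t * g t) has_real_derivative f' t * g t + g' t * f t) (at t)"
    using fg by (auto intro!: DERIV_mult)
  ultimately show ?case by (auto intro!: exI[of _ "\<lambda>t. f' t * g t + g' t * f t"])
qed simp

lemma smooth1_upto_cmult: "smooth1_upto n f \<Longrightarrow> smooth1_upto n (\<lambda>t. c * f t)"
proof (induction n arbitrary: f)
  case (Suc n)
  then obtain f' where "\<forall>t. (f has_real_derivative f' t) (at t)" "smooth1_upto n f'" by auto
  with Suc.IH show ?case by (auto intro!: exI[of _ "\<lambda>t. c * f' t"] DERIV_cmult)
qed simp

lemma smooth1_upto_inverse:
  assumes nz: "\<And>t. g t \<noteq> 0" shows "smooth1_upto n g \<Longrightarrow> smooth1_upto n (\<lambda>t. inverse (g t))"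
proof (induction n)
  case (Suc n)
  then obtain g' where g: "\<forall>t. (g has_real_derivative g' t) (at t)" "smooth1_upto n g'" by auto
  have "smooth1_upto n (\<lambda>t. inverse (g t))" using Suc smooth1_upto_Suc by blast
  then have "smooth1_upto n (\<lambda>t. (- 1) * (g' t * (inverse (g t) * inverse (g t))))"
    by (intro smooth1_upto_mult smooth1_upto_cmult g)
  moreover have "\<forall>t. ((\<lambda>t. inverse (g t)) has_real_derivative (- 1) * (g' t * (inverse (g t) * inverse (g t)))) (at t)"
    using g nz by (auto intro!: derivative_eq_intros simp: field_simps)
  ultimately show ?case by (auto intro!: exI[of _ "\<lambda>t. (- 1) * (g' t * (inverse (g t) * inverse (g t)))"])
qed simp

lemma smooth1_upto_reflect: "smooth1_upto n f \<Longrightarrow> smooth1_upto n (\<lambda>t. f (1 - t))"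
proof (induction n arbitrary: f)
  case (Suc n)
  then obtain f' where f: "\<forall>t. (f has_real_derivative f' t) (at t)" "smooth1_upto n f'" by auto
  have "((\<lambda>t. f (1 - t)) has_real_derivative (- 1) * f' (1 - t)) (at t)" for t
  proof -
    have "((\<lambda>t. 1 - t) has_real_derivative - 1) (at t)" by (auto intro!: derivative_eq_intros)
    from DERIV_chain2[OF f(1)[rule_format] this] show ?thesis by simp
  qed
  with Suc.IH f show ?case
    by (auto intro!: exI[of _ "\<lambda>t. (- 1) * f' (1 - t)"] smooth1_upto_cmult simp del: mult_minus1)
qed simp

lemma smooth1_upto_flat: "smooth1_upto n (flat (flat_poly m))"
  by (induction n arbitrary: m) (auto intro!: exI[of _ "flat (flat_poly (Suc _))"] flat_tower simp del: flat_poly.simps)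

text \<open>Converts the existence of all derivatives into the explicit tower on which
  \<open>smooth_comp\<close> operates.\<close>

lemma smooth1_tower:
  assumes "\<And>n. smooth1_upto n f"
  shows "((deriv ^^ m) f has_real_derivative (deriv ^^ Suc m) f t) (at t)"
proof -
  have "smooth1_upto n ((deriv ^^ m) f)" for n
  proof (induction m arbitrary: n)
    case (Suc m)
    obtain f' where f': "\<forall>t. ((deriv ^^ m) f has_real_derivative f' t) (at t)" "smooth1_upto n f'"
      using Suc[of "Suc n"] by auto
    then have "deriv ((deriv ^^ m) f) = f'" by (auto intro!: DERIV_imp_deriv)
    with f' show ?case by simp
  qed (use assms in simp)
  from this[of "Suc 0"] obtain f' where "\<forall>t. ((deriv ^^ m) f has_real_derivative f' t) (at t)" by auto
  then show ?thesis using DERIV_imp_deriv by (metis funpow.simps(2) o_apply)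
qed

text \<open>The step is e(t) / (e(t) + e(1 - t)) with e = \<open>flat 1\<close>. The denominator is
  positive because t and 1 - t are never both nonpositive.\<close>

lemma smooth_step_exists:
  obtains S :: "nat \<Rightarrow> real \<Rightarrow> real" where
    "\<And>m t. (S m has_real_derivative S (Suc m) t) (at t)"
    "\<And>t. t \<le> 0 \<Longrightarrow> S 0 t = 0" "\<And>t. t \<ge> 1 \<Longrightarrow> S 0 t = 1" "\<And>t. 0 \<le> S 0 t" "\<And>t. S 0 t \<le> 1"
proof -
  define g where "g t = flat 1 t + flat 1 (1 - t)" for t
  define f where "f t = flat 1 t * inverse (g t)" for t
  have g: "g t > 0" for t
    unfolding g_def using flat1_bounds(1)[of t] flat1_bounds(1)[of "1 - t"]
    by (cases "t > 0") (auto simp: flat1 intro: add_pos_nonneg add_nonneg_pos)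
  have fl: "smooth1_upto n (flat 1)" for n using smooth1_upto_flat[of n 0] by simp
  have "smooth1_upto n g" for n
    unfolding g_def[abs_def] by (intro smooth1_upto_add smooth1_upto_reflect fl)
  then have "smooth1_upto n f" for n
    unfolding f_def[abs_def] using g by (intro smooth1_upto_mult smooth1_upto_inverse fl) (auto simp: less_imp_neq[symmetric])
  note smooth1_tower[OF this]
  moreover have "f t = 0" if "t \<le> 0" for t using that by (simp add: f_def flat1)
  moreover have "f t = 1" if "t \<ge> 1" for t using that by (simp add: f_def g_def flat1)
  moreover have "0 \<le> f t" "f t \<le> 1" for t
    using flat1_bounds[of t] flat1_bounds[of "1 - t"] g[of t] by (auto simp: f_def g_def field_simps)
  ultimately show ?thesis using that[of "\<lambda>m. (deriv ^^ m) f"] by simp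
qed

section \<open>Radial cutoffs with scale-invariant derivative bounds\<close>

text \<open>\<open>f (c, R, R')\<close> scales on the annulus \<open>R \<le> dist y c \<le> R'\<close> like \<open>(R' - R)\<^bsup>-d\<^esup>\<close>, and every
  derivative up to order \<open>n\<close> gains a factor \<open>(R' - R)\<^bsup>-1\<^esup>\<close>, uniformly in \<open>(c, R, R')\<close>.\<close>

definition scaled_bound ::
  "nat \<Rightarrow> ((real^'n::finite) \<times> real \<times> real \<Rightarrow> real^'n \<Rightarrow> real) \<Rightarrow> bool" where
  "scaled_bound d f \<longleftrightarrow> (\<exists>K. \<forall>c R R' y. 0 \<le> R \<longrightarrow> R < R' \<longrightarrow> R \<le> dist y c \<longrightarrow> dist y c \<le> R' \<longrightarrow>
     \<bar>f (c, R, R') y\<bar> \<le> K / (R' - R) ^ d)"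

primrec scaled_derivs ::
  "nat \<Rightarrow> nat \<Rightarrow> ((real^'n::finite) \<times> real \<times> real \<Rightarrow> real^'n \<Rightarrow> real) \<Rightarrow> bool" where
  "scaled_derivs 0 d f \<longleftrightarrow> (\<forall>p. diffable (f p)) \<and> scaled_bound d f"
| "scaled_derivs (Suc n) d f \<longleftrightarrow> (\<forall>p. diffable (f p)) \<and> scaled_bound d f \<and>
     (\<forall>i. scaled_derivs n (Suc d) (\<lambda>p. partial_deriv i (f p)))"

lemma scaled_bound_add:
  assumes "scaled_bound d f" "scaled_bound d g" shows "scaled_bound d (\<lambda>p y. f p y + g p y)"
proof -
  obtain K L where KL: "\<forall>c R R' y. 0 \<le> R \<longrightarrow> R < R' \<longrightarrow> R \<le> dist y c \<longrightarrow> dist y c \<le> R' \<longrightarrow>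
     \<bar>f (c, R, R') y\<bar> \<le> K / (R' - R) ^ d"
     "\<forall>c R R' y. 0 \<le> R \<longrightarrow> R < R' \<longrightarrow> R \<le> dist y c \<longrightarrow> dist y c \<le> R' \<longrightarrow>
     \<bar>g (c, R, R') y\<bar> \<le> L / (R' - R) ^ d"
    using assms by (auto simp: scaled_bound_def)
  show ?thesis unfolding scaled_bound_def
  proof (intro exI[of _ "K + L"] allI impI)
    fix c y :: "real^'a" and R R' :: real
    assume *: "0 \<le> R" "R < R'" "R \<le> dist y c" "dist y c \<le> R'"
    show "\<bar>f (c, R, R') y + g (c, R, R') y\<bar> \<le> (K + L) / (R' - R) ^ d"
      using KL(1)[rule_format, OF *] KL(2)[rule_format, OF *] by (simp add: add_divide_distrib)
  qed
qed

lemma scaled_bound_mult: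
  assumes "scaled_bound d f" "scaled_bound e g" shows "scaled_bound (d + e) (\<lambda>p y. f p y * g p y)"
proof -
  obtain K L where KL: "\<forall>c R R' y. 0 \<le> R \<longrightarrow> R < R' \<longrightarrow> R \<le> dist y c \<longrightarrow> dist y c \<le> R' \<longrightarrow>
     \<bar>f (c, R, R') y\<bar> \<le> K / (R' - R) ^ d"
     "\<forall>c R R' y. 0 \<le> R \<longrightarrow> R < R' \<longrightarrow> R \<le> dist y c \<longrightarrow> dist y c \<le> R' \<longrightarrow>
     \<bar>g (c, R, R') y\<bar> \<le> L / (R' - R) ^ e"
    using assms by (auto simp: scaled_bound_def)
  show ?thesis unfolding scaled_bound_def
  proof (intro exI[of _ "K * L"] allI impI)
    fix c y :: "real^'a" and R R' :: real
    assume *: "0 \<le> R" "R < R'" "R \<le> dist y c" "dist y c \<le> R'"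
    show "\<bar>f (c, R, R') y * g (c, R, R') y\<bar> \<le> (K * L) / (R' - R) ^ (d + e)"
      using mult_mono'[OF KL(1)[rule_format, OF *] KL(2)[rule_format, OF *]]
      by (simp add: abs_mult power_add)
  qed
qed

lemma scaled_derivs_Suc: "scaled_derivs (Suc n) d f \<Longrightarrow> scaled_derivs n d f"
proof (induction n arbitrary: d f)
  case (Suc n)
  have "\<forall>p. diffable (f p)" "scaled_bound d f" "\<And>i. scaled_derivs (Suc n) (Suc d) (\<lambda>p. partial_deriv i (f p))"
    using Suc.prems unfolding scaled_derivs.simps(2)[of "Suc n"] by blast+
  then show ?case using Suc.IH by simp
qed simp

lemma scaled_derivs_add:
  "scaled_derivs n d f \<Longrightarrow> scaled_derivs n d g \<Longrightarrow> scaled_derivs n d (\<lambda>p y. f p y + g p y)"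
  by (induction n arbitrary: d f g) (auto simp: scaled_bound_add partial_deriv_add simp del: split_paired_All)

lemma scaled_derivs_mult:
  "scaled_derivs n d f \<Longrightarrow> scaled_derivs n e g \<Longrightarrow> scaled_derivs n (d + e) (\<lambda>p y. f p y * g p y)"
proof (induction n arbitrary: d e f g)
  case (Suc n)
  have "scaled_derivs n d f" "scaled_derivs n e g" using Suc.prems scaled_derivs_Suc by blast+
  then have "scaled_derivs n (Suc d + e) (\<lambda>p y. partial_deriv i (f p) y * g p y)"
    "scaled_derivs n (d + Suc e) (\<lambda>p y. f p y * partial_deriv i (g p) y)" for i
    using Suc by (auto intro!: Suc.IH simp del: add_Suc add_Suc_right)
  then show ?case using Suc.prems by (auto simp: scaled_bound_mult partial_deriv_mult intro!: scaled_derivs_add simp del: split_paired_All)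
qed (auto simp: scaled_bound_mult)

lemma scaled_derivs_zero: "scaled_derivs n d (\<lambda>p y. 0)"
  by (induction n arbitrary: d) (auto simp: partial_deriv_const scaled_bound_def intro!: exI[of _ 0])

lemma scaled_derivs_pderivs:
  "scaled_derivs n d f \<Longrightarrow> length is \<le> n \<Longrightarrow> scaled_bound (d + length is) (\<lambda>p. pderivs is (f p))"
proof (induction n arbitrary: d f "is")
  case (Suc n)
  show ?case
  \<comment> \<open>\<open>foldr\<close> applies the last direction first, and
    \<open>scaled_derivs\<close> unfolds at the first differentiation performed; hence the list is
    split at its end.\<close>
  proof (cases "is" rule: rev_cases)
    case (snoc js i)
    with Suc show ?thesis using Suc.IH[of "Suc d" "\<lambda>p. partial_deriv i (f p)" js] by simp
  qed (use Suc in simp)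
qed simp

text \<open>The sharp cutoff is a smooth step applied to \<open>(|y - c|\<^sup>2 - R\<^sup>2) / (R'\<^sup>2 - R\<^sup>2)\<close>, which is
  smooth also at \<open>c\<close>.\<close>

lemma cutoff_exists:
  "\<exists>K>0. \<forall>c R R'. 0 \<le> R \<longrightarrow> R < R' \<longrightarrow> (\<exists>\<eta> :: real^'n::finite \<Rightarrow> real. smooth \<eta> \<and>
       (\<forall>y. 0 \<le> \<eta> y \<and> \<eta> y \<le> 1) \<and> (\<forall>y. dist y c \<le> R \<longrightarrow> \<eta> y = 0) \<and> (\<forall>y. dist y c \<ge> R' \<longrightarrow> \<eta> y = 1) \<and>
       (\<forall>is y. is \<noteq> [] \<longrightarrow> length is \<le> k \<longrightarrow> \<bar>pderivs is \<eta> y\<bar> \<le> K / (R' - R) ^ length is))"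
proof -
  obtain S :: "nat \<Rightarrow> real \<Rightarrow> real" where S:
    "\<And>m t. (S m has_real_derivative S (Suc m) t) (at t)"
    "\<And>t. t \<le> 0 \<Longrightarrow> S 0 t = 0" "\<And>t. t \<ge> 1 \<Longrightarrow> S 0 t = 1" "\<And>t. 0 \<le> S 0 t" "\<And>t. S 0 t \<le> 1"
    using smooth_step_exists by blast
  define \<alpha> :: "(real^'n) \<times> real \<times> real \<Rightarrow> real" where "\<alpha> = (\<lambda>(c, R, R'). 1 / (R'\<^sup>2 - R\<^sup>2))"
  define q :: "(real^'n) \<times> real \<times> real \<Rightarrow> real^'n \<Rightarrow> real" where
    "q p y = \<alpha> p * ((\<Sum>j\<in>UNIV. (y $ j - fst p $ j) * (y $ j - fst p $ j)) - (fst (snd p))\<^sup>2)" for p y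
  define g :: "'n \<Rightarrow> (real^'n) \<times> real \<times> real \<Rightarrow> real^'n \<Rightarrow> real" where
    "g i p y = 2 * \<alpha> p * (y $ i - fst p $ i)" for i p y
  have q_eq: "q (c, R, R') y = ((dist y c)\<^sup>2 - R\<^sup>2) / (R'\<^sup>2 - R\<^sup>2)" for c R R' y
    unfolding q_def \<alpha>_def dist_norm power2_norm_eq_inner by (simp add: inner_vec_def)
  have smq: "smooth (q p)" for p
    unfolding q_def[abs_def]
    by (intro smooth_cmult smooth_diff smooth_sum smooth_mult smooth_coord smooth_const)
  have pdc: "partial_deriv i (\<lambda>y. y $ j - c) = (\<lambda>y. if i = j then 1 else 0)" for i j :: 'n and c
    using partial_deriv_add[of "\<lambda>y. y $ j" "\<lambda>y. - c" i]
    by (simp add: smooth_diffable smooth_coord partial_deriv_coord partial_deriv_const)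
  have smc: "smooth (\<lambda>y::real^'n. y $ j - c)" for j c
    by (intro smooth_diff smooth_coord smooth_const)
  have pdq: "partial_deriv i (q p) = g i p" for i p
  proof -
    let ?A = "\<lambda>y::real^'n. \<Sum>j\<in>UNIV. \<alpha> p * ((y $ j - fst p $ j) * (y $ j - fst p $ j))"
    have "smooth ?A" by (intro smooth_sum smooth_cmult smooth_mult smc)
    moreover have "q p = (\<lambda>y. ?A y + (- \<alpha> p * (fst (snd p))\<^sup>2))"
      by (rule ext) (simp add: q_def sum_distrib_left algebra_simps)
    ultimately have "partial_deriv i (q p) = (\<lambda>y. partial_deriv i ?A y)"
      by (simp only: partial_deriv_add[OF smooth_diffable smooth_diffable[OF smooth_const]] partial_deriv_const add_0_right)
    also have "\<dots> = (\<lambda>y. \<Sum>j\<in>UNIV. partial_deriv i (\<lambda>y. \<alpha> p * ((y $ j - fst p $ j) * (y $ j - fst p $ j))) y)"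
      using pderivs_sum[of UNIV "\<lambda>j y. \<alpha> p * ((y $ j - fst p $ j) * (y $ j - fst p $ j))" "[i]"]
      by (simp add: smooth_cmult smooth_mult smc)
    also have "\<dots> = (\<lambda>y. \<Sum>j\<in>UNIV. if i = j then 2 * \<alpha> p * (y $ j - fst p $ j) else 0)"
      by (intro ext sum.cong refl)
        (simp add: partial_deriv_cmult partial_deriv_mult pdc smooth_diffable smooth_mult smc)
    also have "\<dots> = g i p" by (simp add: g_def fun_eq_iff)
    finally show ?thesis .
  qed
  have pdg: "partial_deriv j (g i p) = (\<lambda>y. if j = i then 2 * \<alpha> p else 0)" for i j p
    unfolding g_def[abs_def] by (simp add: partial_deriv_cmult pdc smooth_diffable smc fun_eq_iff)
  have smg: "smooth (g i p)" for i p
    unfolding g_def[abs_def] by (intro smooth_cmult smc)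
  \<comment> \<open>Here R'^2 - R^2 = (R' - R) (R' + R), and R' + R dominates both R' - R and R'
    since R is nonnegative. The third bound controls the gradient of \<open>q\<close> on the
    annulus, the second one its Hessian.\<close>
  have bd: "\<alpha> (c, R, R') \<ge> 0" "\<alpha> (c, R, R') \<le> 1 / (R' - R)\<^sup>2" "\<alpha> (c, R, R') * R' \<le> 1 / (R' - R)"
    if "0 \<le> R" "R < R'" for c R R'
  proof -
    have eq: "\<alpha> (c, R, R') = 1 / ((R' - R) * (R' + R))"
      by (simp add: \<alpha>_def power2_eq_square algebra_simps)
    show "\<alpha> (c, R, R') \<ge> 0" using that by (simp add: eq)
    show "\<alpha> (c, R, R') \<le> 1 / (R' - R)\<^sup>2" unfolding eq power2_eq_square
      using that by (intro divide_left_mono mult_left_mono) auto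
    have "R' / (R' + R) \<le> 1" using that by simp
    then have "R' / (R' + R) / (R' - R) \<le> 1 / (R' - R)"
      using that by (intro divide_right_mono) auto
    then show "\<alpha> (c, R, R') * R' \<le> 1 / (R' - R)" by (simp add: eq mult.commute)
  qed
  have sg: "scaled_derivs n (Suc 0) (g i)" for n i
  proof (cases n)
    have "scaled_bound (Suc 0) (g i)"
      unfolding scaled_bound_def
    proof (intro exI[of _ 2] allI impI)
      fix c y :: "real^'n" and R R' :: real
      assume *: "0 \<le> R" "R < R'" "R \<le> dist y c" "dist y c \<le> R'"
      have "\<bar>y $ i - c $ i\<bar> \<le> R'"
        using component_le_norm_cart[of "y - c" i] *(4) by (simp add: dist_norm)
      then have "\<alpha> (c, R, R') * \<bar>y $ i - c $ i\<bar> \<le> \<alpha> (c, R, R') * R'"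
        using bd(1)[OF *(1,2)] by (rule mult_left_mono)
      then show "\<bar>g i (c, R, R') y\<bar> \<le> 2 / (R' - R) ^ Suc 0"
        using bd(1,3)[OF *(1,2), of c] by (simp add: g_def abs_mult)
    qed
    note sb = this
    have dg: "diffable (g i p)" for p using smg smooth_diffable by blast
    { case 0 then show ?thesis using sb dg by (simp del: split_paired_All) }
    { case (Suc n')
      have "scaled_derivs n' (Suc (Suc 0)) (\<lambda>p. partial_deriv j (g i p))" for j
      proof (cases "j = i")
        case True
        have "scaled_bound (Suc (Suc 0)) (\<lambda>p y. 2 * \<alpha> p)"
          unfolding scaled_bound_def
        proof (intro exI[of _ 2] allI impI)
          fix c y :: "real^'n" and R R' :: real assume *: "0 \<le> R" "R < R'"
          show "\<bar>2 * \<alpha> (c, R, R')\<bar> \<le> 2 / (R' - R) ^ Suc (Suc 0)"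
            using bd(1,2)[OF *, of c] by (simp add: abs_mult power2_eq_square)
        qed
        then have "scaled_derivs n' (Suc (Suc 0)) (\<lambda>p y. 2 * \<alpha> p)"
          by (cases n') (auto simp: partial_deriv_const scaled_derivs_zero simp del: split_paired_All)
        then show ?thesis using True by (simp add: pdg)
      next
        case False
        then show ?thesis by (simp add: pdg scaled_derivs_zero)
      qed
      with Suc show ?thesis using sb dg by (simp del: split_paired_All) }
  qed
  have q01: "0 \<le> q (c, R, R') y" "q (c, R, R') y \<le> 1"
    if "0 \<le> R" "R < R'" "R \<le> dist y c" "dist y c \<le> R'" for c R R' y
  proof -
    have "R\<^sup>2 < R'\<^sup>2" "R\<^sup>2 \<le> (dist y c)\<^sup>2" "(dist y c)\<^sup>2 \<le> R'\<^sup>2"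
      using that by (auto intro!: power_strict_mono power_mono)
    then show "0 \<le> q (c, R, R') y" "q (c, R, R') y \<le> 1"
      unfolding q_eq by simp_all
  qed
  \<comment> \<open>On the annulus \<open>q\<close> takes values in the fixed interval [0, 1], so
    each level of the tower \<open>S\<close> is bounded there by a constant independent of the
    center and of both radii.\<close>
  have Sq: "scaled_derivs n 0 (\<lambda>p y. S m (q p y))" for n m
  proof (induction n arbitrary: m)
    have bdd: "scaled_bound 0 (\<lambda>p y. S m (q p y))" for m
    proof -
      have "continuous_on {0..1} (S m)" using S(1) by (meson DERIV_continuous_on has_field_derivative_at_within)
      then have "bounded (S m ` {0..1})" by (intro compact_imp_bounded compact_continuous_image) auto
      then obtain K where "\<forall>t\<in>{0..1}. \<bar>S m t\<bar> \<le> K" by (auto simp: bounded_iff)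
      then show ?thesis unfolding scaled_bound_def using q01 by (intro exI[of _ K]) auto
    qed
    case 0
    then show ?case using bdd diffable_comp(1)[OF S(1) smooth_diffable[OF smq]] by (auto simp del: split_paired_All)
    case (Suc n)
    have "scaled_derivs n (Suc 0) (\<lambda>p. partial_deriv i (\<lambda>y. S m (q p y)))" for i
      using scaled_derivs_mult[OF Suc[of "Suc m"] sg[of n i]]
      by (simp add: diffable_comp(2)[OF S(1) smooth_diffable[OF smq]] pdq)
    then show ?case using bdd diffable_comp(1)[OF S(1) smooth_diffable[OF smq]] by (auto simp del: split_paired_All)
  qed
  have "\<exists>K. \<forall>c R R' y. 0 \<le> R \<longrightarrow> R < R' \<longrightarrow> R \<le> dist y c \<longrightarrow> dist y c \<le> R' \<longrightarrow>
     \<bar>pderivs is (\<lambda>y. S 0 (q (c, R, R') y)) y\<bar> \<le> K / (R' - R) ^ length is" for "is"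
    using scaled_derivs_pderivs[OF Sq order_refl, of "is" 0] by (simp add: scaled_bound_def)
  then obtain K where K: "\<And>is c R R' y. 0 \<le> R \<Longrightarrow> R < R' \<Longrightarrow> R \<le> dist y c \<Longrightarrow> dist y c \<le> R' \<Longrightarrow>
     \<bar>pderivs is (\<lambda>y. S 0 (q (c, R, R') y)) y\<bar> \<le> K is / (R' - R) ^ length is"
    by metis
  \<comment> \<open>Only finitely many lists have length at most \<open>k\<close>, so one constant
    serves them all; the summand 1 makes it positive.\<close>
  define L where "L = 1 + (\<Sum>is\<in>{is :: 'n list. length is \<le> k}. \<bar>K is\<bar>)"
  have L0: "L > 0" unfolding L_def by (intro add_pos_nonneg sum_nonneg) auto
  have fin: "finite {is :: 'n list. length is \<le> k}"
    using finite_lists_length_le[of "UNIV :: 'n set" k] by simp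
  have KL: "K is \<le> L" if "length is \<le> k" for "is"
  proof -
    have "\<bar>K is\<bar> \<le> (\<Sum>is\<in>{is. length is \<le> k}. \<bar>K is\<bar>)"
      using that fin by (intro member_le_sum) auto
    then show ?thesis unfolding L_def by linarith
  qed
  show ?thesis
  proof (rule exI[of _ L], rule conjI[OF L0], intro allI impI)
    fix c :: "real^'n" and R R' :: real assume R: "0 \<le> R" "R < R'"
    let ?\<eta> = "\<lambda>y. S 0 (q (c, R, R') y)"
    have sq: "R\<^sup>2 < R'\<^sup>2" using R by (intro power_strict_mono) auto
    have in0: "?\<eta> y = 0" if "dist y c \<le> R" for y
    proof (rule S(2))
      have "(dist y c)\<^sup>2 \<le> R\<^sup>2" using that R by (intro power_mono) auto
      then show "q (c, R, R') y \<le> 0" using sq unfolding q_eq by (intro divide_nonpos_pos) auto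
    qed
    have in1: "?\<eta> y = 1" if "R' \<le> dist y c" for y
    proof (rule S(3))
      have "R'\<^sup>2 \<le> (dist y c)\<^sup>2" using that R by (intro power_mono) auto
      then show "1 \<le> q (c, R, R') y" using sq unfolding q_eq by simp
    qed
    \<comment> \<open>Off the closed annulus the cutoff is locally constant: 0 on the open inner
      ball and 1 on the open exterior.\<close>
    have out: "pderivs is ?\<eta> y = 0" if ne: "is \<noteq> []" and y: "\<not> (R \<le> dist y c \<and> dist y c \<le> R')" for "is" y
    proof (cases "dist y c < R")
      case True
      show ?thesis
        by (rule pderivs_locally_const[of "ball c R" _ 0, OF _ _ _ ne]) (use True in0 in \<open>auto simp: dist_commute\<close>)
    next
      case False
      show ?thesis
        by (rule pderivs_locally_const[of "- cball c R'" _ 1, OF _ _ _ ne]) (use False y in1 in \<open>auto simp: dist_commute\<close>)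
    qed
    have "\<bar>pderivs is ?\<eta> y\<bar> \<le> L / (R' - R) ^ length is" if ne: "is \<noteq> []" and len: "length is \<le> k" for "is" y
    proof (cases "R \<le> dist y c \<and> dist y c \<le> R'")
      case True
      then have "\<bar>pderivs is ?\<eta> y\<bar> \<le> K is / (R' - R) ^ length is" using K R by blast
      also have "\<dots> \<le> L / (R' - R) ^ length is"
        using KL[OF len] R by (intro divide_right_mono) auto
      finally show ?thesis .
    next
      case False
      then show ?thesis using out[OF ne False] L0 R by simp
    qed
    moreover have "smooth ?\<eta>" by (rule smooth_comp[of S, OF S(1) smq])
    ultimately show "\<exists>\<eta>. smooth \<eta> \<and> (\<forall>y. 0 \<le> \<eta> y \<and> \<eta> y \<le> 1) \<and>
       (\<forall>y. dist y c \<le> R \<longrightarrow> \<eta> y = 0) \<and> (\<forall>y. dist y c \<ge> R' \<longrightarrow> \<eta> y = 1) \<and>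
       (\<forall>is y. is \<noteq> [] \<longrightarrow> length is \<le> k \<longrightarrow> \<bar>pderivs is \<eta> y\<bar> \<le> L / (R' - R) ^ length is)"
      using S(4,5) in0 in1 by (intro exI[of _ ?\<eta>] conjI) blast+
  qed
qed

section \<open>Weak derivatives\<close>

lemma set_integral_outside:
  fixes f :: "'a \<Rightarrow> real"
  assumes "\<And>x. x \<notin> S \<Longrightarrow> f x = 0"
  shows "(LINT x:S|M. f x) = integral\<^sup>L M f" "set_integrable M S f \<longleftrightarrow> integrable M f"
proof -
  have "(\<lambda>x. indicator S x *\<^sub>R f x) = f" using assms by (auto simp: fun_eq_iff split: split_indicator)
  then show "(LINT x:S|M. f x) = integral\<^sup>L M f" "set_integrable M S f \<longleftrightarrow> integrable M f"
    by (simp_all add: set_lebesgue_integral_def set_integrable_def)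
qed

lemma test_function_outside: "\<phi> \<in> test_functions \<Omega> \<Longrightarrow> x \<notin> \<Omega> \<Longrightarrow> \<phi> x = 0"
  using test_functionD(3) not_in_supp by blast

lemma indicator_supp: "indicator (supp f) x * f x = f x"
  by (cases "x \<in> supp f") (auto dest: not_in_supp)

lemma test_function_integrable:
  assumes "f \<in> test_functions \<Omega>" shows "integrable lborel f" "integrable lebesgue f"
proof -
  have "integrable lborel (\<lambda>x. indicator (supp f) x *\<^sub>R f x)"
    using assms by (intro borel_integrable_compact test_functionD(2) smooth_continuous test_functionD(1))
  then show *: "integrable lborel f" by (simp add: indicator_supp)
  then show "integrable lebesgue f"
    using integrable_completion[of f lborel] by auto
qed

lemma test_function_bounded:
  assumes "f \<in> test_functions \<Omega>" obtains B where "B \<ge> 0" "\<And>x. \<bar>f x\<bar> \<le> B"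
proof -
  have "bounded (f ` supp f)"
    using assms by (intro compact_imp_bounded compact_continuous_image test_functionD(2) smooth_continuous test_functionD(1))
  then obtain B where B: "\<And>x. x \<in> supp f \<Longrightarrow> \<bar>f x\<bar> \<le> B" by (auto simp: bounded_iff)
  have "\<bar>f x\<bar> \<le> \<bar>B\<bar>" for x
    by (cases "x \<in> supp f") (use B[of x] not_in_supp[of x f] in auto)
  then show ?thesis using that[of "\<bar>B\<bar>"] by auto
qed

lemma test_function_measurable: "f \<in> test_functions \<Omega> \<Longrightarrow> f \<in> borel_measurable lebesgue"
  using smooth_measurable[OF test_functionD(1)] by (intro measurable_completion) simp

text \<open>By translation invariance every difference quotient of \<open>f\<close> has integral 0,
  and the quotients converge dominatedly to the partial derivative. No iterated integration
  enters.\<close>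

lemma integral_partial_deriv_eq_0:
  assumes f: "f \<in> test_functions \<Omega>"
  shows "integral\<^sup>L lebesgue (partial_deriv i f) = 0"
proof -
  let ?e = "axis i 1 :: real^'a"
  have sm: "smooth f" using f test_functionD by blast
  have pf: "partial_deriv i f \<in> test_functions \<Omega>" using test_function_pderivs[OF f, of "[i]"] by simp
  obtain M where M: "M \<ge> 0" "\<And>x. \<bar>partial_deriv i f x\<bar> \<le> M" using test_function_bounded[OF pf] by blast
  have "bounded (supp f)" using f test_functionD(2) compact_imp_bounded by blast
  then obtain B where B: "\<And>x. x \<in> supp f \<Longrightarrow> norm x \<le> B" by (auto simp: bounded_iff)
  define h where "h n = inverse (real (Suc n))" for n
  have h: "0 < h n" "h n \<le> 1" for n by (auto simp: h_def inverse_le_1_iff)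
  define g where "g n x = (f (h n *\<^sub>R ?e + x) - f x) / h n" for n x
  have intf: "integrable lborel f" using test_function_integrable[OF f] by blast
  have tr: "integrable lborel (\<lambda>x. f (c + x))" "integral\<^sup>L lborel (\<lambda>x. f (c + x)) = integral\<^sup>L lborel f" for c
  proof -
    have m: "f \<in> borel_measurable borel" by (rule smooth_measurable[OF sm])
    show "integrable lborel (\<lambda>x. f (c + x))"
      using integrable_distr_eq[of "(+) c" lborel borel f] m intf lborel_distr_plus[of c] by simp
    show "integral\<^sup>L lborel (\<lambda>x. f (c + x)) = integral\<^sup>L lborel f"
      using integral_distr[of "(+) c" lborel borel f] m lborel_distr_plus[of c] by simp
  qed
  have g0: "integral\<^sup>L lborel (g n) = 0" for n
    unfolding g_def[abs_def] using tr intf by (simp add: Bochner_Integration.integral_diff)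
  have "(\<lambda>n. integral\<^sup>L lborel (g n)) \<longlonglongrightarrow> integral\<^sup>L lborel (partial_deriv i f)"
  \<comment> \<open>Since the steps \<open>h n\<close> are at most 1, all quotients vanish outside
    the ball of radius B + 1; inside, the mean value theorem bounds them by M.\<close>
  proof (rule integral_dominated_convergence[where w = "\<lambda>x. indicator (cball 0 (B + 1)) x *\<^sub>R M"])
    show "partial_deriv i f \<in> borel_measurable lborel"
      using smooth_measurable[OF smooth_partial_deriv[OF sm]] by simp
    show "g n \<in> borel_measurable lborel" for n
      unfolding g_def[abs_def] using tr(1) intf by (intro borel_measurable_integrable integrable_divide Bochner_Integration.integrable_diff)
    show "integrable lborel (\<lambda>x. indicator (cball 0 (B + 1)) x *\<^sub>R M)"
      by (intro borel_integrable_compact) auto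
    show "AE x in lborel. (\<lambda>n. g n x) \<longlonglongrightarrow> partial_deriv i f x"
    proof (intro AE_I2)
      fix x
      have "((\<lambda>t. f (x + t *\<^sub>R ?e)) has_real_derivative partial_deriv i f x) (at 0)"
        using line_deriv[OF sm, of x i 0] by simp
      then have *: "((\<lambda>t. (f (x + t *\<^sub>R ?e) - f x) / t) \<longlongrightarrow> partial_deriv i f x) (at 0)"
        by (simp add: DERIV_def)
      have "h \<longlonglongrightarrow> 0" unfolding h_def[abs_def] by (rule LIMSEQ_inverse_real_of_nat)
      then have "filterlim h (at 0) sequentially"
        using h by (auto simp: filterlim_at intro!: always_eventually less_imp_neq[symmetric])
      from filterlim_compose[OF * this] show "(\<lambda>n. g n x) \<longlonglongrightarrow> partial_deriv i f x"
        by (simp add: g_def add.commute)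
    qed
    show "AE x in lborel. norm (g n x) \<le> indicator (cball 0 (B + 1)) x *\<^sub>R M" for n
    proof (intro AE_I2)
      fix x
      show "norm (g n x) \<le> indicator (cball 0 (B + 1)) x *\<^sub>R M"
      proof (cases "norm x \<le> B + 1")
        case True
        have "\<exists>z. 0 < z \<and> z < h n \<and> f (x + h n *\<^sub>R ?e) - f (x + 0 *\<^sub>R ?e) = (h n - 0) * partial_deriv i f (x + z *\<^sub>R ?e)"
          by (rule MVT2[OF h(1)]) (rule line_deriv[OF sm])
        then obtain z where "f (x + h n *\<^sub>R ?e) - f x = h n * partial_deriv i f (x + z *\<^sub>R ?e)" by auto
        then have "g n x = partial_deriv i f (x + z *\<^sub>R ?e)"
          using h(1)[of n] by (simp add: g_def add.commute)
        then show ?thesis using True M(2) by simp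
      next
        case False
        have "x \<notin> supp f" using B[of x] False by force
        moreover have "h n *\<^sub>R ?e + x \<notin> supp f"
        proof
          assume "h n *\<^sub>R ?e + x \<in> supp f"
          then have "norm (h n *\<^sub>R ?e + x) \<le> B" by (rule B)
          moreover have "norm x \<le> norm (h n *\<^sub>R ?e + x) + norm (h n *\<^sub>R ?e)"
            using norm_triangle_ineq4[of "h n *\<^sub>R ?e + x" "h n *\<^sub>R ?e"] by simp
          ultimately show False using False h[of n] by simp
        qed
        ultimately show ?thesis using False not_in_supp[of x f] not_in_supp[of "h n *\<^sub>R ?e + x" f] by (simp add: g_def)
      qed
    qed
  qed
  then have "integral\<^sup>L lborel (partial_deriv i f) = 0"
    unfolding g0 by (simp add: LIMSEQ_const_iff)
  then show ?thesis
    using integral_completion[of "partial_deriv i f" lborel] smooth_measurable[OF smooth_partial_deriv[OF sm]] by simp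
qed

lemma integration_by_parts1:
  assumes f: "smooth f" and \<phi>: "\<phi> \<in> test_functions \<Omega>"
  shows "integral\<^sup>L lebesgue (\<lambda>x. f x * partial_deriv i \<phi> x)
    = - integral\<^sup>L lebesgue (\<lambda>x. partial_deriv i f x * \<phi> x)"
proof -
  have 1: "(\<lambda>x. f x * \<phi> x) \<in> test_functions \<Omega>" by (rule test_function_smooth_mult[OF f \<phi>])
  have 2: "(\<lambda>x. partial_deriv i f x * \<phi> x) \<in> test_functions \<Omega>"
    by (rule test_function_smooth_mult[OF smooth_partial_deriv[OF f] \<phi>])
  have 3: "(\<lambda>x. f x * partial_deriv i \<phi> x) \<in> test_functions \<Omega>"
    by (rule test_function_smooth_mult[OF f]) (use test_function_pderivs[OF \<phi>, of "[i]"] in simp)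
  have "integral\<^sup>L lebesgue (partial_deriv i (\<lambda>x. f x * \<phi> x)) = 0" by (rule integral_partial_deriv_eq_0[OF 1])
  then show ?thesis
    using test_function_integrable(2)[OF 2] test_function_integrable(2)[OF 3] test_functionD(1)[OF \<phi>] f
    by (simp add: partial_deriv_mult smooth_diffable Bochner_Integration.integral_add)
qed

text \<open>Moving the derivatives across one at a time reverses their order, which symmetry of
  mixed derivatives then restores.\<close>

lemma integration_by_parts:
  assumes f: "smooth f" and \<phi>: "\<phi> \<in> test_functions \<Omega>"
  shows "integral\<^sup>L lebesgue (\<lambda>x. f x * pderivs is \<phi> x)
    = (-1) ^ length is * integral\<^sup>L lebesgue (\<lambda>x. pderivs is f x * \<phi> x)"
proof -
  have "integral\<^sup>L lebesgue (\<lambda>x. f x * pderivs is \<phi> x)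
    = (-1) ^ length is * integral\<^sup>L lebesgue (\<lambda>x. pderivs (rev is) f x * \<phi> x)"
    using f
  proof (induction "is" arbitrary: f)
    case (Cons i "is")
    have "integral\<^sup>L lebesgue (\<lambda>x. f x * pderivs (i # is) \<phi> x)
        = - integral\<^sup>L lebesgue (\<lambda>x. partial_deriv i f x * pderivs is \<phi> x)"
      using integration_by_parts1[OF Cons.prems test_function_pderivs[OF \<phi>]] by simp
    also have "\<dots> = (-1) ^ length (i # is) * integral\<^sup>L lebesgue (\<lambda>x. pderivs (rev (i # is)) f x * \<phi> x)"
      using Cons.IH[OF smooth_partial_deriv[OF Cons.prems], of i] by simp
    finally show ?case .
  qed simp
  then show ?thesis by (simp add: pderivs_perm[OF f, of "rev is" "is"])
qed

lemma continuous_locally_integrable: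
  assumes "continuous_on UNIV f" shows "locally_integrable_on \<Omega> f"
  unfolding locally_integrable_on_def
proof (intro allI impI)
  fix K :: "(real^'a) set" assume K: "compact K \<and> K \<subseteq> \<Omega>"
  have "integrable lborel (\<lambda>x. indicator K x *\<^sub>R f x)"
    by (rule borel_integrable_compact) (use K assms continuous_on_subset in auto)
  then show "f absolutely_integrable_on K"
    unfolding set_integrable_def using integrable_completion[of "\<lambda>x. indicator K x *\<^sub>R f x" lborel] by auto
qed

lemma smooth_weak_deriv:
  assumes "smooth f" shows "is_weak_deriv \<Omega> \<sigma> f (mi_deriv \<sigma> f)"
  unfolding is_weak_deriv_def
proof (intro conjI ballI)
  show "locally_integrable_on \<Omega> f" "locally_integrable_on \<Omega> (mi_deriv \<sigma> f)"
    using assms by (auto intro!: continuous_locally_integrable smooth_continuous smooth_pderivs simp: mi_deriv_eq)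
  fix \<phi> assume \<phi>: "\<phi> \<in> test_functions \<Omega>"
  have "(LINT x:\<Omega>|lebesgue. f x * mi_deriv \<sigma> \<phi> x) = integral\<^sup>L lebesgue (\<lambda>x. f x * mi_deriv \<sigma> \<phi> x)"
    by (rule set_integral_outside) (simp add: test_function_outside[OF test_function_mi_deriv[OF \<phi>]])
  also have "\<dots> = (-1) ^ mi_order \<sigma> * integral\<^sup>L lebesgue (\<lambda>x. mi_deriv \<sigma> f x * \<phi> x)"
    unfolding mi_deriv_eq using integration_by_parts[OF assms \<phi>, of "mi_list \<sigma>"] by (simp add: length_mi_list)
  also have "integral\<^sup>L lebesgue (\<lambda>x. mi_deriv \<sigma> f x * \<phi> x) = (LINT x:\<Omega>|lebesgue. mi_deriv \<sigma> f x * \<phi> x)"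
    by (rule set_integral_outside[symmetric]) (simp add: test_function_outside[OF \<phi>])
  finally show "(LINT x:\<Omega>|lebesgue. f x * mi_deriv \<sigma> \<phi> x)
    = (-1) ^ mi_order \<sigma> * (LINT x:\<Omega>|lebesgue. mi_deriv \<sigma> f x * \<phi> x)" .
qed

text \<open>With \<psi> the derivative of \<phi> in direction \<open>i\<close>, the integral of the
  derivative of x_i \<phi>^2, namely \<phi>^2 + 2 x_i \<phi> \<psi>, is 0. The cross term is
  absorbed by completing the square in \<phi> + 2 x_i \<psi>, using that x_i is bounded by R on the
  support.\<close>

lemma poincare:
  assumes \<phi>: "\<phi> \<in> test_functions \<Omega>" and R: "\<And>x. x \<in> \<Omega> \<Longrightarrow> \<bar>x $ i\<bar> \<le> R"
  shows "integral\<^sup>L lebesgue (\<lambda>x. (\<phi> x)\<^sup>2) \<le> (2 * R)\<^sup>2 * integral\<^sup>L lebesgue (\<lambda>x. (partial_deriv i \<phi> x)\<^sup>2)"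
proof -
  let ?\<psi> = "partial_deriv i \<phi>"
  have sm: "smooth \<phi>" "smooth ?\<psi>" using \<phi> test_functionD smooth_partial_deriv by blast+
  have \<psi>: "?\<psi> \<in> test_functions \<Omega>" using test_function_pderivs[OF \<phi>, of "[i]"] by simp
  have i1: "integrable lebesgue (\<lambda>x. (\<phi> x)\<^sup>2)"
    unfolding power2_eq_square by (rule test_function_integrable[OF test_function_smooth_mult[OF sm(1) \<phi>]])
  have i2: "integrable lebesgue (\<lambda>x. (?\<psi> x)\<^sup>2)"
    unfolding power2_eq_square by (rule test_function_integrable[OF test_function_smooth_mult[OF sm(2) \<psi>]])
  have t: "(\<lambda>x. x $ i * (\<phi> x * \<phi> x)) \<in> test_functions \<Omega>"
    by (intro test_function_smooth_mult smooth_coord sm \<phi>)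
  have pd: "partial_deriv i (\<lambda>x. x $ i * (\<phi> x * \<phi> x)) = (\<lambda>x. (\<phi> x)\<^sup>2 + 2 * (x $ i) * \<phi> x * ?\<psi> x)"
    by (simp add: partial_deriv_mult partial_deriv_coord smooth_diffable smooth_coord smooth_mult sm
        fun_eq_iff power2_eq_square algebra_simps)
  have i3: "integrable lebesgue (\<lambda>x. (\<phi> x)\<^sup>2 + 2 * (x $ i) * \<phi> x * ?\<psi> x)"
    using test_function_integrable(2)[OF test_function_pderivs[OF t, of "[i]"]] by (simp add: pd)
  have "integral\<^sup>L lebesgue (\<lambda>x. (\<phi> x)\<^sup>2) / 2 - 2 * R\<^sup>2 * integral\<^sup>L lebesgue (\<lambda>x. (?\<psi> x)\<^sup>2)
      = integral\<^sup>L lebesgue (\<lambda>x. (\<phi> x)\<^sup>2 / 2 - 2 * R\<^sup>2 * (?\<psi> x)\<^sup>2)"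
    using i1 i2 by (simp add: Bochner_Integration.integral_diff)
  also have "\<dots> \<le> integral\<^sup>L lebesgue (\<lambda>x. (\<phi> x)\<^sup>2 + 2 * (x $ i) * \<phi> x * ?\<psi> x)"
  proof (rule integral_mono)
    fix x :: "real^'a"
    show "(\<phi> x)\<^sup>2 / 2 - 2 * R\<^sup>2 * (?\<psi> x)\<^sup>2 \<le> (\<phi> x)\<^sup>2 + 2 * (x $ i) * \<phi> x * ?\<psi> x"
    proof (cases "x \<in> \<Omega>")
      case True
      have "(x $ i)\<^sup>2 * (?\<psi> x)\<^sup>2 \<le> R\<^sup>2 * (?\<psi> x)\<^sup>2"
        using R[OF True] by (intro mult_right_mono) (auto simp: abs_le_square_iff[symmetric])
      moreover have "0 \<le> (\<phi> x + 2 * (x $ i) * ?\<psi> x)\<^sup>2" by simp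
      ultimately show ?thesis by (simp add: power2_eq_square algebra_simps)
    next
      case False
      then show ?thesis using test_function_outside[OF \<phi>] test_function_outside[OF \<psi>] by simp
    qed
  qed (use i1 i2 i3 in auto)
  also have "\<dots> = 0" using integral_partial_deriv_eq_0[OF t, of i] by (simp add: pd)
  finally show ?thesis by (simp add: power2_eq_square algebra_simps)
qed

text \<open>A test function is bounded, and \<open>g\<close> is integrable on its compact
  support.\<close>

lemma locally_integrable_mult_test:
  assumes g: "locally_integrable_on \<Omega> g" and \<phi>: "\<phi> \<in> test_functions \<Omega>"
  shows "integrable lebesgue (\<lambda>x. g x * \<phi> x)" "set_integrable lebesgue \<Omega> (\<lambda>x. g x * \<phi> x)"
    "(LINT x:\<Omega>|lebesgue. g x * \<phi> x) = integral\<^sup>L lebesgue (\<lambda>x. g x * \<phi> x)"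
proof -
  have out: "\<phi> x = 0" if "x \<notin> \<Omega>" for x
    using that by (rule test_function_outside[OF \<phi>])
  obtain B where B: "B \<ge> 0" "\<And>x. \<bar>\<phi> x\<bar> \<le> B" using test_function_bounded[OF \<phi>] by blast
  have "integrable lebesgue (\<lambda>x. indicator (supp \<phi>) x *\<^sub>R g x)"
    using g test_functionD(2,3)[OF \<phi>] unfolding locally_integrable_on_def set_integrable_def by blast
  then have i: "integrable lebesgue (\<lambda>x. indicator (supp \<phi>) x * g x)" by simp
  have eq: "(\<lambda>x. indicator (supp \<phi>) x * g x * \<phi> x) = (\<lambda>x. g x * \<phi> x)"
    using indicator_supp[of \<phi>] by (simp add: fun_eq_iff mult.assoc mult.left_commute[of "indicator (supp \<phi>) _"])
  have "integrable lebesgue (\<lambda>x. indicator (supp \<phi>) x * g x * \<phi> x)"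
  proof (rule Bochner_Integration.integrable_bound[where f = "\<lambda>x. B * (indicator (supp \<phi>) x * g x)"])
    show "integrable lebesgue (\<lambda>x. B * (indicator (supp \<phi>) x * g x))" using i by simp
    show "(\<lambda>x. indicator (supp \<phi>) x * g x * \<phi> x) \<in> borel_measurable lebesgue"
      by (intro borel_measurable_times borel_measurable_integrable[OF i] test_function_measurable[OF \<phi>])
    show "AE x in lebesgue. norm (indicator (supp \<phi>) x * g x * \<phi> x) \<le> norm (B * (indicator (supp \<phi>) x * g x))"
      using B by (intro AE_I2) (simp add: abs_mult mult.commute mult_right_mono)
  qed
  then show *: "integrable lebesgue (\<lambda>x. g x * \<phi> x)" unfolding eq .
  show "set_integrable lebesgue \<Omega> (\<lambda>x. g x * \<phi> x)"
    by (rule set_integral_outside(2)[THEN iffD2, OF _ *]) (simp add: out)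
  show "(LINT x:\<Omega>|lebesgue. g x * \<phi> x) = integral\<^sup>L lebesgue (\<lambda>x. g x * \<phi> x)"
    by (rule set_integral_outside) (simp add: out)
qed

text \<open>Smooth bumps show that the integral of \<open>g\<close> over every box in
  \<open>\<Omega>\<close> is 0. By Lebesgue differentiation \<open>g\<close> then vanishes almost
  everywhere on each closed box, and countably many boxes cover the open set.\<close>

lemma fundamental_lemma:
  fixes g :: "real^'n::finite \<Rightarrow> real"
  assumes \<Omega>: "open \<Omega>" and g: "locally_integrable_on \<Omega> g"
    and zero: "\<And>\<phi>. \<phi> \<in> test_functions \<Omega> \<Longrightarrow> (LINT x:\<Omega>|lebesgue. g x * \<phi> x) = 0"
  shows "AE x in lebesgue. x \<in> \<Omega> \<longrightarrow> g x = 0"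
proof -
  have box: "(LINT x:box a b|lebesgue. g x) = 0" if ab: "cbox a b \<subseteq> \<Omega>" for a b
  proof -
    have i: "integrable lebesgue (\<lambda>x. indicator (cbox a b) x * g x)"
      using g[unfolded locally_integrable_on_def set_integrable_def, rule_format, of "cbox a b"] ab by simp
    have sub: "indicator (box a b) x * (indicator (cbox a b) x * g x) = indicator (box a b) x * g x" for x
      using box_subset_cbox[of a b] by (auto simp: indicator_def)
    have "(\<lambda>n. integral\<^sup>L lebesgue (\<lambda>x. box_bump a b n x * (indicator (cbox a b) x * g x))) \<longlonglongrightarrow>
        integral\<^sup>L lebesgue (\<lambda>x. indicator (box a b) x * (indicator (cbox a b) x * g x))"
    proof (rule integral_dominated_convergence[where w = "\<lambda>x. norm (indicator (cbox a b) x * g x)"])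
      show "(\<lambda>x. indicator (box a b) x * (indicator (cbox a b) x * g x)) \<in> borel_measurable lebesgue"
        by (rule borel_measurable_times[OF borel_measurable_indicator borel_measurable_integrable[OF i]]) simp
      show "(\<lambda>x. box_bump a b n x * (indicator (cbox a b) x * g x)) \<in> borel_measurable lebesgue" for n
        by (rule borel_measurable_times[OF test_function_measurable[OF box_bump_test[OF ab]] borel_measurable_integrable[OF i]])
      show "integrable lebesgue (\<lambda>x. norm (indicator (cbox a b) x * g x))" using i by (rule integrable_norm)
      show "AE x in lebesgue. (\<lambda>n. box_bump a b n x * (indicator (cbox a b) x * g x))
          \<longlonglongrightarrow> indicator (box a b) x * (indicator (cbox a b) x * g x)"
        by (intro AE_I2 tendsto_mult box_bump_tendsto tendsto_const)
      show "AE x in lebesgue. norm (box_bump a b n x * (indicator (cbox a b) x * g x)) \<le> norm (indicator (cbox a b) x * g x)" for n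
        using box_bump_bounds[of a b n] by (intro AE_I2) (simp add: abs_mult mult_left_le_one_le)
    qed
    moreover have "integral\<^sup>L lebesgue (\<lambda>x. box_bump a b n x * (indicator (cbox a b) x * g x)) = 0" for n
    proof -
      have "box_bump a b n x * (indicator (cbox a b) x * g x) = g x * box_bump a b n x" for x
        using box_bump_outside[of x a b n] box_subset_cbox[of a b] by (cases "x \<in> cbox a b") auto
      then have "(\<lambda>x. box_bump a b n x * (indicator (cbox a b) x * g x)) = (\<lambda>x. g x * box_bump a b n x)"
        by (rule ext)
      then show ?thesis
        using zero[OF box_bump_test[OF ab, of n]] locally_integrable_mult_test(3)[OF g box_bump_test[OF ab, of n]] by simp
    qed
    ultimately have "integral\<^sup>L lebesgue (\<lambda>x. indicator (box a b) x * g x) = 0"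
      by (simp add: sub LIMSEQ_const_iff)
    then show ?thesis by (simp add: set_lebesgue_integral_def)
  qed
  have cb: "AE x in lebesgue. x \<in> cbox a b \<longrightarrow> g x = 0" if ab: "cbox a b \<subseteq> \<Omega>" for a b
  proof -
    let ?G = "\<lambda>x. indicator (cbox a b) x *\<^sub>R g x"
    have i: "integrable lebesgue ?G"
      using g ab compact_cbox unfolding locally_integrable_on_def set_integrable_def by blast
    have ai: "?G absolutely_integrable_on S" if "S \<in> sets lebesgue" for S
    proof -
      have "?G absolutely_integrable_on UNIV" using i by (simp add: set_integrable_def)
      then show ?thesis by (rule set_integrable_subset) (use that in auto)
    qed
    have "?G integrable_on cbox c d" for c d
      using ai[of "cbox c d"] set_lebesgue_integral_eq_integral(1) by auto
    \<comment> \<open>Off a null set the averages of \<open>?G\<close> over small cubes with lower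
      corner x converge to its value at x. For x in the open box these averages are 0.\<close>
    then obtain N where N: "negligible N"
       "\<And>x e. \<lbrakk>x \<notin> N; 0 < e\<rbrakk> \<Longrightarrow> \<exists>d>0. \<forall>h. 0 < h \<and> h < d \<longrightarrow>
           norm (integral (cbox x (x + h *\<^sub>R One)) ?G /\<^sub>R h ^ DIM(real^'n) - ?G x) < e"
      by (rule integrable_ccontinuous_explicit) (rule that, assumption, blast)
    have "g x = 0" if x: "x \<in> box a b" "x \<notin> N" for x
    proof (rule ccontr)
      assume "g x \<noteq> 0"
      then obtain d where d: "d > 0" "\<And>h. 0 < h \<and> h < d \<Longrightarrow>
           norm (integral (cbox x (x + h *\<^sub>R One)) ?G /\<^sub>R h ^ DIM(real^'n) - ?G x) < \<bar>g x\<bar>"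
        using N(2)[OF x(2), of "\<bar>g x\<bar>"] by auto
      have "open (box a b)" by (rule open_box)
      then obtain r where r: "r > 0" "cball x r \<subseteq> box a b" using x open_contains_cball by blast
      \<comment> \<open>The distance from x within the cube is at most the l1 norm, hence at most h
        times the dimension; this choice keeps the cube in the ball of radius r.\<close>
      define h where "h = min (d / 2) (r / real (DIM(real^'n)))"
      have h: "0 < h" "h < d" "h * real (DIM(real^'n)) \<le> r"
        using d(1) r(1) by (auto simp: h_def min_def field_simps)
      have sub: "cbox x (x + h *\<^sub>R One) \<subseteq> box a b"
      proof -
        have "y \<in> cball x r" if y: "y \<in> cbox x (x + h *\<^sub>R One)" for y
        proof -
          have "norm (y - x) \<le> (\<Sum>b\<in>Basis. \<bar>(y - x) \<bullet> b\<bar>)" by (rule norm_le_l1)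
          also have "\<dots> \<le> (\<Sum>b\<in>(Basis::(real^'n) set). h)"
            using y by (intro sum_mono) (auto simp: mem_box inner_diff_left inner_add_left)
          also have "\<dots> \<le> r" using h(3) by (simp add: mult.commute)
          finally show ?thesis by (simp add: dist_norm norm_minus_commute)
        qed
        then show ?thesis using r(2) by blast
      qed
      have sub2: "cbox x (x + h *\<^sub>R One) \<subseteq> cbox a b" using sub box_subset_cbox by blast
      have "integral (cbox x (x + h *\<^sub>R One)) ?G = integral (box x (x + h *\<^sub>R One)) ?G"
        by (rule integral_open_interval[symmetric])
      also have "\<dots> = (LINT y:box x (x + h *\<^sub>R One)|lebesgue. ?G y)"
        by (rule set_lebesgue_integral_eq_integral(2)[symmetric]) (rule ai, simp)
      also have "\<dots> = (LINT y:box x (x + h *\<^sub>R One)|lebesgue. g y)"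
        unfolding set_lebesgue_integral_def
        by (rule Bochner_Integration.integral_cong) (use sub2 box_subset_cbox[of x "x + h *\<^sub>R One"] in \<open>auto simp: indicator_def\<close>)
      also have "\<dots> = 0" using box[of x "x + h *\<^sub>R One"] sub2 ab by blast
      finally have "\<bar>?G x\<bar> < \<bar>g x\<bar>" using d(2)[of h] h by simp
      then show False using x box_subset_cbox[of a b] by (auto simp: indicator_def split: if_splits)
    qed
    \<comment> \<open>The differentiation argument needs room around x, so the boundary of the box
      is discarded along with N.\<close>
    moreover have "negligible (N \<union> (cbox a b - box a b))"
      using N(1) negligible_frontier_interval[of a b] by (simp add: negligible_Un)
    ultimately show ?thesis
      by (intro AE_I'[where N = "N \<union> (cbox a b - box a b)"]) (auto simp: negligible_iff_null_sets)
  qed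
  obtain \<D> where \<D>: "countable \<D>" "\<D> \<subseteq> Pow \<Omega>" "\<And>X. X \<in> \<D> \<Longrightarrow> \<exists>a b. X = cbox a b" "\<Union>\<D> = \<Omega>"
    using open_countable_Union_open_cbox[OF \<Omega>] by metis
  have "AE x in lebesgue. \<forall>X\<in>\<D>. x \<in> X \<longrightarrow> g x = 0"
    unfolding AE_ball_countable[OF \<D>(1)] using \<D>(2,3) cb by blast
  then show ?thesis by eventually_elim (use \<D>(4) in blast)
qed

lemma locally_integrable_diff:
  assumes "locally_integrable_on \<Omega> g" "locally_integrable_on \<Omega> h"
  shows "locally_integrable_on \<Omega> (\<lambda>x. g x - h x)"
  using assms set_integral_diff(1) unfolding locally_integrable_on_def by blast

lemma weak_deriv_unique:
  assumes "open \<Omega>" "is_weak_deriv \<Omega> \<sigma> u g" "is_weak_deriv \<Omega> \<sigma> u h"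
  shows "AE x in lebesgue. x \<in> \<Omega> \<longrightarrow> g x = h x"
proof -
  have g: "locally_integrable_on \<Omega> g" and h: "locally_integrable_on \<Omega> h"
    using assms by (auto simp: is_weak_deriv_def)
  have "AE x in lebesgue. x \<in> \<Omega> \<longrightarrow> g x - h x = 0"
  proof (rule fundamental_lemma[OF assms(1) locally_integrable_diff[OF g h]])
    fix \<phi> assume \<phi>: "\<phi> \<in> test_functions \<Omega>"
    have "(-1) ^ mi_order \<sigma> * (LINT x:\<Omega>|lebesgue. g x * \<phi> x) = (-1) ^ mi_order \<sigma> * (LINT x:\<Omega>|lebesgue. h x * \<phi> x)"
      using assms(2,3) \<phi> by (simp add: is_weak_deriv_def)
    then have "(LINT x:\<Omega>|lebesgue. g x * \<phi> x) = (LINT x:\<Omega>|lebesgue. h x * \<phi> x)" by simp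
    then show "(LINT x:\<Omega>|lebesgue. (g x - h x) * \<phi> x) = 0"
      using set_integral_diff(2)[OF locally_integrable_mult_test(2)[OF g \<phi>] locally_integrable_mult_test(2)[OF h \<phi>]]
      by (simp add: left_diff_distrib)
  qed
  then show ?thesis by eventually_elim simp
qed

lemma is_weak_deriv_weak_deriv: "is_weak_deriv \<Omega> \<sigma> u g \<Longrightarrow> is_weak_deriv \<Omega> \<sigma> u (weak_deriv \<Omega> \<sigma> u)"
  unfolding weak_deriv_def by (rule someI[of "is_weak_deriv \<Omega> \<sigma> u" g])

text \<open>Links the chosen representative \<open>weak_deriv\<close> with any weak derivative
  computed explicitly; this is how identities reach it.\<close>

lemma weak_deriv_AE:
  "open \<Omega> \<Longrightarrow> is_weak_deriv \<Omega> \<sigma> u g \<Longrightarrow> AE x in lebesgue. x \<in> \<Omega> \<longrightarrow> weak_deriv \<Omega> \<sigma> u x = g x"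
  using weak_deriv_unique is_weak_deriv_weak_deriv by blast

section \<open>Square integrable functions\<close>

definition l2 :: "'a measure \<Rightarrow> ('a \<Rightarrow> real) \<Rightarrow> bool" where
  "l2 M f \<longleftrightarrow> f \<in> borel_measurable M \<and> integrable M (\<lambda>x. (f x)\<^sup>2)"

lemma l2_mult_integrable:
  assumes "l2 M f" "l2 M g" shows "integrable M (\<lambda>x. f x * g x)"
proof (rule Bochner_Integration.integrable_bound[where f = "\<lambda>x. (f x)\<^sup>2 + (g x)\<^sup>2"])
  show "integrable M (\<lambda>x. (f x)\<^sup>2 + (g x)\<^sup>2)" "(\<lambda>x. f x * g x) \<in> borel_measurable M"
    using assms by (auto simp: l2_def)
  show "AE x in M. norm (f x * g x) \<le> norm ((f x)\<^sup>2 + (g x)\<^sup>2)"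
  proof (intro AE_I2)
    fix x
    have "2 * \<bar>f x\<bar> * \<bar>g x\<bar> \<le> \<bar>f x\<bar>\<^sup>2 + \<bar>g x\<bar>\<^sup>2" by (rule sum_squares_bound)
    moreover have "0 \<le> \<bar>f x\<bar> * \<bar>g x\<bar>" by simp
    moreover have "norm (f x * g x) = \<bar>f x\<bar> * \<bar>g x\<bar>" "norm ((f x)\<^sup>2 + (g x)\<^sup>2) = \<bar>f x\<bar>\<^sup>2 + \<bar>g x\<bar>\<^sup>2"
      by (simp_all add: abs_mult)
    ultimately show "norm (f x * g x) \<le> norm ((f x)\<^sup>2 + (g x)\<^sup>2)" by linarith
  qed
qed

lemma l2_add: assumes "l2 M f" "l2 M g" shows "l2 M (\<lambda>x. f x + g x)"
proof -
  have "integrable M (\<lambda>x. (f x)\<^sup>2 + (g x)\<^sup>2 + 2 * (f x * g x))"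
    using assms l2_mult_integrable[OF assms] by (simp add: l2_def)
  moreover have "(\<lambda>x. f x + g x) \<in> borel_measurable M"
    using assms by (intro borel_measurable_add) (auto simp: l2_def)
  ultimately show ?thesis by (simp add: l2_def power2_sum mult.assoc)
qed

lemma l2_cmult: "l2 M f \<Longrightarrow> l2 M (\<lambda>x. c * f x)"
  by (auto simp: l2_def power_mult_distrib)

lemma l2_diff: assumes "l2 M f" "l2 M g" shows "l2 M (\<lambda>x. f x - g x)"
  using l2_add[OF assms(1) l2_cmult[OF assms(2), of "-1"]] by simp

text \<open>Serves twice: with \<open>a\<close> and \<open>c\<close> squared norms it is
  Cauchy-Schwarz, and with \<open>a = 0\<close> it says that the first variation at a minimum
  vanishes.\<close>

lemma quadratic_discriminant_le:
  fixes a b c :: real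
  assumes "\<And>t. 0 \<le> a + t * b + t\<^sup>2 * c" "0 \<le> c"
  shows "b\<^sup>2 \<le> 4 * a * c"
proof (cases "c = 0")
  case True
  have "b = 0"
  proof (rule ccontr)
    assume "b \<noteq> 0"
    \<comment> \<open>At this t the affine function takes the value -1.\<close>
    then show False using assms(1)[of "- (a + 1) / b"] True by simp
  qed
  then show ?thesis using True by simp
next
  case False
  then have c: "c > 0" using assms(2) by simp
  have "0 \<le> a + (- b / (2 * c)) * b + (- b / (2 * c))\<^sup>2 * c" by (rule assms(1))
  also have "\<dots> = a - b\<^sup>2 / (4 * c)" using c by (simp add: field_simps power2_eq_square)
  finally show ?thesis using c by (simp add: field_simps)
qed

lemma l2_Cauchy_Schwarz:
  assumes f: "l2 M f" and g: "l2 M g"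
  shows "(\<integral>x. f x * g x \<partial>M)\<^sup>2 \<le> (\<integral>x. (f x)\<^sup>2 \<partial>M) * (\<integral>x. (g x)\<^sup>2 \<partial>M)"
proof -
  have i: "integrable M (\<lambda>x. (f x)\<^sup>2)" "integrable M (\<lambda>x. (g x)\<^sup>2)" "integrable M (\<lambda>x. f x * g x)"
    using f g l2_mult_integrable[OF f g] by (auto simp: l2_def)
  have "(2 * (\<integral>x. f x * g x \<partial>M))\<^sup>2 \<le> 4 * (\<integral>x. (f x)\<^sup>2 \<partial>M) * (\<integral>x. (g x)\<^sup>2 \<partial>M)"
  proof (rule quadratic_discriminant_le)
    fix t :: real
    have "0 \<le> (\<integral>x. (f x + t * g x)\<^sup>2 \<partial>M)" by simp
    also have "(\<lambda>x. (f x + t * g x)\<^sup>2) = (\<lambda>x. (f x)\<^sup>2 + (2 * t) * (f x * g x) + t\<^sup>2 * (g x)\<^sup>2)"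
      by (rule ext) (simp add: power2_sum power_mult_distrib)
    also have "(\<integral>x. (f x)\<^sup>2 + (2 * t) * (f x * g x) + t\<^sup>2 * (g x)\<^sup>2 \<partial>M)
        = (\<integral>x. (f x)\<^sup>2 \<partial>M) + (2 * t) * (\<integral>x. f x * g x \<partial>M) + t\<^sup>2 * (\<integral>x. (g x)\<^sup>2 \<partial>M)"
      using i by simp
    finally show "0 \<le> (\<integral>x. (f x)\<^sup>2 \<partial>M) + t * (2 * (\<integral>x. f x * g x \<partial>M)) + t\<^sup>2 * (\<integral>x. (g x)\<^sup>2 \<partial>M)"
      by (simp add: mult.assoc mult.left_commute)
  qed simp
  then show ?thesis by (simp add: power_mult_distrib)
qed

text \<open>Riesz-Fischer. Along a subsequence with squared increments below 4^-j, the weighted sum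
  of 2^j times the squared increments has finite integral, hence is finite almost everywhere and
  forces pointwise convergence. Fatou's lemma turns the pointwise limit into the limit in the
  mean.\<close>

lemma l2_complete:
  assumes f: "\<And>n. l2 M (f n)"
    and cauchy: "\<And>e. e > 0 \<Longrightarrow> \<exists>N. \<forall>m\<ge>N. \<forall>n\<ge>N. (\<integral>x. (f m x - f n x)\<^sup>2 \<partial>M) < e"
  obtains g where "l2 M g" "(\<lambda>n. \<integral>x. (f n x - g x)\<^sup>2 \<partial>M) \<longlonglongrightarrow> 0"
proof -
  have "\<exists>N. \<forall>m\<ge>N. \<forall>n\<ge>N. (\<integral>x. (f m x - f n x)\<^sup>2 \<partial>M) < (1 / 4) ^ j" for j :: nat
    by (rule cauchy) simp
  then obtain N where N: "\<And>j m n. m \<ge> N j \<Longrightarrow> n \<ge> N j \<Longrightarrow> (\<integral>x. (f m x - f n x)\<^sup>2 \<partial>M) < (1 / 4) ^ j"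
    by metis
  define r where "r j = (\<Sum>i\<le>j. N i) + j" for j
  have rN: "N j \<le> r j" for j
    using member_le_sum[of j "{..j}" N] by (simp add: r_def)
  have rmono: "r j \<le> r (Suc j)" for j by (simp add: r_def)
  have rj: "j \<le> r j" for j by (simp add: r_def)
  define d where "d j x = f (r (Suc j)) x - f (r j) x" for j x
  have d2: "l2 M (d j)" for j unfolding d_def[abs_def] by (intro l2_diff f)
  have dm [measurable]: "d j \<in> borel_measurable M" and di: "integrable M (\<lambda>x. (d j x)\<^sup>2)" for j
    using d2[of j] by (auto simp: l2_def)
  have dsm: "(\<integral>x. (d j x)\<^sup>2 \<partial>M) \<le> (1 / 4) ^ j" for j
    unfolding d_def using N[of j "r (Suc j)" "r j"] rN[of j] rmono[of j] by simp
  have "(\<integral>\<^sup>+x. (\<Sum>j. ennreal (2 ^ j * (d j x)\<^sup>2)) \<partial>M) = (\<Sum>j. \<integral>\<^sup>+x. ennreal (2 ^ j * (d j x)\<^sup>2) \<partial>M)"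
    by (intro nn_integral_suminf) measurable
  also have "\<dots> \<le> (\<Sum>j. ennreal ((1 / 2) ^ j))"
  proof (intro suminf_le summableI)
    fix j
    have "(\<integral>\<^sup>+x. ennreal (2 ^ j * (d j x)\<^sup>2) \<partial>M) = ennreal (\<integral>x. 2 ^ j * (d j x)\<^sup>2 \<partial>M)"
      using di[of j] by (intro nn_integral_eq_integral) auto
    also have "(\<integral>x. 2 ^ j * (d j x)\<^sup>2 \<partial>M) \<le> 2 ^ j * (1 / 4) ^ j"
      using dsm[of j] by simp
    also have "(2::real) ^ j * (1 / 4) ^ j = (1 / 2) ^ j" by (simp flip: power_mult_distrib)
    finally show "(\<integral>\<^sup>+x. ennreal (2 ^ j * (d j x)\<^sup>2) \<partial>M) \<le> ennreal ((1 / 2) ^ j)"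
      by (simp add: ennreal_leI)
  qed
  also have "\<dots> = ennreal (\<Sum>j. (1 / 2) ^ j)"
    by (rule suminf_ennreal2) (auto intro: summable_geometric)
  finally have fin: "(\<integral>\<^sup>+x. (\<Sum>j. ennreal (2 ^ j * (d j x)\<^sup>2)) \<partial>M) \<noteq> \<infinity>"
    by (auto simp: top_unique)
  have "AE x in M. (\<Sum>j. ennreal (2 ^ j * (d j x)\<^sup>2)) \<noteq> \<infinity>"
    by (rule nn_integral_PInf_AE[OF _ fin]) measurable
  then have conv: "AE x in M. convergent (\<lambda>j. f (r j) x)"
  proof eventually_elim
    fix x assume "(\<Sum>j. ennreal (2 ^ j * (d j x)\<^sup>2)) \<noteq> \<infinity>"
    then have s: "summable (\<lambda>j. 2 ^ j * (d j x)\<^sup>2)"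
      by (intro summable_suminf_not_top) auto
    have "summable (\<lambda>j. d j x)"
    proof (rule summable_comparison_test')
      show "summable (\<lambda>j. (1 / 2) ^ j + 2 ^ j * (d j x)\<^sup>2)"
        by (intro summable_add s summable_geometric) simp
      fix j :: nat
      \<comment> \<open>The weighted inequality between arithmetic and geometric mean bounds |d_j|
        by 2^-j + 2^j d_j^2, two summable terms.\<close>
      have "0 \<le> ((1 / 2) ^ j - \<bar>d j x\<bar>)\<^sup>2" by simp
      then have "2 * (1 / 2) ^ j * \<bar>d j x\<bar> \<le> ((1 / 2) ^ j)\<^sup>2 + (d j x)\<^sup>2"
        by (simp add: power2_diff)
      then have "2 ^ j * (2 * (1 / 2) ^ j * \<bar>d j x\<bar>) \<le> 2 ^ j * (((1 / 2) ^ j)\<^sup>2 + (d j x)\<^sup>2)"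
        by (intro mult_left_mono) auto
      also have "2 ^ j * (2 * (1 / 2) ^ j * \<bar>d j x\<bar>) = 2 * \<bar>d j x\<bar>"
        by (simp add: power_divide)
      also have "2 ^ j * (((1 / 2) ^ j)\<^sup>2 + (d j x)\<^sup>2) = (1 / 2) ^ j + 2 ^ j * (d j x)\<^sup>2"
        by (simp add: power2_eq_square distrib_left power_divide)
      finally show "norm (d j x) \<le> (1 / 2) ^ j + 2 ^ j * (d j x)\<^sup>2" by simp
    qed
    then have "(\<lambda>n. \<Sum>j<n. d j x) \<longlonglongrightarrow> (\<Sum>j. d j x)" by (rule summable_LIMSEQ)
    moreover have "(\<Sum>j<n. d j x) = f (r n) x - f (r 0) x" for n
      unfolding d_def by (rule sum_lessThan_telescope)
    ultimately have "(\<lambda>n. f (r n) x - f (r 0) x) \<longlonglongrightarrow> (\<Sum>j. d j x)" by simp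
    then have "(\<lambda>n. f (r n) x - f (r 0) x + f (r 0) x) \<longlonglongrightarrow> (\<Sum>j. d j x) + f (r 0) x"
      by (intro tendsto_add tendsto_const)
    then show "convergent (\<lambda>j. f (r j) x)" by (auto simp: convergent_def)
  qed
  define g where "g x = lim (\<lambda>j. f (r j) x)" for x
  have gm: "g \<in> borel_measurable M"
    unfolding g_def[abs_def] using f by (intro borel_measurable_lim_metric) (simp add: l2_def)
  have key: "integrable M (\<lambda>x. (f n x - g x)\<^sup>2) \<and> (\<integral>x. (f n x - g x)\<^sup>2 \<partial>M) \<le> (1 / 4) ^ i" if n: "n \<ge> N i" for n i
  proof -
    have fm: "f n \<in> borel_measurable M" for n using f by (simp add: l2_def)
    \<comment> \<open>Fatou along the subsequence, with \<open>n\<close> fixed; the Cauchy bound for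
      \<open>f n\<close> against late members of the subsequence survives in the limit.\<close>
    have "(\<integral>\<^sup>+x. ennreal ((f n x - g x)\<^sup>2) \<partial>M) \<le> (\<integral>\<^sup>+x. liminf (\<lambda>j. ennreal ((f n x - f (r j) x)\<^sup>2)) \<partial>M)"
    proof (rule nn_integral_mono_AE)
      show "AE x in M. ennreal ((f n x - g x)\<^sup>2) \<le> liminf (\<lambda>j. ennreal ((f n x - f (r j) x)\<^sup>2))"
        using conv
      proof eventually_elim
        fix x assume "convergent (\<lambda>j. f (r j) x)"
        then have "(\<lambda>j. f (r j) x) \<longlonglongrightarrow> g x" by (simp add: g_def convergent_LIMSEQ_iff)
        then have "(\<lambda>j. ennreal ((f n x - f (r j) x)\<^sup>2)) \<longlonglongrightarrow> ennreal ((f n x - g x)\<^sup>2)"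
          by (intro tendsto_ennrealI tendsto_power tendsto_diff tendsto_const)
        then have "liminf (\<lambda>j. ennreal ((f n x - f (r j) x)\<^sup>2)) = ennreal ((f n x - g x)\<^sup>2)"
          by (intro lim_imp_Liminf) auto
        then show "ennreal ((f n x - g x)\<^sup>2) \<le> liminf (\<lambda>j. ennreal ((f n x - f (r j) x)\<^sup>2))" by simp
      qed
    qed
    also have "\<dots> \<le> liminf (\<lambda>j. \<integral>\<^sup>+x. ennreal ((f n x - f (r j) x)\<^sup>2) \<partial>M)"
      using fm by (intro nn_integral_liminf) auto
    also have "\<dots> \<le> ennreal ((1 / 4) ^ i)"
    proof (rule Liminf_le)
      have "\<forall>j\<ge>N i. (\<integral>\<^sup>+x. ennreal ((f n x - f (r j) x)\<^sup>2) \<partial>M) \<le> ennreal ((1 / 4) ^ i)"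
      proof (intro allI impI)
        fix j assume j: "N i \<le> j"
        have "(\<integral>\<^sup>+x. ennreal ((f n x - f (r j) x)\<^sup>2) \<partial>M) = ennreal (\<integral>x. (f n x - f (r j) x)\<^sup>2 \<partial>M)"
          using l2_diff[OF f f, of n "r j"] by (intro nn_integral_eq_integral) (auto simp: l2_def)
        also have "\<dots> \<le> ennreal ((1 / 4) ^ i)"
          using N[OF n, of "r j"] j rj[of j] by (intro ennreal_leI) auto
        finally show "(\<integral>\<^sup>+x. ennreal ((f n x - f (r j) x)\<^sup>2) \<partial>M) \<le> ennreal ((1 / 4) ^ i)" .
      qed
      then show "\<forall>\<^sub>F j in sequentially. (\<integral>\<^sup>+x. ennreal ((f n x - f (r j) x)\<^sup>2) \<partial>M) \<le> ennreal ((1 / 4) ^ i)"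
        by (auto simp: eventually_sequentially)
    qed simp
    finally have le: "(\<integral>\<^sup>+x. ennreal ((f n x - g x)\<^sup>2) \<partial>M) \<le> ennreal ((1 / 4) ^ i)" .
    have int: "integrable M (\<lambda>x. (f n x - g x)\<^sup>2)"
      using le fm gm by (intro integrableI_nonneg) (auto intro: le_less_trans)
    have "ennreal (\<integral>x. (f n x - g x)\<^sup>2 \<partial>M) \<le> ennreal ((1 / 4) ^ i)"
      using le nn_integral_eq_integral[OF int] by simp
    then show ?thesis using int by (simp add: ennreal_le_iff)
  qed
  have "l2 M (\<lambda>x. f (N 0) x - g x)"
    using key[of 0 "N 0"] borel_measurable_diff[OF _ gm, of "f (N 0)"] f by (auto simp: l2_def)
  from l2_diff[OF f[of "N 0"] this] have g: "l2 M g" by simp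
  have "(\<lambda>n. \<integral>x. (f n x - g x)\<^sup>2 \<partial>M) \<longlonglongrightarrow> 0"
  proof (rule LIMSEQ_I)
    fix e :: real assume "e > 0"
    then obtain i where i: "(1 / 4 :: real) ^ i < e" using real_arch_pow_inv[of e "1 / 4"] by auto
    show "\<exists>no. \<forall>n\<ge>no. norm ((\<integral>x. (f n x - g x)\<^sup>2 \<partial>M) - 0) < e"
    proof (intro exI[of _ "N i"] allI impI)
      fix n assume "N i \<le> n"
      with key[of i n] i show "norm ((\<integral>x. (f n x - g x)\<^sup>2 \<partial>M) - 0) < e" by simp
    qed
  qed
  with g that show ?thesis by blast
qed

text \<open>Completeness of the measure transfers measurability across almost everywhere equality.
  If one side is not integrable, neither is the other, and both integrals have the default value
  0.\<close>

lemma lebesgue_integral_cong_AE: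
  fixes F G :: "'a::euclidean_space \<Rightarrow> real"
  assumes "AE x in lebesgue. F x = G x"
  shows "integral\<^sup>L lebesgue F = integral\<^sup>L lebesgue G" "integrable lebesgue F \<longleftrightarrow> integrable lebesgue G"
proof -
  have sym: "AE x in lebesgue. G x = F x" using assms by eventually_elim simp
  have m: "F \<in> borel_measurable lebesgue \<longleftrightarrow> G \<in> borel_measurable lebesgue"
    using borel_measurable_AE[OF _ assms] borel_measurable_AE[OF _ sym] by blast
  show i: "integrable lebesgue F \<longleftrightarrow> integrable lebesgue G"
    using integrable_cong_AE[OF _ _ assms] m borel_measurable_integrable by blast
  show "integral\<^sup>L lebesgue F = integral\<^sup>L lebesgue G"
  proof (cases "integrable lebesgue F")
    case True
    then show ?thesis using integral_cong_AE[OF _ _ assms] m borel_measurable_integrable by blast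
  next
    case False
    then show ?thesis using i by (simp add: not_integrable_integral_eq)
  qed
qed

text \<open>The domain may change by a null set too, which is how closed elements are exchanged for
  their interiors.\<close>

lemma set_integral_cong_AE_sets:
  fixes f g :: "'a::euclidean_space \<Rightarrow> real"
  assumes "AE x in lebesgue. (x \<in> S \<longleftrightarrow> x \<in> T) \<and> (x \<in> S \<longrightarrow> f x = g x)"
  shows "(LINT x:S|lebesgue. f x) = (LINT x:T|lebesgue. g x)"
    "set_integrable lebesgue S f \<longleftrightarrow> set_integrable lebesgue T g"
proof -
  have "AE x in lebesgue. indicator S x *\<^sub>R f x = indicator T x *\<^sub>R g x"
    using assms by eventually_elim (auto split: split_indicator)
  from lebesgue_integral_cong_AE[OF this]
  show "(LINT x:S|lebesgue. f x) = (LINT x:T|lebesgue. g x)"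
    "set_integrable lebesgue S f \<longleftrightarrow> set_integrable lebesgue T g"
    by (simp_all add: set_lebesgue_integral_def set_integrable_def)
qed

lemma square_integrable_iff_l2: "square_integrable_on S f \<longleftrightarrow> l2 lebesgue (\<lambda>x. indicator S x * f x)"
proof -
  have "(\<lambda>x. (indicator S x * f x)\<^sup>2) = (\<lambda>x. indicator S x *\<^sub>R (f x)\<^sup>2)"
    by (auto simp: fun_eq_iff split: split_indicator)
  then show ?thesis
    by (simp add: square_integrable_on_def l2_def set_borel_measurable_def set_integrable_def)
qed

lemma sq_cong_AE:
  assumes "AE x in lebesgue. (x \<in> S \<longleftrightarrow> x \<in> T) \<and> (x \<in> S \<longrightarrow> f x = g x)" "square_integrable_on S f"
  shows "square_integrable_on T g"
proof -
  have ae: "AE x in lebesgue. indicator S x * f x = indicator T x * g x"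
    using assms(1) by eventually_elim (auto split: split_indicator)
  then have ae2: "AE x in lebesgue. (indicator S x * f x)\<^sup>2 = (indicator T x * g x)\<^sup>2"
    by eventually_elim simp
  show ?thesis
    using assms(2) lebesgue_integral_cong_AE(2)[OF ae2] borel_measurable_AE[OF _ ae]
    unfolding square_integrable_iff_l2 l2_def by simp
qed

lemma indicator_mult_mult:
  "(indicator S x * f x) * (indicator S x * g x) = indicator S x *\<^sub>R (f x * g x :: real)"
  by (auto simp: fun_eq_iff split: split_indicator)

lemma sq_mult_integrable:
  "square_integrable_on S f \<Longrightarrow> square_integrable_on S g \<Longrightarrow> set_integrable lebesgue S (\<lambda>x. f x * g x)"
  using l2_mult_integrable[of lebesgue "\<lambda>x. indicator S x * f x" "\<lambda>x. indicator S x * g x"]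
  unfolding square_integrable_iff_l2 set_integrable_def indicator_mult_mult by simp

lemma sq_integrable: "square_integrable_on S f \<Longrightarrow> set_integrable lebesgue S (\<lambda>x. (f x)\<^sup>2)"
  by (simp add: square_integrable_on_def)

lemma sq_add:
  "square_integrable_on S f \<Longrightarrow> square_integrable_on S g \<Longrightarrow> square_integrable_on S (\<lambda>x. f x + g x)"
  unfolding square_integrable_iff_l2 distrib_left by (rule l2_add)

lemma sq_cmult: "square_integrable_on S f \<Longrightarrow> square_integrable_on S (\<lambda>x. c * f x)"
  unfolding square_integrable_iff_l2 mult.left_commute[of _ c] by (rule l2_cmult)

lemma sq_diff:
  "square_integrable_on S f \<Longrightarrow> square_integrable_on S g \<Longrightarrow> square_integrable_on S (\<lambda>x. f x - g x)"
  unfolding square_integrable_iff_l2 right_diff_distrib by (rule l2_diff)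

lemma sq_zero: "square_integrable_on S (\<lambda>x. 0)"
  by (simp add: square_integrable_iff_l2 l2_def)

lemma sq_subset:
  assumes "square_integrable_on S f" "T \<in> sets lebesgue" "T \<subseteq> S"
  shows "square_integrable_on T f"
proof -
  have "(\<lambda>x. indicator T x * (indicator S x * f x)) \<in> borel_measurable lebesgue"
    by (rule borel_measurable_times) (use assms(1,2) in \<open>auto simp: square_integrable_iff_l2 l2_def\<close>)
  moreover have "(\<lambda>x. indicator T x * (indicator S x * f x)) = (\<lambda>x. indicator T x * f x)"
    using assms(3) by (auto simp: fun_eq_iff split: split_indicator)
  ultimately show ?thesis
    using set_integrable_subset[OF sq_integrable[OF assms(1)] assms(2,3)]
    by (simp add: square_integrable_on_def set_borel_measurable_def)
qed

lemma sq_bounded_mult: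
  assumes "square_integrable_on S f" "set_borel_measurable lebesgue S b" "AE x in lebesgue. x \<in> S \<longrightarrow> \<bar>b x\<bar> \<le> B"
  shows "square_integrable_on S (\<lambda>x. b x * f x)"
    "(LINT x:S|lebesgue. (b x * f x)\<^sup>2) \<le> B\<^sup>2 * (LINT x:S|lebesgue. (f x)\<^sup>2)"
proof -
  have le: "AE x in lebesgue. x \<in> S \<longrightarrow> (b x * f x)\<^sup>2 \<le> B\<^sup>2 * (f x)\<^sup>2"
    using assms(3)
  proof eventually_elim
    fix x assume *: "x \<in> S \<longrightarrow> \<bar>b x\<bar> \<le> B"
    show "x \<in> S \<longrightarrow> (b x * f x)\<^sup>2 \<le> B\<^sup>2 * (f x)\<^sup>2"
      using * by (auto simp: power_mult_distrib abs_le_square_iff[symmetric] intro!: mult_right_mono)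
  qed
  have "(\<lambda>x. (indicator S x *\<^sub>R b x) * (indicator S x * f x)) \<in> borel_measurable lebesgue"
    by (rule borel_measurable_times)
      (use assms(1,2) in \<open>auto simp: square_integrable_iff_l2 l2_def set_borel_measurable_def\<close>)
  moreover have "(\<lambda>x. (indicator S x *\<^sub>R b x) * (indicator S x * f x)) = (\<lambda>x. indicator S x *\<^sub>R (b x * f x))"
    by (auto simp: fun_eq_iff split: split_indicator)
  ultimately have m: "(\<lambda>x. indicator S x *\<^sub>R (b x * f x)) \<in> borel_measurable lebesgue" by simp
  have "(\<lambda>x. (indicator S x *\<^sub>R (b x * f x))\<^sup>2) \<in> borel_measurable lebesgue"
    using m by (rule borel_measurable_power)
  moreover have "(\<lambda>x. (indicator S x *\<^sub>R (b x * f x))\<^sup>2) = (\<lambda>x. indicator S x *\<^sub>R (b x * f x)\<^sup>2)"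
    by (auto simp: fun_eq_iff split: split_indicator)
  ultimately have m2: "set_borel_measurable lebesgue S (\<lambda>x. (b x * f x)\<^sup>2)"
    by (simp add: set_borel_measurable_def)
  have i1: "set_integrable lebesgue S (\<lambda>x. B\<^sup>2 * (f x)\<^sup>2)"
    using sq_integrable[OF assms(1)] by (rule set_integrable_mult_right)
  have i2: "set_integrable lebesgue S (\<lambda>x. (b x * f x)\<^sup>2)"
    by (rule set_integrable_bound[OF i1 m2]) (use le in eventually_elim, auto)
  then show "square_integrable_on S (\<lambda>x. b x * f x)"
    using m by (simp add: square_integrable_on_def set_borel_measurable_def)
  have "(LINT x:S|lebesgue. (b x * f x)\<^sup>2) \<le> (LINT x:S|lebesgue. B\<^sup>2 * (f x)\<^sup>2)"
    unfolding set_lebesgue_integral_def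
    by (rule integral_mono_AE) (use i1 i2 le in \<open>auto simp: set_integrable_def split: split_indicator elim: eventually_mono\<close>)
  then show "(LINT x:S|lebesgue. (b x * f x)\<^sup>2) \<le> B\<^sup>2 * (LINT x:S|lebesgue. (f x)\<^sup>2)" by simp
qed

lemma sq_ess_bounded_mult:
  "essentially_bounded_on S b \<Longrightarrow> square_integrable_on S f \<Longrightarrow> square_integrable_on S (\<lambda>x. b x * f x)"
  unfolding essentially_bounded_on_def using sq_bounded_mult(1) by blast

lemma sqint_nonneg: "0 \<le> (LINT x:S|lebesgue. (f x :: real)\<^sup>2)"
  unfolding set_lebesgue_integral_def by (rule Bochner_Integration.integral_nonneg) (auto split: split_indicator)

lemma sq_Cauchy_Schwarz:
  assumes "square_integrable_on S f" "square_integrable_on S g"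
  shows "(LINT x:S|lebesgue. f x * g x)\<^sup>2 \<le> (LINT x:S|lebesgue. (f x)\<^sup>2) * (LINT x:S|lebesgue. (g x)\<^sup>2)"
  using l2_Cauchy_Schwarz[OF assms[unfolded square_integrable_iff_l2]]
  unfolding power2_eq_square indicator_mult_mult set_lebesgue_integral_def by simp

lemma sq_Cauchy_Schwarz_sqrt:
  assumes "square_integrable_on S f" "square_integrable_on S g"
  shows "\<bar>LINT x:S|lebesgue. f x * g x\<bar> \<le> sqrt (LINT x:S|lebesgue. (f x)\<^sup>2) * sqrt (LINT x:S|lebesgue. (g x)\<^sup>2)"
  using real_sqrt_le_mono[OF sq_Cauchy_Schwarz[OF assms]] by (simp add: real_sqrt_mult)

lemma sqint_add_le:
  assumes "square_integrable_on S f" "square_integrable_on S g"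
  shows "(LINT x:S|lebesgue. (f x + g x)\<^sup>2) \<le> 2 * (LINT x:S|lebesgue. (f x)\<^sup>2) + 2 * (LINT x:S|lebesgue. (g x)\<^sup>2)"
proof -
  have "(LINT x:S|lebesgue. (f x + g x)\<^sup>2) \<le> (LINT x:S|lebesgue. 2 * (f x)\<^sup>2 + 2 * (g x)\<^sup>2)"
  proof (rule set_integral_mono)
    show "set_integrable lebesgue S (\<lambda>x. (f x + g x)\<^sup>2)" by (intro sq_integrable sq_add assms)
    show "set_integrable lebesgue S (\<lambda>x. 2 * (f x)\<^sup>2 + 2 * (g x)\<^sup>2)"
      by (intro set_integral_add set_integrable_mult_right sq_integrable assms)
    show "(f x + g x)\<^sup>2 \<le> 2 * (f x)\<^sup>2 + 2 * (g x)\<^sup>2" for x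
      using zero_le_power2[of "f x - g x"] by (simp add: power2_eq_square algebra_simps)
  qed
  also have "\<dots> = 2 * (LINT x:S|lebesgue. (f x)\<^sup>2) + 2 * (LINT x:S|lebesgue. (g x)\<^sup>2)"
    using assms by (subst set_integral_add(2)) (auto intro: set_integrable_mult_right sq_integrable)
  finally show ?thesis .
qed

section \<open>Strong L2 convergence on a set\<close>

definition l2conv :: "(real^'n::finite) set \<Rightarrow> (nat \<Rightarrow> real^'n \<Rightarrow> real) \<Rightarrow> (real^'n \<Rightarrow> real) \<Rightarrow> bool" where
  "l2conv S fs f \<longleftrightarrow> (\<forall>n. square_integrable_on S (fs n)) \<and> square_integrable_on S f \<and>
     (\<lambda>n. LINT x:S|lebesgue. (fs n x - f x)\<^sup>2) \<longlonglongrightarrow> 0"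

lemma l2convD: "l2conv S fs f \<Longrightarrow> square_integrable_on S (fs n)" "l2conv S fs f \<Longrightarrow> square_integrable_on S f"
  by (auto simp: l2conv_def)

lemma l2conv_const: "square_integrable_on S f \<Longrightarrow> l2conv S (\<lambda>n. f) f"
  by (simp add: l2conv_def)

lemma l2conv_add:
  assumes "l2conv S fs f" "l2conv S gs g" shows "l2conv S (\<lambda>n x. fs n x + gs n x) (\<lambda>x. f x + g x)"
  unfolding l2conv_def
proof (intro conjI allI)
  let ?F = "\<lambda>n. LINT x:S|lebesgue. (fs n x - f x)\<^sup>2" and ?G = "\<lambda>n. LINT x:S|lebesgue. (gs n x - g x)\<^sup>2"
  show "square_integrable_on S (\<lambda>x. fs n x + gs n x)" "square_integrable_on S (\<lambda>x. f x + g x)" for n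
    using assms by (auto intro: sq_add dest: l2convD)
  have "(\<lambda>n. 2 * ?F n + 2 * ?G n) \<longlonglongrightarrow> 2 * 0 + 2 * 0"
    using assms by (intro tendsto_intros) (auto simp: l2conv_def)
  then have lim: "(\<lambda>n. 2 * ?F n + 2 * ?G n) \<longlonglongrightarrow> 0" by simp
  have "(LINT x:S|lebesgue. (fs n x + gs n x - (f x + g x))\<^sup>2) \<le> 2 * ?F n + 2 * ?G n" for n
  proof -
    have "(LINT x:S|lebesgue. (fs n x + gs n x - (f x + g x))\<^sup>2) = (LINT x:S|lebesgue. ((fs n x - f x) + (gs n x - g x))\<^sup>2)"
      by (simp add: algebra_simps)
    also have "\<dots> \<le> 2 * ?F n + 2 * ?G n"
      using assms by (intro sqint_add_le sq_diff) (auto dest: l2convD)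
    finally show ?thesis .
  qed
  then show "(\<lambda>n. LINT x:S|lebesgue. (fs n x + gs n x - (f x + g x))\<^sup>2) \<longlonglongrightarrow> 0"
    by (intro tendsto_sandwich[OF _ _ tendsto_const lim]) (auto simp: sqint_nonneg)
qed

lemma l2conv_bounded_mult:
  assumes "l2conv S fs f" "set_borel_measurable lebesgue S b" "AE x in lebesgue. x \<in> S \<longrightarrow> \<bar>b x\<bar> \<le> B"
  shows "l2conv S (\<lambda>n x. b x * fs n x) (\<lambda>x. b x * f x)"
  unfolding l2conv_def
proof (intro conjI allI)
  let ?F = "\<lambda>n. LINT x:S|lebesgue. (fs n x - f x)\<^sup>2"
  show "square_integrable_on S (\<lambda>x. b x * fs n x)" "square_integrable_on S (\<lambda>x. b x * f x)" for n
    using sq_bounded_mult(1)[OF _ assms(2,3)] l2convD[OF assms(1)] by blast+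
  have "(\<lambda>n. B\<^sup>2 * ?F n) \<longlonglongrightarrow> B\<^sup>2 * 0"
    using assms(1) by (intro tendsto_intros) (auto simp: l2conv_def)
  then have lim: "(\<lambda>n. B\<^sup>2 * ?F n) \<longlonglongrightarrow> 0" by simp
  have "(LINT x:S|lebesgue. (b x * fs n x - b x * f x)\<^sup>2) \<le> B\<^sup>2 * ?F n" for n
    using sq_bounded_mult(2)[OF sq_diff[OF l2convD(1)[OF assms(1)] l2convD(2)[OF assms(1)]] assms(2,3), of n]
    by (simp add: right_diff_distrib)
  then show "(\<lambda>n. LINT x:S|lebesgue. (b x * fs n x - b x * f x)\<^sup>2) \<longlonglongrightarrow> 0"
    by (intro tendsto_sandwich[OF _ _ tendsto_const lim]) (auto simp: sqint_nonneg)
qed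

lemma l2conv_cmult:
  assumes "l2conv S fs f" shows "l2conv S (\<lambda>n x. c * fs n x) (\<lambda>x. c * f x)"
proof -
  have "(\<lambda>n. c\<^sup>2 * (LINT x:S|lebesgue. (fs n x - f x)\<^sup>2)) \<longlonglongrightarrow> c\<^sup>2 * 0"
    using assms by (intro tendsto_intros) (auto simp: l2conv_def)
  moreover have "(LINT x:S|lebesgue. (c * fs n x - c * f x)\<^sup>2) = c\<^sup>2 * (LINT x:S|lebesgue. (fs n x - f x)\<^sup>2)" for n
    by (simp flip: right_diff_distrib add: power_mult_distrib)
  ultimately show ?thesis using assms by (auto simp: l2conv_def intro: sq_cmult)
qed

lemma l2conv_sum_list:
  "(\<And>c. c \<in> set cs \<Longrightarrow> l2conv S (\<lambda>n. fs n c) (f c)) \<Longrightarrow>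
   l2conv S (\<lambda>n x. \<Sum>c\<leftarrow>cs. fs n c x) (\<lambda>x. \<Sum>c\<leftarrow>cs. f c x)"
  by (induction cs) (auto intro: l2conv_add l2conv_const sq_zero)

lemma l2conv_cong_AE:
  assumes "l2conv S fs f" "AE x in lebesgue. x \<in> S \<longrightarrow> f x = g x"
  shows "l2conv S fs g"
proof -
  have "(LINT x:S|lebesgue. (fs n x - f x)\<^sup>2) = (LINT x:S|lebesgue. (fs n x - g x)\<^sup>2)" for n
    by (rule set_integral_cong_AE_sets) (use assms(2) in eventually_elim, auto)
  moreover have "square_integrable_on S g"
    by (rule sq_cong_AE[OF _ l2convD(2)[OF assms(1)]]) (use assms(2) in eventually_elim, auto)
  ultimately show ?thesis using assms(1) by (simp add: l2conv_def)
qed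

lemma l2conv_inner1:
  assumes "l2conv S fs f" "square_integrable_on S g"
  shows "(\<lambda>n. LINT x:S|lebesgue. fs n x * g x) \<longlonglongrightarrow> (LINT x:S|lebesgue. f x * g x)"
proof -
  let ?F = "\<lambda>n. LINT x:S|lebesgue. (fs n x - f x)\<^sup>2" and ?G = "LINT x:S|lebesgue. (g x)\<^sup>2"
  have "(\<lambda>n. sqrt (?F n) * sqrt ?G) \<longlonglongrightarrow> sqrt 0 * sqrt ?G"
    using assms(1) by (intro tendsto_intros) (auto simp: l2conv_def)
  then have lim: "(\<lambda>n. sqrt (?F n) * sqrt ?G) \<longlonglongrightarrow> 0" by simp
  have "norm ((LINT x:S|lebesgue. fs n x * g x) - (LINT x:S|lebesgue. f x * g x)) \<le> sqrt (?F n) * sqrt ?G" for n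
  proof -
    have "(LINT x:S|lebesgue. fs n x * g x) - (LINT x:S|lebesgue. f x * g x) = (LINT x:S|lebesgue. fs n x * g x - f x * g x)"
      using l2convD[OF assms(1)] assms(2) by (intro set_integral_diff(2)[symmetric] sq_mult_integrable)
    then show ?thesis
      using sq_Cauchy_Schwarz_sqrt[OF sq_diff[OF l2convD(1)[OF assms(1)] l2convD(2)[OF assms(1)]] assms(2), of n]
      by (simp add: left_diff_distrib)
  qed
  then have "(\<lambda>n. (LINT x:S|lebesgue. fs n x * g x) - (LINT x:S|lebesgue. f x * g x)) \<longlonglongrightarrow> 0"
    by (intro Lim_null_comparison[OF always_eventually lim] allI)
  then show ?thesis by (simp add: LIM_zero_iff)
qed

text \<open>The integral of the product of the two errors tends to 0 by Cauchy-Schwarz; expanding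
  that product leaves pairings with one fixed factor.\<close>

lemma l2conv_inner:
  assumes f: "l2conv S fs f" and g: "l2conv S gs g"
  shows "(\<lambda>n. LINT x:S|lebesgue. fs n x * gs n x) \<longlonglongrightarrow> (LINT x:S|lebesgue. f x * g x)"
proof -
  let ?F = "\<lambda>n. LINT x:S|lebesgue. (fs n x - f x)\<^sup>2" and ?G = "\<lambda>n. LINT x:S|lebesgue. (gs n x - g x)\<^sup>2"
  note sq = l2convD[OF f] l2convD[OF g]
  have "(\<lambda>n. sqrt (?F n) * sqrt (?G n)) \<longlonglongrightarrow> sqrt 0 * sqrt 0"
    using f g by (intro tendsto_intros) (auto simp: l2conv_def)
  then have lim: "(\<lambda>n. sqrt (?F n) * sqrt (?G n)) \<longlonglongrightarrow> 0" by simp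
  have "(\<lambda>n. LINT x:S|lebesgue. (fs n x - f x) * (gs n x - g x)) \<longlonglongrightarrow> 0"
    using sq by (intro Lim_null_comparison[OF always_eventually lim] allI)
      (auto intro!: sq_Cauchy_Schwarz_sqrt sq_diff)
  then have "(\<lambda>n. (LINT x:S|lebesgue. (fs n x - f x) * (gs n x - g x)) + (LINT x:S|lebesgue. fs n x * g x)
      + (LINT x:S|lebesgue. gs n x * f x) - (LINT x:S|lebesgue. f x * g x)) \<longlonglongrightarrow>
      0 + (LINT x:S|lebesgue. f x * g x) + (LINT x:S|lebesgue. g x * f x) - (LINT x:S|lebesgue. f x * g x)"
    using sq by (intro tendsto_intros l2conv_inner1[OF f] l2conv_inner1[OF g])
  moreover have "(LINT x:S|lebesgue. (fs n x - f x) * (gs n x - g x)) + (LINT x:S|lebesgue. fs n x * g x)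
      + (LINT x:S|lebesgue. gs n x * f x) - (LINT x:S|lebesgue. f x * g x) = (LINT x:S|lebesgue. fs n x * gs n x)" for n
  proof -
    have "(LINT x:S|lebesgue. (fs n x - f x) * (gs n x - g x))
      = (LINT x:S|lebesgue. (fs n x * gs n x - fs n x * g x) - (gs n x * f x - f x * g x))"
      by (simp add: algebra_simps)
    also have "\<dots> = (LINT x:S|lebesgue. fs n x * gs n x - fs n x * g x) - (LINT x:S|lebesgue. gs n x * f x - f x * g x)"
      using sq by (intro set_integral_diff sq_mult_integrable)
    also have "\<dots> = ((LINT x:S|lebesgue. fs n x * gs n x) - (LINT x:S|lebesgue. fs n x * g x))
       - ((LINT x:S|lebesgue. gs n x * f x) - (LINT x:S|lebesgue. f x * g x))"
      using sq by (subst (1 2) set_integral_diff(2)) (auto intro: sq_mult_integrable)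
    finally show ?thesis by simp
  qed
  ultimately show ?thesis by (simp add: mult.commute)
qed

text \<open>The limit is first taken for the extensions by zero to the whole space. Restricting it
  to \<open>S\<close> can only lower the distance to them.\<close>

lemma sq_complete:
  assumes S: "S \<in> sets lebesgue" and f: "\<And>n. square_integrable_on S (f n)"
    and cauchy: "\<And>e. e > 0 \<Longrightarrow> \<exists>N. \<forall>m\<ge>N. \<forall>n\<ge>N. (LINT x:S|lebesgue. (f m x - f n x)\<^sup>2) < e"
  obtains g where "l2conv S f g"
proof -
  have eq: "(\<lambda>x. (indicator S x * u x - indicator S x * v x)\<^sup>2) = (\<lambda>x. indicator S x *\<^sub>R (u x - v x)\<^sup>2)" for u v :: "real^'a \<Rightarrow> real"
    by (auto simp: fun_eq_iff split: split_indicator)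
  obtain g where g: "l2 lebesgue g" "(\<lambda>n. \<integral>x. (indicator S x * f n x - g x)\<^sup>2 \<partial>lebesgue) \<longlonglongrightarrow> 0"
  proof (rule l2_complete[of lebesgue "\<lambda>n x. indicator S x * f n x"])
    show "l2 lebesgue (\<lambda>x. indicator S x * f n x)" for n using f by (simp add: square_integrable_iff_l2)
    show "\<exists>N. \<forall>m\<ge>N. \<forall>n\<ge>N. (\<integral>x. (indicator S x * f m x - indicator S x * f n x)\<^sup>2 \<partial>lebesgue) < e" if "e > 0" for e
      using cauchy[OF that] by (simp add: eq set_lebesgue_integral_def)
  qed (rule that)
  have F: "l2 lebesgue (\<lambda>x. indicator S x * f n x)" for n using f by (simp add: square_integrable_iff_l2)
  have gm: "(\<lambda>x. indicator S x * g x) \<in> borel_measurable lebesgue"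
    by (rule borel_measurable_times) (use S g(1) in \<open>auto simp: l2_def\<close>)
  have "l2 lebesgue (\<lambda>x. indicator S x * g x)"
    unfolding l2_def
  proof
    show "integrable lebesgue (\<lambda>x. (indicator S x * g x)\<^sup>2)"
      by (rule Bochner_Integration.integrable_bound[where f = "\<lambda>x. (g x)\<^sup>2"])
        (use g(1) borel_measurable_power[OF gm] in \<open>auto simp: l2_def split: split_indicator\<close>)
  qed (rule gm)
  then have sq: "square_integrable_on S g" by (simp add: square_integrable_iff_l2)
  have "(LINT x:S|lebesgue. (f n x - g x)\<^sup>2) \<le> (\<integral>x. (indicator S x * f n x - g x)\<^sup>2 \<partial>lebesgue)" for n
    unfolding set_lebesgue_integral_def
  proof (rule integral_mono)
    show "integrable lebesgue (\<lambda>x. indicator S x *\<^sub>R (f n x - g x)\<^sup>2)"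
      using sq_integrable[OF sq_diff[OF f sq]] by (simp add: set_integrable_def)
    show "integrable lebesgue (\<lambda>x. (indicator S x * f n x - g x)\<^sup>2)"
      using l2_diff[OF F g(1)] by (simp add: l2_def)
  qed (auto split: split_indicator)
  then have "(\<lambda>n. LINT x:S|lebesgue. (f n x - g x)\<^sup>2) \<longlonglongrightarrow> 0"
    by (intro tendsto_sandwich[OF _ _ tendsto_const g(2)]) (auto simp: sqint_nonneg)
  then show ?thesis using that f sq by (simp add: l2conv_def)
qed

section \<open>Sobolev functions with zero boundary values\<close>

lemma sq_test_function:
  assumes "\<Omega> \<in> sets lebesgue" "\<phi> \<in> test_functions \<Omega>'" shows "square_integrable_on \<Omega> \<phi>"
proof -
  have i: "integrable lebesgue (\<lambda>x. (\<phi> x)\<^sup>2)"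
    unfolding power2_eq_square
    by (rule test_function_integrable[OF test_function_smooth_mult[OF test_functionD(1)[OF assms(2)] assms(2)]])
  have "square_integrable_on UNIV \<phi>"
    using i test_function_measurable[OF assms(2)] by (simp add: square_integrable_iff_l2 l2_def)
  then show ?thesis by (rule sq_subset) (use assms(1) in auto)
qed

lemma open_sets_lebesgue: "open \<Omega> \<Longrightarrow> (\<Omega> :: 'a::euclidean_space set) \<in> sets lebesgue"
  using borel_open by auto

text \<open>Cauchy-Schwarz against the constant 1, which is square integrable on a compact
  set.\<close>

lemma sq_locally_integrable:
  assumes "square_integrable_on \<Omega> u" shows "locally_integrable_on \<Omega> u"
  unfolding locally_integrable_on_def
proof (intro allI impI)
  fix K assume K: "compact K \<and> K \<subseteq> \<Omega>"
  have KS: "K \<in> sets lebesgue" "K \<in> lmeasurable" using K using lmeasurable_compact fmeasurableD by blast+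
  have "square_integrable_on K u" by (rule sq_subset[OF assms]) (use KS K in auto)
  moreover have "square_integrable_on K (\<lambda>x. 1)"
    using KS unfolding square_integrable_on_def set_borel_measurable_def set_integrable_def
    by (auto simp: fmeasurable_def)
  ultimately have "set_integrable lebesgue K (\<lambda>x. u x * 1)" by (rule sq_mult_integrable)
  then show "u absolutely_integrable_on K" by simp
qed

lemma is_weak_deriv_diff:
  assumes "is_weak_deriv \<Omega> \<sigma> u g" "is_weak_deriv \<Omega> \<sigma> v h"
  shows "is_weak_deriv \<Omega> \<sigma> (\<lambda>x. u x - v x) (\<lambda>x. g x - h x)"
  unfolding is_weak_deriv_def
proof (intro conjI ballI)
  have l: "locally_integrable_on \<Omega> u" "locally_integrable_on \<Omega> v" "locally_integrable_on \<Omega> g" "locally_integrable_on \<Omega> h"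
    using assms by (auto simp: is_weak_deriv_def)
  then show "locally_integrable_on \<Omega> (\<lambda>x. u x - v x)" "locally_integrable_on \<Omega> (\<lambda>x. g x - h x)"
    by (auto intro: locally_integrable_diff)
  fix \<phi> assume \<phi>: "\<phi> \<in> test_functions \<Omega>"
  note d\<phi> = test_function_mi_deriv[OF \<phi>, of \<sigma>]
  have "(LINT x:\<Omega>|lebesgue. (u x - v x) * mi_deriv \<sigma> \<phi> x)
     = (LINT x:\<Omega>|lebesgue. u x * mi_deriv \<sigma> \<phi> x) - (LINT x:\<Omega>|lebesgue. v x * mi_deriv \<sigma> \<phi> x)"
    using set_integral_diff(2)[OF locally_integrable_mult_test(2)[OF l(1) d\<phi>] locally_integrable_mult_test(2)[OF l(2) d\<phi>]]
    by (simp add: left_diff_distrib)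
  also have "\<dots> = (-1) ^ mi_order \<sigma> * ((LINT x:\<Omega>|lebesgue. g x * \<phi> x) - (LINT x:\<Omega>|lebesgue. h x * \<phi> x))"
    using assms \<phi> by (simp add: is_weak_deriv_def right_diff_distrib)
  also have "(LINT x:\<Omega>|lebesgue. g x * \<phi> x) - (LINT x:\<Omega>|lebesgue. h x * \<phi> x) = (LINT x:\<Omega>|lebesgue. (g x - h x) * \<phi> x)"
    using set_integral_diff(2)[OF locally_integrable_mult_test(2)[OF l(3) \<phi>] locally_integrable_mult_test(2)[OF l(4) \<phi>]]
    by (simp add: left_diff_distrib)
  finally show "(LINT x:\<Omega>|lebesgue. (u x - v x) * mi_deriv \<sigma> \<phi> x)
     = (-1) ^ mi_order \<sigma> * (LINT x:\<Omega>|lebesgue. (g x - h x) * \<phi> x)" .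
qed

lemma sobolev_space_weak_deriv:
  assumes \<Omega>: "open \<Omega>" and u: "u \<in> sobolev_space k \<Omega>" and \<sigma>: "mi_order \<sigma> \<le> k"
  shows "is_weak_deriv \<Omega> \<sigma> u (weak_deriv \<Omega> \<sigma> u)" "square_integrable_on \<Omega> (weak_deriv \<Omega> \<sigma> u)"
proof -
  obtain g where g: "square_integrable_on \<Omega> g" "is_weak_deriv \<Omega> \<sigma> u g"
    using u \<sigma> by (auto simp: sobolev_space_def)
  show "is_weak_deriv \<Omega> \<sigma> u (weak_deriv \<Omega> \<sigma> u)" using g(2) by (rule is_weak_deriv_weak_deriv)
  show "square_integrable_on \<Omega> (weak_deriv \<Omega> \<sigma> u)"
    by (rule sq_cong_AE[OF _ g(1)]) (use weak_deriv_AE[OF \<Omega> g(2)] in eventually_elim, auto)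
qed

lemma mi_list_zero: "mi_list (\<lambda>_. 0 :: nat) = ([] :: 'n::finite list)"
  using length_mi_list[of "\<lambda>_::'n. 0"] by (simp add: mi_order_def)

lemma mi_deriv_zero: "mi_deriv (\<lambda>_. 0) f = f"
  by (simp add: mi_deriv_eq mi_list_zero)

lemma weak_deriv_zero:
  assumes \<Omega>: "open \<Omega>" and u: "locally_integrable_on \<Omega> u"
  shows "AE x in lebesgue. x \<in> \<Omega> \<longrightarrow> weak_deriv \<Omega> (\<lambda>_. 0) u x = u x"
  by (rule weak_deriv_AE[OF \<Omega>]) (simp add: is_weak_deriv_def u mi_deriv_zero mi_order_def)

text \<open>A single sequence approximates \<open>u\<close> and all its derivatives up to order
  \<open>k\<close>. Together with the converse \<open>sobolev_space_0_limit\<close>, it reduces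
  claims on H_0^k to claims on test functions that survive L2 limits.\<close>

lemma sobolev_space_0_approx:
  fixes \<Omega> :: "(real^'n::finite) set"
  assumes \<Omega>: "open \<Omega>" and u: "u \<in> sobolev_space_0 k \<Omega>"
  obtains \<phi> where "\<And>n. \<phi> n \<in> test_functions \<Omega>" "l2conv \<Omega> \<phi> u"
    "\<And>\<sigma>. mi_order \<sigma> \<le> k \<Longrightarrow> l2conv \<Omega> (\<lambda>n. mi_deriv \<sigma> (\<phi> n)) (weak_deriv \<Omega> \<sigma> u)"
proof -
  have us: "u \<in> sobolev_space k \<Omega>" using u by (simp add: sobolev_space_0_def)
  have "\<exists>\<phi>\<in>test_functions \<Omega>. sobolev_norm k \<Omega> (\<lambda>x. u x - \<phi> x) < inverse (real (Suc n))" for n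
    using u by (simp add: sobolev_space_0_def)
  then obtain \<phi> where \<phi>: "\<And>n. \<phi> n \<in> test_functions \<Omega>"
    "\<And>n. sobolev_norm k \<Omega> (\<lambda>x. u x - \<phi> n x) < inverse (real (Suc n))" by metis
  have conv: "l2conv \<Omega> (\<lambda>n. mi_deriv \<sigma> (\<phi> n)) (weak_deriv \<Omega> \<sigma> u)" if \<sigma>: "mi_order \<sigma> \<le> k" for \<sigma>
    unfolding l2conv_def
  proof (intro conjI allI)
    note wd = sobolev_space_weak_deriv[OF \<Omega> us \<sigma>]
    show "square_integrable_on \<Omega> (weak_deriv \<Omega> \<sigma> u)" by (rule wd)
    show "square_integrable_on \<Omega> (mi_deriv \<sigma> (\<phi> n))" for n
      by (rule sq_test_function[OF open_sets_lebesgue[OF \<Omega>] test_function_mi_deriv[OF \<phi>(1)]])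
    have le: "(LINT x:\<Omega>|lebesgue. (mi_deriv \<sigma> (\<phi> n) x - weak_deriv \<Omega> \<sigma> u x)\<^sup>2) \<le> (inverse (real (Suc n)))\<^sup>2" for n
    proof -
      let ?v = "\<lambda>x. u x - \<phi> n x"
      have "is_weak_deriv \<Omega> \<sigma> ?v (\<lambda>x. weak_deriv \<Omega> \<sigma> u x - mi_deriv \<sigma> (\<phi> n) x)"
        by (rule is_weak_deriv_diff[OF wd(1) smooth_weak_deriv[OF test_functionD(1)[OF \<phi>(1)]]])
      note ae = weak_deriv_AE[OF \<Omega> this]
      have "(LINT x:\<Omega>|lebesgue. (mi_deriv \<sigma> (\<phi> n) x - weak_deriv \<Omega> \<sigma> u x)\<^sup>2) = (LINT x:\<Omega>|lebesgue. (weak_deriv \<Omega> \<sigma> ?v x)\<^sup>2)"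
        by (rule set_integral_cong_AE_sets) (use ae in eventually_elim, auto simp: power2_commute)
      also have "\<dots> \<le> (\<Sum>\<gamma>\<in>multiindices (mi_order \<sigma>). LINT x:\<Omega>|lebesgue. (weak_deriv \<Omega> \<gamma> ?v x)\<^sup>2)"
        by (rule member_le_sum) (auto simp: finite_multiindices sqint_nonneg, simp add: multiindices_def)
      also have "\<dots> = (sobolev_seminorm \<Omega> (mi_order \<sigma>) \<Omega> ?v)\<^sup>2"
        by (simp add: sobolev_seminorm_def sum_nonneg sqint_nonneg)
      also have "\<dots> \<le> (\<Sum>p\<le>k. (sobolev_seminorm \<Omega> p \<Omega> ?v)\<^sup>2)"
        using \<sigma> by (intro member_le_sum) auto
      also have "\<dots> = (sobolev_norm k \<Omega> ?v)\<^sup>2"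
        by (simp add: sobolev_norm_def sum_nonneg)
      also have "\<dots> \<le> (inverse (real (Suc n)))\<^sup>2"
        using \<phi>(2)[of n] by (intro power_mono) (auto simp: sobolev_norm_def sum_nonneg)
      finally show ?thesis .
    qed
    have "(\<lambda>n. (inverse (real (Suc n)))\<^sup>2) \<longlonglongrightarrow> 0\<^sup>2"
      by (intro tendsto_power LIMSEQ_inverse_real_of_nat)
    then have lim: "(\<lambda>n. (inverse (real (Suc n)))\<^sup>2) \<longlonglongrightarrow> 0" by simp
    show "(\<lambda>n. LINT x:\<Omega>|lebesgue. (mi_deriv \<sigma> (\<phi> n) x - weak_deriv \<Omega> \<sigma> u x)\<^sup>2) \<longlonglongrightarrow> 0"
      by (rule tendsto_sandwich[OF _ _ tendsto_const lim]) (use le in \<open>simp_all add: sqint_nonneg\<close>)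
  qed
  have "square_integrable_on \<Omega> u" using us by (simp add: sobolev_space_def)
  then have "l2conv \<Omega> (\<lambda>n. mi_deriv (\<lambda>_. 0) (\<phi> n)) u"
    using l2conv_cong_AE[OF conv weak_deriv_zero[OF \<Omega> sq_locally_integrable]] by (simp add: mi_order_def)
  then have "l2conv \<Omega> \<phi> u" by (simp add: mi_deriv_zero)
  then show ?thesis using that \<phi>(1) conv by blast
qed

lemma l2conv_weak_deriv:
  assumes \<Omega>: "open \<Omega>" and \<phi>: "\<And>n. \<phi> n \<in> test_functions \<Omega>"
    and u: "l2conv \<Omega> \<phi> u" and g: "l2conv \<Omega> (\<lambda>n. mi_deriv \<sigma> (\<phi> n)) g"
  shows "is_weak_deriv \<Omega> \<sigma> u g"
  unfolding is_weak_deriv_def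
proof (intro conjI ballI)
  show "locally_integrable_on \<Omega> u" "locally_integrable_on \<Omega> g"
    using l2convD(2) u g by (auto intro: sq_locally_integrable)
  fix \<xi> assume \<xi>: "\<xi> \<in> test_functions \<Omega>"
  note sq = sq_test_function[OF open_sets_lebesgue[OF \<Omega>]]
  have 1: "(\<lambda>n. LINT x:\<Omega>|lebesgue. \<phi> n x * mi_deriv \<sigma> \<xi> x) \<longlonglongrightarrow> (LINT x:\<Omega>|lebesgue. u x * mi_deriv \<sigma> \<xi> x)"
    by (rule l2conv_inner1[OF u sq[OF test_function_mi_deriv[OF \<xi>]]])
  have "(\<lambda>n. (-1) ^ mi_order \<sigma> * (LINT x:\<Omega>|lebesgue. mi_deriv \<sigma> (\<phi> n) x * \<xi> x)) \<longlonglongrightarrow>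
      (-1) ^ mi_order \<sigma> * (LINT x:\<Omega>|lebesgue. g x * \<xi> x)"
    by (intro tendsto_intros l2conv_inner1[OF g sq[OF \<xi>]])
  moreover have "(-1) ^ mi_order \<sigma> * (LINT x:\<Omega>|lebesgue. mi_deriv \<sigma> (\<phi> n) x * \<xi> x) = (LINT x:\<Omega>|lebesgue. \<phi> n x * mi_deriv \<sigma> \<xi> x)" for n
    using smooth_weak_deriv[OF test_functionD(1)[OF \<phi>[of n]], of \<Omega> \<sigma>] \<xi> by (simp add: is_weak_deriv_def)
  ultimately show "(LINT x:\<Omega>|lebesgue. u x * mi_deriv \<sigma> \<xi> x) = (-1) ^ mi_order \<sigma> * (LINT x:\<Omega>|lebesgue. g x * \<xi> x)"
    using LIMSEQ_unique[OF 1] by simp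
qed

text \<open>Weak derivatives are closed under L2 limits, so the limits of the classical derivatives
  are the weak derivatives of \<open>u\<close>, and the sequence converges to \<open>u\<close> in
  the Sobolev norm.\<close>

lemma sobolev_space_0_limit:
  fixes \<Omega> :: "(real^'n::finite) set"
  assumes \<Omega>: "open \<Omega>" and \<phi>: "\<And>n. \<phi> n \<in> test_functions \<Omega>" and u: "l2conv \<Omega> \<phi> u"
    and g: "\<And>\<sigma>. mi_order \<sigma> \<le> k \<Longrightarrow> l2conv \<Omega> (\<lambda>n. mi_deriv \<sigma> (\<phi> n)) (g \<sigma>)"
  shows "u \<in> sobolev_space_0 k \<Omega>"
    "\<And>\<sigma>. mi_order \<sigma> \<le> k \<Longrightarrow> AE x in lebesgue. x \<in> \<Omega> \<longrightarrow> weak_deriv \<Omega> \<sigma> u x = g \<sigma> x"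
proof -
  have wd: "is_weak_deriv \<Omega> \<sigma> u (g \<sigma>)" if "mi_order \<sigma> \<le> k" for \<sigma>
    by (rule l2conv_weak_deriv[OF \<Omega> \<phi> u g[OF that]])
  then show "AE x in lebesgue. x \<in> \<Omega> \<longrightarrow> weak_deriv \<Omega> \<sigma> u x = g \<sigma> x" if "mi_order \<sigma> \<le> k" for \<sigma>
    using weak_deriv_AE[OF \<Omega>] that by blast
  have us: "u \<in> sobolev_space k \<Omega>"
    unfolding sobolev_space_def using wd l2convD(2)[OF u] l2convD(2)[OF g] by blast
  have int: "(LINT x:\<Omega>|lebesgue. (weak_deriv \<Omega> \<sigma> (\<lambda>x. u x - \<phi> n x) x)\<^sup>2) = (LINT x:\<Omega>|lebesgue. (mi_deriv \<sigma> (\<phi> n) x - g \<sigma> x)\<^sup>2)"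
    if "mi_order \<sigma> \<le> k" for \<sigma> n
  proof -
    have "is_weak_deriv \<Omega> \<sigma> (\<lambda>x. u x - \<phi> n x) (\<lambda>x. g \<sigma> x - mi_deriv \<sigma> (\<phi> n) x)"
      by (rule is_weak_deriv_diff[OF wd[OF that] smooth_weak_deriv[OF test_functionD(1)[OF \<phi>]]])
    note ae = weak_deriv_AE[OF \<Omega> this]
    show ?thesis
      by (rule set_integral_cong_AE_sets) (use ae in eventually_elim, auto simp: power2_commute)
  qed
  have "(sobolev_norm k \<Omega> (\<lambda>x. u x - \<phi> n x))
     = sqrt (\<Sum>p\<le>k. \<Sum>\<sigma>\<in>multiindices p. LINT x:\<Omega>|lebesgue. (mi_deriv \<sigma> (\<phi> n) x - g \<sigma> x)\<^sup>2)" for n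
    unfolding sobolev_norm_def sobolev_seminorm_def
    by (intro arg_cong[where f = sqrt] sum.cong refl)
      (auto simp: sum_nonneg sqint_nonneg multiindices_def int intro!: sum.cong)
  moreover have "(\<lambda>n. sqrt (\<Sum>p\<le>k. \<Sum>\<sigma>\<in>(multiindices p :: 'n multiindex set). LINT x:\<Omega>|lebesgue. (mi_deriv \<sigma> (\<phi> n) x - g \<sigma> x)\<^sup>2))
     \<longlonglongrightarrow> sqrt (\<Sum>p\<le>k. \<Sum>\<sigma>\<in>(multiindices p :: 'n multiindex set). 0)"
    using g by (intro tendsto_real_sqrt tendsto_sum) (auto simp: l2conv_def multiindices_def)
  ultimately have lim: "(\<lambda>n. sobolev_norm k \<Omega> (\<lambda>x. u x - \<phi> n x)) \<longlonglongrightarrow> 0" by simp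
  have "\<exists>\<phi>\<in>test_functions \<Omega>. sobolev_norm k \<Omega> (\<lambda>x. u x - \<phi> x) < \<epsilon>" if "\<epsilon> > 0" for \<epsilon>
  proof -
    have "\<forall>\<^sub>F n in sequentially. sobolev_norm k \<Omega> (\<lambda>x. u x - \<phi> n x) < \<epsilon>"
      using order_tendstoD(2)[OF lim that] .
    then obtain n where "sobolev_norm k \<Omega> (\<lambda>x. u x - \<phi> n x) < \<epsilon>"
      by (auto simp: eventually_sequentially)
    then show ?thesis using \<phi> by blast
  qed
  with us show "u \<in> sobolev_space_0 k \<Omega>" by (simp add: sobolev_space_0_def)
qed

lemma sobolev_space_0_lincomb:
  fixes \<Omega> :: "(real^'n::finite) set"
  assumes \<Omega>: "open \<Omega>" and u: "u \<in> sobolev_space_0 k \<Omega>" and v: "v \<in> sobolev_space_0 k \<Omega>"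
  shows "(\<lambda>x. u x + c * v x) \<in> sobolev_space_0 k \<Omega>"
    "\<And>\<sigma>. mi_order \<sigma> \<le> k \<Longrightarrow> AE x in lebesgue. x \<in> \<Omega> \<longrightarrow>
        weak_deriv \<Omega> \<sigma> (\<lambda>x. u x + c * v x) x = weak_deriv \<Omega> \<sigma> u x + c * weak_deriv \<Omega> \<sigma> v x"
proof -
  obtain \<phi> where \<phi>: "\<And>n. \<phi> n \<in> test_functions \<Omega>" "l2conv \<Omega> \<phi> u"
    "\<And>\<sigma>. mi_order \<sigma> \<le> k \<Longrightarrow> l2conv \<Omega> (\<lambda>n. mi_deriv \<sigma> (\<phi> n)) (weak_deriv \<Omega> \<sigma> u)"
    by (rule sobolev_space_0_approx[OF \<Omega> u]) blast
  obtain \<xi> where \<xi>: "\<And>n. \<xi> n \<in> test_functions \<Omega>" "l2conv \<Omega> \<xi> v"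
    "\<And>\<sigma>. mi_order \<sigma> \<le> k \<Longrightarrow> l2conv \<Omega> (\<lambda>n. mi_deriv \<sigma> (\<xi> n)) (weak_deriv \<Omega> \<sigma> v)"
    by (rule sobolev_space_0_approx[OF \<Omega> v]) blast
  have t: "(\<lambda>x. \<phi> n x + c * \<xi> n x) \<in> test_functions \<Omega>" for n
    by (intro test_function_add test_function_cmult \<phi> \<xi>)
  have c0: "l2conv \<Omega> (\<lambda>n x. \<phi> n x + c * \<xi> n x) (\<lambda>x. u x + c * v x)"
    by (intro l2conv_add l2conv_cmult \<phi> \<xi>)
  have "mi_deriv \<sigma> (\<lambda>x. \<phi> n x + c * \<xi> n x) = (\<lambda>x. mi_deriv \<sigma> (\<phi> n) x + c * mi_deriv \<sigma> (\<xi> n) x)" for n \<sigma>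
    using test_functionD(1)[OF \<phi>(1)] test_functionD(1)[OF \<xi>(1)]
    by (simp add: mi_deriv_add mi_deriv_cmult smooth_cmult)
  then have c\<sigma>: "l2conv \<Omega> (\<lambda>n. mi_deriv \<sigma> (\<lambda>x. \<phi> n x + c * \<xi> n x)) (\<lambda>x. weak_deriv \<Omega> \<sigma> u x + c * weak_deriv \<Omega> \<sigma> v x)"
    if "mi_order \<sigma> \<le> k" for \<sigma>
    using l2conv_add[OF \<phi>(3)[OF that] l2conv_cmult[OF \<xi>(3)[OF that], of c]] by simp
  show "(\<lambda>x. u x + c * v x) \<in> sobolev_space_0 k \<Omega>"
    by (rule sobolev_space_0_limit(1)[OF \<Omega> t c0 c\<sigma>])
  show "AE x in lebesgue. x \<in> \<Omega> \<longrightarrow>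
        weak_deriv \<Omega> \<sigma> (\<lambda>x. u x + c * v x) x = weak_deriv \<Omega> \<sigma> u x + c * weak_deriv \<Omega> \<sigma> v x"
    if "mi_order \<sigma> \<le> k" for \<sigma>
    by (rule sobolev_space_0_limit(2)[OF \<Omega> t c0 c\<sigma> that])
qed

text \<open>The Leibniz rule holds for the approximating test functions, and multiplication by the
  bounded derivatives of \<eta> is continuous in L2. This covers cutoffs that do not vanish near the
  boundary of D.\<close>

lemma sobolev_space_0_smooth_mult:
  fixes D :: "(real^'n::finite) set"
  assumes D: "open D" and \<psi>: "\<psi> \<in> sobolev_space_0 k D" and \<eta>: "smooth \<eta>"
    and bd: "\<And>is. length is \<le> k \<Longrightarrow> \<exists>B. \<forall>x. \<bar>pderivs is \<eta> x\<bar> \<le> B"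
  shows "(\<lambda>x. \<eta> x * \<psi> x) \<in> sobolev_space_0 k D"
    "\<And>\<sigma>. mi_order \<sigma> \<le> k \<Longrightarrow> AE x in lebesgue. x \<in> D \<longrightarrow> weak_deriv D \<sigma> (\<lambda>x. \<eta> x * \<psi> x) x
       = (\<Sum>(a, b)\<leftarrow>splits (mi_list \<sigma>). pderivs a \<eta> x * weak_deriv D (count_list b) \<psi> x)"
proof -
  obtain \<phi> where \<phi>: "\<And>n. \<phi> n \<in> test_functions D" "l2conv D \<phi> \<psi>"
    "\<And>\<sigma>. mi_order \<sigma> \<le> k \<Longrightarrow> l2conv D (\<lambda>n. mi_deriv \<sigma> (\<phi> n)) (weak_deriv D \<sigma> \<psi>)"
    by (rule sobolev_space_0_approx[OF D \<psi>]) blast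
  have m: "set_borel_measurable lebesgue D (pderivs is \<eta>)" for "is"
  proof -
    have "pderivs is \<eta> \<in> borel_measurable lebesgue"
      using smooth_measurable[OF smooth_pderivs[OF \<eta>]] by (intro measurable_completion) simp
    then show ?thesis using open_sets_lebesgue[OF D] by (auto simp: set_borel_measurable_def)
  qed
  have mult: "l2conv D (\<lambda>n x. pderivs is \<eta> x * fs n x) (\<lambda>x. pderivs is \<eta> x * f x)"
    if len: "length is \<le> k" and conv: "l2conv D fs f" for "is" fs f
  proof -
    obtain B where "\<forall>x. \<bar>pderivs is \<eta> x\<bar> \<le> B" using bd[OF len] by blast
    then show ?thesis by (intro l2conv_bounded_mult[OF conv m[of "is"], of B]) auto
  qed
  have t: "(\<lambda>x. \<eta> x * \<phi> n x) \<in> test_functions D" for n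
    by (rule test_function_smooth_mult[OF \<eta> \<phi>(1)])
  have c0: "l2conv D (\<lambda>n x. \<eta> x * \<phi> n x) (\<lambda>x. \<eta> x * \<psi> x)"
    using mult[of "[]" \<phi> \<psi>] \<phi>(2) by simp
  have c\<sigma>: "l2conv D (\<lambda>n. mi_deriv \<sigma> (\<lambda>x. \<eta> x * \<phi> n x))
      (\<lambda>x. \<Sum>(a, b)\<leftarrow>splits (mi_list \<sigma>). pderivs a \<eta> x * weak_deriv D (count_list b) \<psi> x)"
    if \<sigma>: "mi_order \<sigma> \<le> k" for \<sigma>
  proof -
    have len: "length a + length b = mi_order \<sigma>" if "(a, b) \<in> set (splits (mi_list \<sigma>))" for a b
      using splits_head[of "mi_list \<sigma>"] that by (auto simp: length_mi_list)
    have "mi_deriv \<sigma> (\<lambda>x. \<eta> x * \<phi> n x)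
       = (\<lambda>x. \<Sum>c\<leftarrow>splits (mi_list \<sigma>). pderivs (fst c) \<eta> x * mi_deriv (count_list (snd c)) (\<phi> n) x)" for n
      unfolding mi_deriv_eq[of \<sigma>] pderivs_mult[OF \<eta> test_functionD(1)[OF \<phi>(1)]]
      by (simp add: mi_deriv_count_list[OF test_functionD(1)[OF \<phi>(1)]] case_prod_beta')
    moreover have "l2conv D (\<lambda>n x. \<Sum>c\<leftarrow>splits (mi_list \<sigma>). pderivs (fst c) \<eta> x * mi_deriv (count_list (snd c)) (\<phi> n) x)
       (\<lambda>x. \<Sum>c\<leftarrow>splits (mi_list \<sigma>). pderivs (fst c) \<eta> x * weak_deriv D (count_list (snd c)) \<psi> x)"
    proof (rule l2conv_sum_list)
      fix c assume "c \<in> set (splits (mi_list \<sigma>))"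
      then have "length (fst c) + length (snd c) = mi_order \<sigma>" using len[of "fst c" "snd c"] by simp
      then show "l2conv D (\<lambda>n x. pderivs (fst c) \<eta> x * mi_deriv (count_list (snd c)) (\<phi> n) x)
          (\<lambda>x. pderivs (fst c) \<eta> x * weak_deriv D (count_list (snd c)) \<psi> x)"
        using \<sigma> by (intro mult \<phi>(3)) (auto simp: mi_order_count_list)
    qed
    ultimately show ?thesis by (simp add: case_prod_beta')
  qed
  show "(\<lambda>x. \<eta> x * \<psi> x) \<in> sobolev_space_0 k D"
    by (rule sobolev_space_0_limit(1)[OF D t c0 c\<sigma>])
  show "AE x in lebesgue. x \<in> D \<longrightarrow> weak_deriv D \<sigma> (\<lambda>x. \<eta> x * \<psi> x) x
       = (\<Sum>(a, b)\<leftarrow>splits (mi_list \<sigma>). pderivs a \<eta> x * weak_deriv D (count_list b) \<psi> x)" if "mi_order \<sigma> \<le> k" for \<sigma>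
    by (rule sobolev_space_0_limit(2)[OF D t c0 c\<sigma> that])
qed

text \<open>The one-dimensional inequality is iterated in one fixed coordinate direction, adding
  derivatives until the order is \<open>k\<close>. The sum of the powers of the constant serves all
  lower orders at once.\<close>

lemma poincare_multi:
  fixes \<Omega> :: "(real^'n::finite) set"
  assumes "bounded \<Omega>"
  obtains C where "C \<ge> 0" "\<And>\<phi> \<sigma>. \<phi> \<in> test_functions \<Omega> \<Longrightarrow> mi_order \<sigma> \<le> k \<Longrightarrow>
     integral\<^sup>L lebesgue (\<lambda>x. (mi_deriv \<sigma> \<phi> x)\<^sup>2) \<le> C * (\<Sum>\<gamma>\<in>multiindices k. integral\<^sup>L lebesgue (\<lambda>x. (mi_deriv \<gamma> \<phi> x)\<^sup>2))"
proof -
  obtain R where R: "\<And>x. x \<in> \<Omega> \<Longrightarrow> norm x \<le> R" using assms by (auto simp: bounded_iff)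
  define i :: 'n where "i = undefined"
  have Ri: "\<bar>x $ i\<bar> \<le> R" if "x \<in> \<Omega>" for x
    using R[OF that] component_le_norm_cart[of x i] by linarith
  define P where "P = (2 * R)\<^sup>2"
  have P: "P \<ge> 0" by (simp add: P_def)
  have it: "integral\<^sup>L lebesgue (\<lambda>x. (pderivs is \<phi> x)\<^sup>2)
      \<le> P ^ m * integral\<^sup>L lebesgue (\<lambda>x. (pderivs (replicate m i @ is) \<phi> x)\<^sup>2)"
    if \<phi>: "\<phi> \<in> test_functions \<Omega>" for \<phi> m "is"
  proof (induction m)
    case (Suc m)
    note Suc
    also have "integral\<^sup>L lebesgue (\<lambda>x. (pderivs (replicate m i @ is) \<phi> x)\<^sup>2)
       \<le> P * integral\<^sup>L lebesgue (\<lambda>x. (pderivs (replicate (Suc m) i @ is) \<phi> x)\<^sup>2)"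
      using poincare[OF test_function_pderivs[OF \<phi>] Ri, of "replicate m i @ is"] by (simp add: P_def)
    finally show ?case using P by (simp add: mult_left_mono mult.assoc mult.left_commute)
  qed simp
  have "integral\<^sup>L lebesgue (\<lambda>x. (mi_deriv \<sigma> \<phi> x)\<^sup>2)
      \<le> (\<Sum>m\<le>k. P ^ m) * (\<Sum>\<gamma>\<in>multiindices k. integral\<^sup>L lebesgue (\<lambda>x. (mi_deriv \<gamma> \<phi> x)\<^sup>2))"
    if \<phi>: "\<phi> \<in> test_functions \<Omega>" and \<sigma>: "mi_order \<sigma> \<le> k" for \<phi> \<sigma>
  proof -
    let ?js = "replicate (k - mi_order \<sigma>) i @ mi_list \<sigma>"
    let ?S = "\<Sum>\<gamma>\<in>multiindices k. integral\<^sup>L lebesgue (\<lambda>x. (mi_deriv \<gamma> \<phi> x)\<^sup>2)"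
    have "integral\<^sup>L lebesgue (\<lambda>x. (mi_deriv \<sigma> \<phi> x)\<^sup>2)
      \<le> P ^ (k - mi_order \<sigma>) * integral\<^sup>L lebesgue (\<lambda>x. (mi_deriv (count_list ?js) \<phi> x)\<^sup>2)"
      unfolding mi_deriv_count_list[OF test_functionD(1)[OF \<phi>]] mi_deriv_eq[of \<sigma>] by (rule it[OF \<phi>])
    also have "integral\<^sup>L lebesgue (\<lambda>x. (mi_deriv (count_list ?js) \<phi> x)\<^sup>2) \<le> ?S"
    proof (rule member_le_sum)
      show "count_list ?js \<in> multiindices k"
        using \<sigma> by (simp add: multiindices_def mi_order_count_list length_mi_list)
    qed (auto simp: finite_multiindices)
    also have "P ^ (k - mi_order \<sigma>) \<le> (\<Sum>m\<le>k. P ^ m)"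
      using P by (intro member_le_sum) auto
    finally show ?thesis using P by (simp add: mult_left_mono mult_right_mono sum_nonneg)
  qed
  then show ?thesis using that[of "\<Sum>m\<le>k. P ^ m"] P by (simp add: sum_nonneg)
qed

section \<open>The polyharmonic equation\<close>

text \<open>The direct method for f \<mapsto> A f f / 2 - P f, stated for an abstract linear class:
  the parallelogram law at midpoints makes a minimizing sequence Cauchy in the energy, and
  perturbing its members gives an approximate Euler equation.\<close>

lemma quadratic_minimizing_sequence:
  fixes A :: "('a \<Rightarrow> real) \<Rightarrow> ('a \<Rightarrow> real) \<Rightarrow> real" and P :: "('a \<Rightarrow> real) \<Rightarrow> real"
  assumes ne: "T \<noteq> {}" and comb: "\<And>f g s t. f \<in> T \<Longrightarrow> g \<in> T \<Longrightarrow> (\<lambda>x. s * f x + t * g x) \<in> T"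
    and A: "\<And>f g s t. f \<in> T \<Longrightarrow> g \<in> T \<Longrightarrow> A (\<lambda>x. s * f x + t * g x) (\<lambda>x. s * f x + t * g x)
        = s\<^sup>2 * A f f + 2 * s * t * A f g + t\<^sup>2 * A g g"
    and P: "\<And>f g s t. f \<in> T \<Longrightarrow> g \<in> T \<Longrightarrow> P (\<lambda>x. s * f x + t * g x) = s * P f + t * P g"
    and bound: "\<And>f. f \<in> T \<Longrightarrow> P f \<le> X + A f f / 2"
  obtains \<phi> where "\<And>n. \<phi> n \<in> T"
    "\<And>m n. A (\<lambda>x. \<phi> m x - \<phi> n x) (\<lambda>x. \<phi> m x - \<phi> n x) \<le> 4 * (inverse (real (Suc m)) + inverse (real (Suc n)))"
    "\<And>n f t. f \<in> T \<Longrightarrow> - inverse (real (Suc n)) \<le> t * (A (\<phi> n) f - P f) + t\<^sup>2 * (A f f / 2)"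
proof -
  define J where "J f = A f f / 2 - P f" for f
  have bdd: "bdd_below (J ` T)"
  proof (rule bdd_belowI2[of _ "- X"])
    fix f assume "f \<in> T"
    then show "- X \<le> J f" using bound[of f] unfolding J_def by linarith
  qed
  define I where "I = Inf (J ` T)"
  have I: "I \<le> J f" if "f \<in> T" for f
    unfolding I_def using that bdd by (intro cInf_lower) auto
  have "\<exists>f\<in>T. J f < I + inverse (real (Suc n))" for n
  proof -
    have "Inf (J ` T) < I + inverse (real (Suc n))" by (simp add: I_def)
    then show ?thesis using cInf_lessD[of "J ` T"] ne by auto
  qed
  then obtain \<phi> where \<phi>: "\<And>n. \<phi> n \<in> T" "\<And>n. J (\<phi> n) < I + inverse (real (Suc n))" by metis
  show ?thesis
  proof (rule that[OF \<phi>(1)])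
    fix m n
    have "(\<lambda>x. \<phi> m x - \<phi> n x) = (\<lambda>x. 1 * \<phi> m x + (-1) * \<phi> n x)" by simp
    then have d: "A (\<lambda>x. \<phi> m x - \<phi> n x) (\<lambda>x. \<phi> m x - \<phi> n x) = A (\<phi> m) (\<phi> m) - 2 * A (\<phi> m) (\<phi> n) + A (\<phi> n) (\<phi> n)"
      using A[OF \<phi>(1)[of m] \<phi>(1)[of n], of 1 "-1"] by simp
    have "I \<le> J (\<lambda>x. (1/2) * \<phi> m x + (1/2) * \<phi> n x)" by (rule I[OF comb[OF \<phi>(1) \<phi>(1)]])
    also have "\<dots> = J (\<phi> m) / 2 + J (\<phi> n) / 2 - A (\<lambda>x. \<phi> m x - \<phi> n x) (\<lambda>x. \<phi> m x - \<phi> n x) / 8"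
      unfolding J_def d A[OF \<phi>(1) \<phi>(1)] P[OF \<phi>(1) \<phi>(1)] by (simp add: power2_eq_square field_simps)
    finally have "I \<le> J (\<phi> m) / 2 + J (\<phi> n) / 2 - A (\<lambda>x. \<phi> m x - \<phi> n x) (\<lambda>x. \<phi> m x - \<phi> n x) / 8" .
    moreover have "a \<le> 4 * (x + y)" if "i \<le> p / 2 + q / 2 - a / 8" "p < i + x" "q < i + y" for a i p q x y :: real
      using that by argo
    ultimately show "A (\<lambda>x. \<phi> m x - \<phi> n x) (\<lambda>x. \<phi> m x - \<phi> n x) \<le> 4 * (inverse (real (Suc m)) + inverse (real (Suc n)))"
      using \<phi>(2)[of m] \<phi>(2)[of n] by blast
  next
    fix n f t assume f: "f \<in> T"
    have "I \<le> J (\<lambda>x. 1 * \<phi> n x + t * f x)" by (rule I[OF comb[OF \<phi>(1) f]])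
    also have "\<dots> = J (\<phi> n) + t * (A (\<phi> n) f - P f) + t\<^sup>2 * (A f f / 2)"
      unfolding J_def A[OF \<phi>(1) f] P[OF \<phi>(1) f] by (simp add: field_simps)
    finally show "- inverse (real (Suc n)) \<le> t * (A (\<phi> n) f - P f) + t\<^sup>2 * (A f f / 2)"
      using \<phi>(2)[of n] by linarith
  qed
qed

text \<open>Dirichlet's principle over test functions. The approximating sequence is part of the
  result because later \<open>w\<close> is tested on D through its approximants, which extend by
  zero.\<close>

lemma polyharmonic_solution:
  fixes \<Omega> :: "(real^'n::finite) set"
  assumes \<Omega>: "open \<Omega>" and bdd: "bounded \<Omega>" and p: "square_integrable_on \<Omega> p"
  obtains w \<phi> where "w \<in> sobolev_space_0 k \<Omega>" "weak_polyharmonic_eq k \<Omega> w p"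
    "\<And>n. \<phi> n \<in> test_functions \<Omega>" "l2conv \<Omega> \<phi> w"
    "\<And>\<sigma>. mi_order \<sigma> \<le> k \<Longrightarrow> l2conv \<Omega> (\<lambda>n. mi_deriv \<sigma> (\<phi> n)) (weak_deriv \<Omega> \<sigma> w)"
proof -
  note \<Omega>s = open_sets_lebesgue[OF \<Omega>]
  define A where "A f g = (\<Sum>\<gamma>\<in>multiindices k. LINT x:\<Omega>|lebesgue. mi_deriv \<gamma> f x * mi_deriv \<gamma> g x)"
    for f g :: "real^'n \<Rightarrow> real"
  define P where "P f = (LINT x:\<Omega>|lebesgue. p x * f x)" for f
  note sqt = sq_test_function[OF \<Omega>s]
  note sqd = sqt[OF test_function_mi_deriv]
  have comb: "(\<lambda>x. s * f x + t * g x) \<in> test_functions \<Omega>"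
    if "f \<in> test_functions \<Omega>" "g \<in> test_functions \<Omega>" for f g s t
    by (intro test_function_add test_function_cmult that)
  have mid: "mi_deriv \<gamma> (\<lambda>x. s * f x + t * g x) = (\<lambda>x. s * mi_deriv \<gamma> f x + t * mi_deriv \<gamma> g x)"
    if "f \<in> test_functions \<Omega>" "g \<in> test_functions \<Omega>" for f g s t \<gamma>
    using that by (simp add: mi_deriv_add mi_deriv_cmult smooth_cmult test_functionD(1))
  have Ac: "A (\<lambda>x. s * f x + t * g x) (\<lambda>x. s * f x + t * g x)
        = s\<^sup>2 * A f f + 2 * s * t * A f g + t\<^sup>2 * A g g"
    if fg: "f \<in> test_functions \<Omega>" "g \<in> test_functions \<Omega>" for f g s t
  proof -
    have "(LINT x:\<Omega>|lebesgue. (s * mi_deriv \<gamma> f x + t * mi_deriv \<gamma> g x) * (s * mi_deriv \<gamma> f x + t * mi_deriv \<gamma> g x))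
      = s\<^sup>2 * (LINT x:\<Omega>|lebesgue. mi_deriv \<gamma> f x * mi_deriv \<gamma> f x)
        + 2 * s * t * (LINT x:\<Omega>|lebesgue. mi_deriv \<gamma> f x * mi_deriv \<gamma> g x)
        + t\<^sup>2 * (LINT x:\<Omega>|lebesgue. mi_deriv \<gamma> g x * mi_deriv \<gamma> g x)" for \<gamma>
    proof -
      have i: "set_integrable lebesgue \<Omega> (\<lambda>x. mi_deriv \<gamma> f x * mi_deriv \<gamma> f x)"
        "set_integrable lebesgue \<Omega> (\<lambda>x. mi_deriv \<gamma> f x * mi_deriv \<gamma> g x)"
        "set_integrable lebesgue \<Omega> (\<lambda>x. mi_deriv \<gamma> g x * mi_deriv \<gamma> g x)"
        by (rule sq_mult_integrable[OF sqd[OF fg(1)] sqd[OF fg(1)]] sq_mult_integrable[OF sqd[OF fg(1)] sqd[OF fg(2)]]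
            sq_mult_integrable[OF sqd[OF fg(2)] sqd[OF fg(2)]])+
      have "(LINT x:\<Omega>|lebesgue. (s * mi_deriv \<gamma> f x + t * mi_deriv \<gamma> g x) * (s * mi_deriv \<gamma> f x + t * mi_deriv \<gamma> g x))
        = (LINT x:\<Omega>|lebesgue. (s\<^sup>2 * (mi_deriv \<gamma> f x * mi_deriv \<gamma> f x) + (2 * s * t) * (mi_deriv \<gamma> f x * mi_deriv \<gamma> g x))
           + t\<^sup>2 * (mi_deriv \<gamma> g x * mi_deriv \<gamma> g x))"
        by (simp add: power2_eq_square algebra_simps)
      also have "\<dots> = s\<^sup>2 * (LINT x:\<Omega>|lebesgue. mi_deriv \<gamma> f x * mi_deriv \<gamma> f x)
        + 2 * s * t * (LINT x:\<Omega>|lebesgue. mi_deriv \<gamma> f x * mi_deriv \<gamma> g x)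
        + t\<^sup>2 * (LINT x:\<Omega>|lebesgue. mi_deriv \<gamma> g x * mi_deriv \<gamma> g x)"
        using i by (subst set_integral_add(2), auto intro!: set_integral_add(1) simp: set_integral_add(2))
      finally show ?thesis .
    qed
    then show ?thesis
      unfolding A_def mid[OF fg] by (simp add: sum.distrib sum_distrib_left)
  qed
  have Pc: "P (\<lambda>x. s * f x + t * g x) = s * P f + t * P g"
    if fg: "f \<in> test_functions \<Omega>" "g \<in> test_functions \<Omega>" for f g s t
  proof -
    have i: "set_integrable lebesgue \<Omega> (\<lambda>x. p x * f x)" "set_integrable lebesgue \<Omega> (\<lambda>x. p x * g x)"
      by (rule sq_mult_integrable[OF p sqt[OF fg(1)]] sq_mult_integrable[OF p sqt[OF fg(2)]])+
    have "P (\<lambda>x. s * f x + t * g x) = (LINT x:\<Omega>|lebesgue. s * (p x * f x) + t * (p x * g x))"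
      by (simp add: P_def algebra_simps)
    also have "\<dots> = s * P f + t * P g"
      using i by (subst set_integral_add(2)) (auto simp: P_def)
    finally show ?thesis .
  qed
  have out: "(LINT x:\<Omega>|lebesgue. (f x)\<^sup>2) = integral\<^sup>L lebesgue (\<lambda>x. (f x)\<^sup>2)"
    if "f \<in> test_functions \<Omega>" for f
    by (rule set_integral_outside) (simp add: test_function_outside[OF that])
  obtain C where C: "C \<ge> 0" "\<And>f \<sigma>. f \<in> test_functions \<Omega> \<Longrightarrow> mi_order \<sigma> \<le> k \<Longrightarrow>
     integral\<^sup>L lebesgue (\<lambda>x. (mi_deriv \<sigma> f x)\<^sup>2) \<le> C * (\<Sum>\<gamma>\<in>multiindices k. integral\<^sup>L lebesgue (\<lambda>x. (mi_deriv \<gamma> f x)\<^sup>2))"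
    using poincare_multi[OF bdd, of k] by metis
  have poinc: "(LINT x:\<Omega>|lebesgue. (mi_deriv \<sigma> f x)\<^sup>2) \<le> C * A f f"
    if f: "f \<in> test_functions \<Omega>" and \<sigma>: "mi_order \<sigma> \<le> k" for f \<sigma>
    using C(2)[OF f \<sigma>] by (simp add: A_def out[OF test_function_mi_deriv[OF f]] flip: power2_eq_square)
  have An: "A f f \<ge> 0" for f
    unfolding A_def power2_eq_square[symmetric] by (intro sum_nonneg sqint_nonneg)
  define N where "N = (LINT x:\<Omega>|lebesgue. (p x)\<^sup>2)"
  have N: "N \<ge> 0" by (simp add: N_def sqint_nonneg)
  \<comment> \<open>The functional is bounded below: by Cauchy-Schwarz and Poincare the square of
    \<open>P f\<close> is at most N C A(f, f), and a product is at most the square of the arithmetic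
    mean.\<close>
  have bound: "P f \<le> N * C / 2 + A f f / 2" if f: "f \<in> test_functions \<Omega>" for f
  proof -
    have "(P f)\<^sup>2 \<le> N * (LINT x:\<Omega>|lebesgue. (f x)\<^sup>2)"
      unfolding P_def N_def by (rule sq_Cauchy_Schwarz[OF p sqt[OF f]])
    also have "\<dots> \<le> N * (C * A f f)"
      using poinc[OF f, of "\<lambda>_. 0"] N by (intro mult_left_mono) (auto simp: mi_deriv_zero mi_order_def)
    also have "\<dots> \<le> (N * C / 2 + A f f / 2)\<^sup>2"
      using zero_le_power2[of "N * C / 2 - A f f / 2"] by (simp add: power2_eq_square algebra_simps)
    finally show ?thesis
      by (rule power2_le_imp_le) (use N C(1) An in auto)
  qed
  obtain \<phi> where \<phi>: "\<And>n. \<phi> n \<in> test_functions \<Omega>"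
    "\<And>m n. A (\<lambda>x. \<phi> m x - \<phi> n x) (\<lambda>x. \<phi> m x - \<phi> n x) \<le> 4 * (inverse (real (Suc m)) + inverse (real (Suc n)))"
    "\<And>n f t. f \<in> test_functions \<Omega> \<Longrightarrow> - inverse (real (Suc n)) \<le> t * (A (\<phi> n) f - P f) + t\<^sup>2 * (A f f / 2)"
    by (rule quadratic_minimizing_sequence[of "test_functions \<Omega>" A P "N * C / 2"])
      (use test_function_zero[of \<Omega>] comb Ac Pc bound in auto)
  have "\<exists>g. l2conv \<Omega> (\<lambda>n. mi_deriv \<sigma> (\<phi> n)) g" if \<sigma>: "mi_order \<sigma> \<le> k" for \<sigma>
  proof -
    have sq: "square_integrable_on \<Omega> (mi_deriv \<sigma> (\<phi> n))" for n by (rule sqd[OF \<phi>(1)])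
    have cau: "\<exists>M. \<forall>m\<ge>M. \<forall>n\<ge>M. (LINT x:\<Omega>|lebesgue. (mi_deriv \<sigma> (\<phi> m) x - mi_deriv \<sigma> (\<phi> n) x)\<^sup>2) < e" if e: "e > 0" for e
    proof -
      have "e / (8 * C + 1) > 0" using e C(1) by simp
      \<comment> \<open>The factor 8 C comes from two error terms with weight 4; adding 1 keeps the
        divisor positive when C = 0.\<close>
      then obtain M where M: "inverse (real (Suc M)) < e / (8 * C + 1)" using reals_Archimedean by blast
      have "(LINT x:\<Omega>|lebesgue. (mi_deriv \<sigma> (\<phi> m) x - mi_deriv \<sigma> (\<phi> n) x)\<^sup>2) < e" if mn: "m \<ge> M" "n \<ge> M" for m n
      proof -
        have inv: "inverse (real (Suc m)) \<le> inverse (real (Suc M))" "inverse (real (Suc n)) \<le> inverse (real (Suc M))"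
          using mn by (auto intro!: le_imp_inverse_le)
        have "(LINT x:\<Omega>|lebesgue. (mi_deriv \<sigma> (\<phi> m) x - mi_deriv \<sigma> (\<phi> n) x)\<^sup>2)
           = (LINT x:\<Omega>|lebesgue. (mi_deriv \<sigma> (\<lambda>x. \<phi> m x - \<phi> n x) x)\<^sup>2)"
          by (simp add: mi_deriv_diff test_functionD(1)[OF \<phi>(1)])
        also have "\<dots> \<le> C * A (\<lambda>x. \<phi> m x - \<phi> n x) (\<lambda>x. \<phi> m x - \<phi> n x)"
          by (rule poinc[OF test_function_diff[OF \<phi>(1) \<phi>(1)] \<sigma>])
        also have "\<dots> \<le> C * (8 * inverse (real (Suc M)))"
        proof (rule mult_left_mono[OF _ C(1)])
          have "a \<le> 8 * z" if "a \<le> 4 * (x + y)" "x \<le> z" "y \<le> z" for a x y z :: real using that by argo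
          then show "A (\<lambda>x. \<phi> m x - \<phi> n x) (\<lambda>x. \<phi> m x - \<phi> n x) \<le> 8 * inverse (real (Suc M))"
            using \<phi>(2)[of m n] inv by blast
        qed
        also have "\<dots> \<le> (8 * C + 1) * inverse (real (Suc M))"
          by (simp add: algebra_simps)
        also have "\<dots> < e" using M C(1) by (simp add: pos_less_divide_eq mult.commute)
        finally show ?thesis .
      qed
      then show ?thesis by blast
    qed
    show ?thesis by (rule sq_complete[OF \<Omega>s sq cau]) blast+
  qed
  then obtain g where g: "\<And>\<sigma>. mi_order \<sigma> \<le> k \<Longrightarrow> l2conv \<Omega> (\<lambda>n. mi_deriv \<sigma> (\<phi> n)) (g \<sigma>)" by metis
  define w where "w = g (\<lambda>_. 0)"
  have w: "l2conv \<Omega> \<phi> w"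
    using g[of "\<lambda>_. 0"] by (simp add: w_def mi_deriv_zero mi_order_def)
  have w0: "w \<in> sobolev_space_0 k \<Omega>" by (rule sobolev_space_0_limit(1)[OF \<Omega> \<phi>(1) w g])
  have conv: "l2conv \<Omega> (\<lambda>n. mi_deriv \<sigma> (\<phi> n)) (weak_deriv \<Omega> \<sigma> w)" if \<sigma>: "mi_order \<sigma> \<le> k" for \<sigma>
  proof (rule l2conv_cong_AE[OF g[OF \<sigma>]])
    have "AE x in lebesgue. x \<in> \<Omega> \<longrightarrow> weak_deriv \<Omega> \<sigma> w x = g \<sigma> x"
      by (rule sobolev_space_0_limit(2)[OF \<Omega> \<phi>(1) w g \<sigma>])
    then show "AE x in lebesgue. x \<in> \<Omega> \<longrightarrow> g \<sigma> x = weak_deriv \<Omega> \<sigma> w x" by eventually_elim auto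
  qed
  have "weak_polyharmonic_eq k \<Omega> w p"
    unfolding weak_polyharmonic_eq_def
  proof
    fix f assume f: "f \<in> test_functions \<Omega>"
    let ?L = "\<Sum>\<sigma>\<in>multiindices k. LINT x:\<Omega>|lebesgue. weak_deriv \<Omega> \<sigma> w x * mi_deriv \<sigma> f x"
    have L: "(\<lambda>n. A (\<phi> n) f) \<longlonglongrightarrow> ?L"
      unfolding A_def
      by (intro tendsto_sum l2conv_inner1 conv sqd[OF f]) (simp add: multiindices_def)
    \<comment> \<open>The approximate Euler inequality passes to the limit for each fixed t. A
      quadratic in t without constant term stays nonnegative only if its linear coefficient
      vanishes.\<close>
    have "0 \<le> 0 + t * (?L - P f) + t\<^sup>2 * (A f f / 2)" for t
    proof (rule LIMSEQ_le)
      show "(\<lambda>n. t * (A (\<phi> n) f - P f) + t\<^sup>2 * (A f f / 2)) \<longlonglongrightarrow> 0 + t * (?L - P f) + t\<^sup>2 * (A f f / 2)"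
        by (simp, intro tendsto_intros L)
      show "(\<lambda>n. - inverse (real (Suc n))) \<longlonglongrightarrow> 0"
        using tendsto_minus[OF LIMSEQ_inverse_real_of_nat] by simp
      show "\<exists>M. \<forall>n\<ge>M. - inverse (real (Suc n)) \<le> t * (A (\<phi> n) f - P f) + t\<^sup>2 * (A f f / 2)"
        using \<phi>(3)[OF f] by blast
    qed
    from quadratic_discriminant_le[OF this] have "(?L - P f)\<^sup>2 \<le> 4 * 0 * (A f f / 2)" using An[of f] by simp
    then have "?L = P f" by simp
    then show "?L = (LINT x:\<Omega>|lebesgue. p x * f x)" by (simp add: P_def)
  qed
  with that w0 \<phi>(1) w conv show ?thesis by blast
qed

section \<open>The energy form\<close>

lemma set_lint_sum:
  fixes f :: "'i \<Rightarrow> 'a \<Rightarrow> real"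
  assumes "\<And>i. i \<in> I \<Longrightarrow> set_integrable M S (f i)"
  shows "(LINT x:S|M. \<Sum>i\<in>I. f i x) = (\<Sum>i\<in>I. LINT x:S|M. f i x)" "set_integrable M S (\<lambda>x. \<Sum>i\<in>I. f i x)"
  using assms unfolding set_lebesgue_integral_def set_integrable_def scaleR_sum_right
  by (auto intro!: Bochner_Integration.integral_sum Bochner_Integration.integrable_sum)

lemma test_function_sobolev_space_0:
  assumes \<Omega>: "open \<Omega>" and \<phi>: "\<phi> \<in> test_functions \<Omega>"
  shows "\<phi> \<in> sobolev_space_0 k \<Omega>"
    "AE x in lebesgue. x \<in> \<Omega> \<longrightarrow> weak_deriv \<Omega> \<sigma> \<phi> x = mi_deriv \<sigma> \<phi> x"
proof -
  note sq = sq_test_function[OF open_sets_lebesgue[OF \<Omega>]]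
  show "\<phi> \<in> sobolev_space_0 k \<Omega>"
    by (rule sobolev_space_0_limit(1)[OF \<Omega>, of "\<lambda>n. \<phi>" \<phi> k "\<lambda>\<sigma>. mi_deriv \<sigma> \<phi>"])
      (auto intro!: l2conv_const sq[OF \<phi>] sq[OF test_function_mi_deriv[OF \<phi>]] \<phi>)
  show "AE x in lebesgue. x \<in> \<Omega> \<longrightarrow> weak_deriv \<Omega> \<sigma> \<phi> x = mi_deriv \<sigma> \<phi> x"
    by (rule weak_deriv_AE[OF \<Omega> smooth_weak_deriv[OF test_functionD(1)[OF \<phi>]]])
qed

lemma sq_Minkowski:
  assumes f: "square_integrable_on S f" and g: "square_integrable_on S g"
  shows "sqrt (LINT x:S|lebesgue. (f x + g x)\<^sup>2) \<le> sqrt (LINT x:S|lebesgue. (f x)\<^sup>2) + sqrt (LINT x:S|lebesgue. (g x)\<^sup>2)"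
proof -
  let ?F = "LINT x:S|lebesgue. (f x)\<^sup>2" and ?G = "LINT x:S|lebesgue. (g x)\<^sup>2" and ?H = "LINT x:S|lebesgue. f x * g x"
  have "(LINT x:S|lebesgue. (f x + g x)\<^sup>2) = (LINT x:S|lebesgue. ((f x)\<^sup>2 + (g x)\<^sup>2) + 2 * (f x * g x))"
    by (simp add: power2_sum algebra_simps)
  also have "\<dots> = ?F + ?G + 2 * ?H"
    using sq_integrable[OF f] sq_integrable[OF g] sq_mult_integrable[OF f g] by (simp add: set_integral_add)
  also have "\<dots> \<le> ?F + ?G + 2 * (sqrt ?F * sqrt ?G)"
    using sq_Cauchy_Schwarz_sqrt[OF f g] by simp
  also have "\<dots> = (sqrt ?F + sqrt ?G)\<^sup>2" by (simp add: power2_sum sqint_nonneg)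
  finally show ?thesis by (rule real_le_lsqrt[rotated]) (simp add: sqint_nonneg)
qed

lemma sq_Minkowski_list:
  assumes "\<And>c. c \<in> set cs \<Longrightarrow> square_integrable_on S (f c)"
  shows "square_integrable_on S (\<lambda>x. \<Sum>c\<leftarrow>cs. f c x)"
    "sqrt (LINT x:S|lebesgue. (\<Sum>c\<leftarrow>cs. f c x)\<^sup>2) \<le> (\<Sum>c\<leftarrow>cs. sqrt (LINT x:S|lebesgue. (f c x)\<^sup>2))"
proof -
  have "square_integrable_on S (\<lambda>x. \<Sum>c\<leftarrow>cs. f c x) \<and>
    sqrt (LINT x:S|lebesgue. (\<Sum>c\<leftarrow>cs. f c x)\<^sup>2) \<le> (\<Sum>c\<leftarrow>cs. sqrt (LINT x:S|lebesgue. (f c x)\<^sup>2))"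
    using assms
  proof (induction cs)
    case (Cons c cs)
    then have *: "square_integrable_on S (f c)" "square_integrable_on S (\<lambda>x. \<Sum>c\<leftarrow>cs. f c x)"
      "sqrt (LINT x:S|lebesgue. (\<Sum>c\<leftarrow>cs. f c x)\<^sup>2) \<le> (\<Sum>c\<leftarrow>cs. sqrt (LINT x:S|lebesgue. (f c x)\<^sup>2))" by auto
    show ?case using sq_add[OF *(1,2)] sq_Minkowski[OF *(1,2)] *(3) by simp
  qed (simp add: sq_zero set_lebesgue_integral_def)
  then show "square_integrable_on S (\<lambda>x. \<Sum>c\<leftarrow>cs. f c x)"
    "sqrt (LINT x:S|lebesgue. (\<Sum>c\<leftarrow>cs. f c x)\<^sup>2) \<le> (\<Sum>c\<leftarrow>cs. sqrt (LINT x:S|lebesgue. (f c x)\<^sup>2))" by auto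
qed

text \<open>The arguments are arbitrary families indexed by multi-indices, so that \<eta> times a
  gradient, a commutator or a family of classical derivatives can be inserted although none of them
  need be a family of weak derivatives.\<close>

definition energy_form ::
  "nat \<Rightarrow> 'n::finite coeffs \<Rightarrow> (real^'n) set \<Rightarrow> ('n multiindex \<Rightarrow> real^'n \<Rightarrow> real) \<Rightarrow>
   ('n multiindex \<Rightarrow> real^'n \<Rightarrow> real) \<Rightarrow> real" where
  "energy_form k a S U V = (\<Sum>\<sigma>\<in>multiindices k. \<Sum>\<gamma>\<in>multiindices k.
     LINT x:S|lebesgue. a \<sigma> \<gamma> x * U \<sigma> x * V \<gamma> x)"

lemma bilinear_form_eq:
  "bilinear_form k D a u v = energy_form k a D (\<lambda>\<sigma>. weak_deriv D \<sigma> u) (\<lambda>\<sigma>. weak_deriv D \<sigma> v)"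
  by (simp add: bilinear_form_def energy_form_def)

lemma local_energy_eq:
  "local_energy k D a S u = energy_form k a S (\<lambda>\<sigma>. weak_deriv D \<sigma> u) (\<lambda>\<sigma>. weak_deriv D \<sigma> u)"
  by (simp add: local_energy_def energy_form_def)

lemma energy_form_cong_AE:
  assumes "\<And>\<sigma>. \<sigma> \<in> multiindices k \<Longrightarrow> AE x in lebesgue. x \<in> S \<longrightarrow> U \<sigma> x = U' \<sigma> x"
    and "\<And>\<sigma>. \<sigma> \<in> multiindices k \<Longrightarrow> AE x in lebesgue. x \<in> S \<longrightarrow> V \<sigma> x = V' \<sigma> x"
    and S: "AE x in lebesgue. x \<in> S \<longleftrightarrow> x \<in> S'"
  shows "energy_form k a S U V = energy_form k a S' U' V'"
  unfolding energy_form_def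
proof (intro sum.cong refl set_integral_cong_AE_sets(1))
  fix \<sigma> \<gamma> :: "'a multiindex" assume "\<sigma> \<in> multiindices k" "\<gamma> \<in> multiindices k"
  from assms(1)[OF this(1)] assms(2)[OF this(2)] S
  show "AE x in lebesgue. (x \<in> S) = (x \<in> S') \<and> (x \<in> S \<longrightarrow> a \<sigma> \<gamma> x * U \<sigma> x * V \<gamma> x = a \<sigma> \<gamma> x * U' \<sigma> x * V' \<gamma> x)"
    by eventually_elim auto
qed

locale elliptic_form =
  fixes k :: nat and D :: "(real^'n::finite) set" and a :: "'n coeffs" and \<theta>max \<theta>min :: real
  assumes D: "open D" "bounded D" "D \<noteq> {}"
    and ess: "\<And>\<sigma> \<gamma>. \<sigma> \<in> multiindices k \<Longrightarrow> \<gamma> \<in> multiindices k \<Longrightarrow> essentially_bounded_on D (a \<sigma> \<gamma>)"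
    and self_adj: "self_adjoint_form k D a"
    and max0: "\<theta>max \<ge> 0" and bounded_above: "bounded_above_form k D a \<theta>max"
    and min0: "\<theta>min > 0" and elliptic: "strongly_elliptic k D a \<theta>min"
begin

abbreviation MI :: "'n multiindex set" where "MI \<equiv> multiindices k"
abbreviation E where "E \<equiv> energy_form k a"
abbreviation W where "W u \<sigma> \<equiv> weak_deriv D \<sigma> u"

definition sqf :: "(real^'n) set \<Rightarrow> ('n multiindex \<Rightarrow> real^'n \<Rightarrow> real) \<Rightarrow> bool" where
  "sqf S U \<longleftrightarrow> (\<forall>\<sigma>\<in>MI. square_integrable_on S (U \<sigma>))"

lemma a_measurable_subset:
  assumes "S \<in> sets lebesgue" "S \<subseteq> D" "\<sigma> \<in> MI" "\<gamma> \<in> MI"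
  shows "essentially_bounded_on S (a \<sigma> \<gamma>)"
proof -
  have m: "(\<lambda>x. indicator D x *\<^sub>R a \<sigma> \<gamma> x) \<in> borel_measurable lebesgue"
    and b: "\<exists>M. AE x in lebesgue. x \<in> D \<longrightarrow> \<bar>a \<sigma> \<gamma> x\<bar> \<le> M"
    using ess[OF assms(3,4)] by (auto simp: essentially_bounded_on_def set_borel_measurable_def)
  have "(\<lambda>x. indicator S x * (indicator D x *\<^sub>R a \<sigma> \<gamma> x)) \<in> borel_measurable lebesgue"
    by (rule borel_measurable_times[OF borel_measurable_indicator[OF assms(1)] m])
  moreover have "(\<lambda>x. indicator S x * (indicator D x *\<^sub>R a \<sigma> \<gamma> x)) = (\<lambda>x. indicator S x *\<^sub>R a \<sigma> \<gamma> x)"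
    using assms(2) by (auto simp: fun_eq_iff split: split_indicator)
  moreover have "\<exists>M. AE x in lebesgue. x \<in> S \<longrightarrow> \<bar>a \<sigma> \<gamma> x\<bar> \<le> M"
  proof -
    obtain M where "AE x in lebesgue. x \<in> D \<longrightarrow> \<bar>a \<sigma> \<gamma> x\<bar> \<le> M" using b by blast
    then have "AE x in lebesgue. x \<in> S \<longrightarrow> \<bar>a \<sigma> \<gamma> x\<bar> \<le> M" by eventually_elim (use assms(2) in auto)
    then show ?thesis by blast
  qed
  ultimately show ?thesis by (simp add: essentially_bounded_on_def set_borel_measurable_def)
qed

lemma term_integrable:
  assumes "S \<in> sets lebesgue" "S \<subseteq> D" "sqf S U" "sqf S V" "\<sigma> \<in> MI" "\<gamma> \<in> MI"
  shows "set_integrable lebesgue S (\<lambda>x. a \<sigma> \<gamma> x * U \<sigma> x * V \<gamma> x)"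
  using assms by (intro sq_mult_integrable sq_ess_bounded_mult a_measurable_subset) (auto simp: sqf_def)

definition dens :: "('n multiindex \<Rightarrow> real^'n \<Rightarrow> real) \<Rightarrow> real^'n \<Rightarrow> real" where
  "dens U x = (\<Sum>\<sigma>\<in>MI. \<Sum>\<gamma>\<in>MI. a \<sigma> \<gamma> x * U \<sigma> x * U \<gamma> x)"

lemma dens_bounds:
  assumes "x \<in> D"
  shows "\<theta>min * (\<Sum>\<sigma>\<in>MI. (U \<sigma> x)\<^sup>2) \<le> dens U x" "dens U x \<le> \<theta>max * (\<Sum>\<sigma>\<in>MI. (U \<sigma> x)\<^sup>2)" "0 \<le> dens U x"
proof -
  show 1: "\<theta>min * (\<Sum>\<sigma>\<in>MI. (U \<sigma> x)\<^sup>2) \<le> dens U x"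
    using elliptic[unfolded strongly_elliptic_def, THEN bspec, OF assms, THEN spec, of "\<lambda>\<sigma>. U \<sigma> x"] by (simp add: dens_def)
  show "dens U x \<le> \<theta>max * (\<Sum>\<sigma>\<in>MI. (U \<sigma> x)\<^sup>2)"
    using bounded_above[unfolded bounded_above_form_def, THEN bspec, OF assms, THEN spec, of "\<lambda>\<sigma>. U \<sigma> x"] by (simp add: dens_def)
  have "0 \<le> \<theta>min * (\<Sum>\<sigma>\<in>MI. (U \<sigma> x)\<^sup>2)" using min0 by (simp add: sum_nonneg)
  with 1 show "0 \<le> dens U x" by simp
qed

text \<open>Both pointwise bounds are compared at one point of D for the family that is constantly
  1.\<close>

lemma min_le_max: "\<theta>min \<le> \<theta>max"
proof -
  obtain x where x: "x \<in> D" using D(3) by blast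
  have "\<theta>min * (\<Sum>\<sigma>\<in>MI. 1\<^sup>2) \<le> \<theta>max * (\<Sum>\<sigma>\<in>MI. 1\<^sup>2)"
    using order_trans[OF dens_bounds(1)[OF x, of "\<lambda>_ _. 1"] dens_bounds(2)[OF x]] .
  moreover have "(\<Sum>\<sigma>\<in>MI. (1::real)\<^sup>2) > 0"
    by (simp add: card_gt_0_iff multiindices_nonempty finite_multiindices)
  ultimately show ?thesis by (rule mult_right_le_imp_le)
qed

lemma E_eq_integral:
  assumes "S \<in> sets lebesgue" "S \<subseteq> D" "sqf S U"
  shows "E S U U = (LINT x:S|lebesgue. dens U x)" "set_integrable lebesgue S (dens U)"
proof -
  have i: "set_integrable lebesgue S (\<lambda>x. a \<sigma> \<gamma> x * U \<sigma> x * U \<gamma> x)" if "\<sigma> \<in> MI" "\<gamma> \<in> MI" for \<sigma> \<gamma>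
    using term_integrable[OF assms(1,2,3,3) that] .
  show "E S U U = (LINT x:S|lebesgue. dens U x)" "set_integrable lebesgue S (dens U)"
    unfolding energy_form_def dens_def[abs_def]
    by (simp_all add: set_lint_sum i)
qed

lemma E_bounds:
  assumes S: "S \<in> sets lebesgue" "S \<subseteq> D" and U: "sqf S U"
  shows "\<theta>min * (\<Sum>\<sigma>\<in>MI. LINT x:S|lebesgue. (U \<sigma> x)\<^sup>2) \<le> E S U U"
    "E S U U \<le> \<theta>max * (\<Sum>\<sigma>\<in>MI. LINT x:S|lebesgue. (U \<sigma> x)\<^sup>2)" "0 \<le> E S U U"
proof -
  have i: "set_integrable lebesgue S (\<lambda>x. (U \<sigma> x)\<^sup>2)" if "\<sigma> \<in> MI" for \<sigma>
    using U that by (auto simp: sqf_def intro: sq_integrable)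
  have i2: "set_integrable lebesgue S (\<lambda>x. c * (\<Sum>\<sigma>\<in>MI. (U \<sigma> x)\<^sup>2))" for c
    by (intro set_integrable_mult_right set_lint_sum i)
  have eq: "(LINT x:S|lebesgue. c * (\<Sum>\<sigma>\<in>MI. (U \<sigma> x)\<^sup>2)) = c * (\<Sum>\<sigma>\<in>MI. LINT x:S|lebesgue. (U \<sigma> x)\<^sup>2)" for c
    by (simp add: set_lint_sum i)
  show 1: "\<theta>min * (\<Sum>\<sigma>\<in>MI. LINT x:S|lebesgue. (U \<sigma> x)\<^sup>2) \<le> E S U U"
    unfolding eq[symmetric] E_eq_integral(1)[OF S U]
    by (rule set_integral_mono[OF i2 E_eq_integral(2)[OF S U]]) (use S(2) dens_bounds(1) in auto)
  show "E S U U \<le> \<theta>max * (\<Sum>\<sigma>\<in>MI. LINT x:S|lebesgue. (U \<sigma> x)\<^sup>2)"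
    unfolding eq[symmetric] E_eq_integral(1)[OF S U]
    by (rule set_integral_mono[OF E_eq_integral(2)[OF S U] i2]) (use S(2) dens_bounds(2) in auto)
  have "0 \<le> \<theta>min * (\<Sum>\<sigma>\<in>MI. LINT x:S|lebesgue. (U \<sigma> x)\<^sup>2)"
    using min0 by (simp add: sum_nonneg sqint_nonneg)
  with 1 show "0 \<le> E S U U" by simp
qed

lemma E_add_right:
  assumes S: "S \<in> sets lebesgue" "S \<subseteq> D" and U: "sqf S U" "sqf S V" "sqf S V'"
  shows "E S U (\<lambda>\<sigma> x. V \<sigma> x + t * V' \<sigma> x) = E S U V + t * E S U V'"
proof -
  have "(LINT x:S|lebesgue. a \<sigma> \<gamma> x * U \<sigma> x * (V \<gamma> x + t * V' \<gamma> x))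
     = (LINT x:S|lebesgue. a \<sigma> \<gamma> x * U \<sigma> x * V \<gamma> x) + t * (LINT x:S|lebesgue. a \<sigma> \<gamma> x * U \<sigma> x * V' \<gamma> x)"
    if "\<sigma> \<in> MI" "\<gamma> \<in> MI" for \<sigma> \<gamma>
  proof -
    have "(LINT x:S|lebesgue. a \<sigma> \<gamma> x * U \<sigma> x * (V \<gamma> x + t * V' \<gamma> x))
      = (LINT x:S|lebesgue. a \<sigma> \<gamma> x * U \<sigma> x * V \<gamma> x + t * (a \<sigma> \<gamma> x * U \<sigma> x * V' \<gamma> x))"
      by (simp add: algebra_simps)
    also have "\<dots> = (LINT x:S|lebesgue. a \<sigma> \<gamma> x * U \<sigma> x * V \<gamma> x) + (LINT x:S|lebesgue. t * (a \<sigma> \<gamma> x * U \<sigma> x * V' \<gamma> x))"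
      by (rule set_integral_add(2)[OF term_integrable[OF S U(1,2) that]
          set_integrable_mult_right[OF term_integrable[OF S U(1,3) that]]])
    finally show ?thesis by simp
  qed
  then show ?thesis unfolding energy_form_def by (simp add: sum.distrib sum_distrib_left)
qed

lemma E_add_left:
  assumes S: "S \<in> sets lebesgue" "S \<subseteq> D" and U: "sqf S U" "sqf S V" "sqf S V'"
  shows "E S (\<lambda>\<sigma> x. V \<sigma> x + t * V' \<sigma> x) U = E S V U + t * E S V' U"
proof -
  have "(LINT x:S|lebesgue. a \<sigma> \<gamma> x * (V \<sigma> x + t * V' \<sigma> x) * U \<gamma> x)
     = (LINT x:S|lebesgue. a \<sigma> \<gamma> x * V \<sigma> x * U \<gamma> x) + t * (LINT x:S|lebesgue. a \<sigma> \<gamma> x * V' \<sigma> x * U \<gamma> x)"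
    if "\<sigma> \<in> MI" "\<gamma> \<in> MI" for \<sigma> \<gamma>
  proof -
    have "(LINT x:S|lebesgue. a \<sigma> \<gamma> x * (V \<sigma> x + t * V' \<sigma> x) * U \<gamma> x)
      = (LINT x:S|lebesgue. a \<sigma> \<gamma> x * V \<sigma> x * U \<gamma> x + t * (a \<sigma> \<gamma> x * V' \<sigma> x * U \<gamma> x))"
      by (simp add: algebra_simps)
    also have "\<dots> = (LINT x:S|lebesgue. a \<sigma> \<gamma> x * V \<sigma> x * U \<gamma> x) + (LINT x:S|lebesgue. t * (a \<sigma> \<gamma> x * V' \<sigma> x * U \<gamma> x))"
      by (rule set_integral_add(2)[OF term_integrable[OF S U(2,1) that]
          set_integrable_mult_right[OF term_integrable[OF S U(3,1) that]]])
    finally show ?thesis by simp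
  qed
  then show ?thesis unfolding energy_form_def by (simp add: sum.distrib sum_distrib_left)
qed

definition Es :: "(real^'n) set \<Rightarrow> ('n multiindex \<Rightarrow> real^'n \<Rightarrow> real) \<Rightarrow> ('n multiindex \<Rightarrow> real^'n \<Rightarrow> real) \<Rightarrow> real" where
  "Es S U V = (E S U V + E S V U) / 2"

lemma sqf_lin: "sqf S U \<Longrightarrow> sqf S V \<Longrightarrow> sqf S (\<lambda>\<sigma> x. U \<sigma> x + t * V \<sigma> x)"
  unfolding sqf_def by (intro ballI sq_add sq_cmult) blast+

text \<open>The coefficients need not be symmetric pointwise, and \<open>\<theta>max\<close> controls only their symmetric part;
  hence the symmetrization \<open>Es\<close>.\<close>

lemma Es_Cauchy_Schwarz:
  assumes S: "S \<in> sets lebesgue" "S \<subseteq> D" and U: "sqf S U" "sqf S V"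
  shows "\<bar>Es S U V\<bar> \<le> sqrt (E S U U) * sqrt (E S V V)"
proof -
  have "(E S U V + E S V U)\<^sup>2 \<le> 4 * E S U U * E S V V"
  proof (rule quadratic_discriminant_le)
    fix t
    have lin: "sqf S (\<lambda>\<sigma> x. U \<sigma> x + t * V \<sigma> x)" by (rule sqf_lin[OF U])
    have "0 \<le> E S (\<lambda>\<sigma> x. U \<sigma> x + t * V \<sigma> x) (\<lambda>\<sigma> x. U \<sigma> x + t * V \<sigma> x)"
      by (rule E_bounds(3)[OF S lin])
    also have "\<dots> = (E S U U + t * E S U V) + t * (E S V U + t * E S V V)"
      unfolding E_add_left[OF S lin U] E_add_right[OF S U(1) U] E_add_right[OF S U(2) U] ..
    finally show "0 \<le> E S U U + t * (E S U V + E S V U) + t\<^sup>2 * E S V V"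
      by (simp add: power2_eq_square algebra_simps)
  qed (rule E_bounds(3)[OF S U(2)])
  then have "(Es S U V)\<^sup>2 \<le> E S U U * E S V V"
    by (simp add: Es_def power_divide)
  from real_sqrt_le_mono[OF this] show ?thesis by (simp add: real_sqrt_mult)
qed

lemma Es_add_right:
  assumes S: "S \<in> sets lebesgue" "S \<subseteq> D" and U: "sqf S U" "sqf S V" "sqf S V'"
  shows "Es S U (\<lambda>\<sigma> x. V \<sigma> x + V' \<sigma> x) = Es S U V + Es S U V'"
  using E_add_right[OF S U, of 1] E_add_left[OF S U, of 1] by (simp add: Es_def field_simps)

text \<open>A scalar weight may stand in either slot, so both halves of the symmetrization give the
  same weighted density.\<close>

lemma Es_mult:
  assumes S: "S \<in> sets lebesgue" "S \<subseteq> D" and U: "sqf S U" and V: "sqf S (\<lambda>\<sigma> x. \<eta> x * U \<sigma> x)"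
  shows "Es S U (\<lambda>\<sigma> x. \<eta> x * U \<sigma> x) = (LINT x:S|lebesgue. \<eta> x * dens U x)"
    "set_integrable lebesgue S (\<lambda>x. \<eta> x * dens U x)"
proof -
  have i1: "set_integrable lebesgue S (\<lambda>x. a \<sigma> \<gamma> x * U \<sigma> x * (\<eta> x * U \<gamma> x))" if "\<sigma> \<in> MI" "\<gamma> \<in> MI" for \<sigma> \<gamma>
    using term_integrable[OF S U V that] .
  have eq1: "\<eta> x * dens U x = (\<Sum>\<sigma>\<in>MI. \<Sum>\<gamma>\<in>MI. a \<sigma> \<gamma> x * U \<sigma> x * (\<eta> x * U \<gamma> x))" for x
    by (simp add: dens_def sum_distrib_left mult.left_commute mult.assoc)
  have 1: "E S U (\<lambda>\<sigma> x. \<eta> x * U \<sigma> x) = (LINT x:S|lebesgue. \<eta> x * dens U x)"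
    unfolding energy_form_def eq1 by (simp add: set_lint_sum i1)
  show "set_integrable lebesgue S (\<lambda>x. \<eta> x * dens U x)"
    unfolding eq1 by (simp add: set_lint_sum i1)
  have i2: "set_integrable lebesgue S (\<lambda>x. a \<sigma> \<gamma> x * (\<eta> x * U \<sigma> x) * U \<gamma> x)" if "\<sigma> \<in> MI" "\<gamma> \<in> MI" for \<sigma> \<gamma>
    using term_integrable[OF S V U that] .
  have eq2: "\<eta> x * dens U x = (\<Sum>\<sigma>\<in>MI. \<Sum>\<gamma>\<in>MI. a \<sigma> \<gamma> x * (\<eta> x * U \<sigma> x) * U \<gamma> x)" for x
    by (simp add: dens_def sum_distrib_left mult.left_commute mult.assoc)
  have 2: "E S (\<lambda>\<sigma> x. \<eta> x * U \<sigma> x) U = (LINT x:S|lebesgue. \<eta> x * dens U x)"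
    unfolding energy_form_def eq2 by (simp add: set_lint_sum i2)
  show "Es S U (\<lambda>\<sigma> x. \<eta> x * U \<sigma> x) = (LINT x:S|lebesgue. \<eta> x * dens U x)"
    by (simp add: Es_def 1 2)
qed

lemma sobolev_0_imp: "u \<in> sobolev_space_0 k D \<Longrightarrow> u \<in> sobolev_space k D"
  by (simp add: sobolev_space_0_def)

lemma W_sq: "u \<in> sobolev_space_0 k D \<Longrightarrow> mi_order \<sigma> \<le> k \<Longrightarrow> square_integrable_on D (W u \<sigma>)"
  using sobolev_space_weak_deriv(2)[OF D(1) sobolev_0_imp] by blast

lemma W_sqf: "u \<in> sobolev_space_0 k D \<Longrightarrow> sqf D (W u)"
  by (auto simp: sqf_def multiindices_def intro: W_sq)

lemma sqf_subset: "sqf S U \<Longrightarrow> T \<in> sets lebesgue \<Longrightarrow> T \<subseteq> S \<Longrightarrow> sqf T U"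
  by (auto simp: sqf_def intro: sq_subset)

lemma D_sets: "D \<in> sets lebesgue"
  by (rule open_sets_lebesgue[OF D(1)])

text \<open>Self-adjointness enters here: on all of D the symmetrization leaves the form unchanged,
  and \<open>Es\<close>, unlike the symmetry of the form, can be localized to elements.\<close>

lemma bilinear_eq_Es:
  "u \<in> sobolev_space_0 k D \<Longrightarrow> v \<in> sobolev_space_0 k D \<Longrightarrow> bilinear_form k D a u v = Es D (W u) (W v)"
  using self_adj unfolding self_adjoint_form_def Es_def bilinear_form_eq by simp

lemma bilinear_add_right:
  assumes u: "u \<in> sobolev_space_0 k D" and v: "v \<in> sobolev_space_0 k D" and w: "w \<in> sobolev_space_0 k D"
  shows "bilinear_form k D a u (\<lambda>x. v x + t * w x) = bilinear_form k D a u v + t * bilinear_form k D a u w"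
proof -
  have "bilinear_form k D a u (\<lambda>x. v x + t * w x) = E D (W u) (\<lambda>\<sigma> x. W v \<sigma> x + t * W w \<sigma> x)"
    unfolding bilinear_form_eq
    by (rule energy_form_cong_AE)
      (auto simp: multiindices_def intro!: sobolev_space_0_lincomb(2)[OF D(1) v w])
  also have "\<dots> = bilinear_form k D a u v + t * bilinear_form k D a u w"
    unfolding bilinear_form_eq by (rule E_add_right[OF D_sets order_refl W_sqf[OF u] W_sqf[OF v] W_sqf[OF w]])
  finally show ?thesis .
qed

lemma bilinear_commute:
  "u \<in> sobolev_space_0 k D \<Longrightarrow> v \<in> sobolev_space_0 k D \<Longrightarrow> bilinear_form k D a u v = bilinear_form k D a v u"
  using self_adj by (simp add: self_adjoint_form_def)

lemma bilinear_lincomb: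
  assumes u: "u \<in> sobolev_space_0 k D" and v: "v \<in> sobolev_space_0 k D"
  shows "bilinear_form k D a (\<lambda>x. u x + t * v x) (\<lambda>x. u x + t * v x)
    = bilinear_form k D a u u + t * (2 * bilinear_form k D a u v) + t\<^sup>2 * bilinear_form k D a v v"
proof -
  have uv: "(\<lambda>x. u x + t * v x) \<in> sobolev_space_0 k D" by (rule sobolev_space_0_lincomb(1)[OF D(1) u v])
  show ?thesis
    unfolding bilinear_add_right[OF uv u v] bilinear_commute[OF uv u] bilinear_commute[OF uv v]
      bilinear_add_right[OF u u v] bilinear_add_right[OF v u v]
    using bilinear_commute[OF u v] by (simp add: power2_eq_square algebra_simps)
qed

lemma bilinear_nonneg: "u \<in> sobolev_space_0 k D \<Longrightarrow> 0 \<le> bilinear_form k D a u u"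
  unfolding bilinear_form_eq by (intro E_bounds(3) D_sets order_refl W_sqf)

end

section \<open>The partition and its basis functions\<close>

lemma finite_mi_order_le: "finite {\<sigma> :: 'n::finite multiindex. mi_order \<sigma> \<le> n}"
proof -
  have "{\<sigma> :: 'n multiindex. mi_order \<sigma> \<le> n} = (\<Union>p\<le>n. multiindices p)"
    by (auto simp: multiindices_def)
  then show ?thesis by (simp add: finite_multiindices)
qed

lemma polys_lincomb:
  assumes "p \<in> polys n" "q \<in> polys n" shows "(\<lambda>x. s * p x + t * q x) \<in> polys n"
proof -
  obtain c d where "p = (\<lambda>x. \<Sum>\<sigma> | mi_order \<sigma> \<le> n. c \<sigma> * (\<Prod>i\<in>UNIV. (x $ i) ^ \<sigma> i))"
    "q = (\<lambda>x. \<Sum>\<sigma> | mi_order \<sigma> \<le> n. d \<sigma> * (\<Prod>i\<in>UNIV. (x $ i) ^ \<sigma> i))"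
    using assms by (auto simp: polys_def)
  then have "(\<lambda>x. s * p x + t * q x) = (\<lambda>x. \<Sum>\<sigma> | mi_order \<sigma> \<le> n. (s * c \<sigma> + t * d \<sigma>) * (\<Prod>i\<in>UNIV. (x $ i) ^ \<sigma> i))"
    by (simp add: sum_distrib_left sum.distrib algebra_simps)
  then show ?thesis by (auto simp: polys_def)
qed

lemma polys_const: "(\<lambda>x :: real^'n::finite. c) \<in> polys n"
proof -
  have "(\<lambda>x. \<Sum>\<sigma> | mi_order \<sigma> \<le> n. (if \<sigma> = (\<lambda>_. 0) then c else 0) * (\<Prod>i\<in>UNIV. (x $ i) ^ \<sigma> i))
     = (\<lambda>x::real^'n. \<Sum>\<sigma>::'n multiindex | mi_order \<sigma> \<le> n. if \<sigma> = (\<lambda>_. 0) then c else 0)"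
    by (rule ext, rule sum.cong[OF refl]) simp
  also have "(\<Sum>\<sigma>::'n multiindex | mi_order \<sigma> \<le> n. if \<sigma> = (\<lambda>_. 0) then c else 0) = c"
    by (subst sum.delta[OF finite_mi_order_le]) (simp add: mi_order_def)
  finally have "(\<lambda>x::real^'n. c) = (\<lambda>x. \<Sum>\<sigma> | mi_order \<sigma> \<le> n. (if \<sigma> = (\<lambda>_. 0) then c else 0) * (\<Prod>i\<in>UNIV. (x $ i) ^ \<sigma> i))" ..
  then show ?thesis unfolding polys_def by (intro image_eqI[where x = "\<lambda>\<sigma>. if \<sigma> = (\<lambda>_. 0) then c else 0"] UNIV_I)
qed

lemma polys_sum:
  assumes "finite A" "\<And>i. i \<in> A \<Longrightarrow> p i \<in> polys n" shows "(\<lambda>x. \<Sum>i\<in>A. c i * p i x) \<in> polys n"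
  using assms
proof (induction A)
  case empty
  then show ?case using polys_const[of 0] by simp
next
  case (insert i A)
  then show ?case using polys_lincomb[of "p i" n "\<lambda>x. \<Sum>i\<in>A. c i * p i x" "c i" 1] by simp
qed

lemma polys_continuous: "p \<in> polys n \<Longrightarrow> continuous_on S p"
  by (auto simp: polys_def intro!: continuous_intros)

lemma sq_continuous:
  assumes p: "continuous_on UNIV p" and S: "bounded S" "S \<in> sets lebesgue"
  shows "square_integrable_on S (p :: real^'n::finite \<Rightarrow> real)"
proof -
  have c: "compact (closure S)" using S by simp
  have m: "p \<in> borel_measurable lebesgue"
    using borel_measurable_continuous_onI[OF p] by (intro measurable_completion) simp
  have "continuous_on UNIV (\<lambda>x. (p x)\<^sup>2)" by (intro continuous_intros p)
  then have "locally_integrable_on UNIV (\<lambda>x. (p x)\<^sup>2)" by (rule continuous_locally_integrable)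
  then have "set_integrable lebesgue (closure S) (\<lambda>x. (p x)\<^sup>2)"
    using c by (simp add: locally_integrable_on_def)
  then have "set_integrable lebesgue S (\<lambda>x. (p x)\<^sup>2)"
    by (rule set_integrable_subset) (use S closure_subset in auto)
  moreover have "set_borel_measurable lebesgue S p"
    unfolding set_borel_measurable_def
    using borel_measurable_times[OF borel_measurable_indicator[OF S(2)] m] by simp
  ultimately show ?thesis by (simp add: square_integrable_on_def)
qed

lemma sq_int_pos:
  assumes "open S" "bounded S" "(S :: (real^'n::finite) set) \<noteq> {}"
  shows "0 < (LINT x:S|lebesgue. (1::real)\<^sup>2)"
proof -
  have S: "S \<in> lmeasurable" using assms by (simp add: lmeasurable_open)
  have "(LINT x:S|lebesgue. (1::real)\<^sup>2) = measure lebesgue S"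
    using S by (simp add: set_lebesgue_integral_def fmeasurableD)
  moreover have "measure lebesgue S \<noteq> 0"
  proof
    assume "measure lebesgue S = 0"
    then have "negligible S" using S by (simp add: negligible_iff_measure0)
    then show False using assms open_not_negligible by blast
  qed
  ultimately show ?thesis using measure_nonneg[of lebesgue S] by linarith
qed

locale partition_form = elliptic_form k D a \<theta>max \<theta>min
  for k and D :: "(real^'n::finite) set" and a \<theta>max \<theta>min +
  fixes \<delta> :: real and m :: nat and \<tau> :: "nat \<Rightarrow> (real^'n) set" and x :: "nat \<Rightarrow> real^'n"
    and \<phi> \<psi> :: "nat \<Rightarrow> nat \<Rightarrow> real^'n \<Rightarrow> real" and Cp C :: real and nQ :: nat
  assumes nQ: "nQ = poly_dim TYPE('n) k" and \<delta>: "\<delta> > 0" and regular: "regular_partition D m \<tau> \<delta>"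
    and centers: "\<And>i. i \<in> {1..m} \<Longrightarrow> x i \<in> \<tau> i \<and> ball (x i) (\<delta> * diameter (\<tau> i) / 2) \<subseteq> \<tau> i"
    and basis: "local_poly_basis k m \<tau> \<phi>"
    and minimizer: "\<And>i q. i \<in> {1..m} \<Longrightarrow> q \<in> {1..nQ} \<Longrightarrow> is_basis_minimizer k D a m \<phi> i q (\<psi> i q)"
    and proj: "projection_constant k D m \<tau> Cp"
    and inv: "inverse_estimate_constant TYPE('n) k \<delta> C"
begin

abbreviation I where "I \<equiv> {1..m}"
abbreviation Q where "Q \<equiv> {1..nQ}"
abbreviation T where "T j \<equiv> interior (\<tau> j)"
abbreviation h where "h j \<equiv> diameter (\<tau> j)"

lemma part: "partition_of D m \<tau>"
  using regular by (simp add: regular_partition_def)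

lemma \<tau>_facts:
  assumes "j \<in> I"
  shows "compact (\<tau> j)" "T j \<subseteq> D" "negligible (frontier (\<tau> j))" "open (T j)" "bounded (T j)" "T j \<in> sets lebesgue" "0 < h j"
proof -
  show c: "compact (\<tau> j)" "T j \<subseteq> D" "negligible (frontier (\<tau> j))"
    using part assms by (auto simp: partition_of_def)
  show "open (T j)" by simp
  then show "T j \<in> sets lebesgue" by (rule open_sets_lebesgue)
  show "bounded (T j)" using c(2) D(2) bounded_subset by blast
  \<comment> \<open>If the diameter were 0, the quotient would be 0 by the convention for division
    by zero, contradicting \<delta> > 0.\<close>
  have "inscribed_diameter (\<tau> j) / h j \<ge> \<delta>" using regular assms by (auto simp: regular_partition_def)
  then have "h j \<noteq> 0" using \<delta> by auto
  moreover have "0 \<le> h j" using c(1) compact_imp_bounded diameter_ge_0 by blast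
  ultimately show "0 < h j" by simp
qed

lemma T_nonempty: "j \<in> I \<Longrightarrow> T j \<noteq> {}"
proof -
  assume j: "j \<in> I"
  have "ball (x j) (\<delta> * h j / 2) \<subseteq> T j"
    using centers[OF j] by (intro interior_maximal) auto
  moreover have "x j \<in> ball (x j) (\<delta> * h j / 2)" using \<delta> \<tau>_facts(7)[OF j] by simp
  ultimately show ?thesis by blast
qed

lemma \<tau>_AE: "j \<in> I \<Longrightarrow> AE y in lebesgue. y \<in> \<tau> j \<longleftrightarrow> y \<in> T j"
proof -
  assume j: "j \<in> I"
  have "\<tau> j - T j \<subseteq> frontier (\<tau> j)"
    using closure_subset by (auto simp: frontier_def)
  then have "{y. \<not> (y \<in> \<tau> j \<longleftrightarrow> y \<in> T j)} \<subseteq> frontier (\<tau> j)" using interior_subset by blast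
  moreover have "frontier (\<tau> j) \<in> null_sets lebesgue" using \<tau>_facts(3)[OF j] by (simp add: negligible_iff_null_sets)
  ultimately show ?thesis by (intro AE_I'[of "frontier (\<tau> j)"]) auto
qed

text \<open>The elements cover the closure of D and their frontiers are null sets, so almost every
  point of D is interior to an element; conversely the interiors lie in D.\<close>

lemma D_AE: "AE y in lebesgue. y \<in> D \<longleftrightarrow> y \<in> (\<Union>j\<in>I. T j)"
proof -
  have "AE y in lebesgue. \<forall>j\<in>I. y \<in> \<tau> j \<longleftrightarrow> y \<in> T j"
    by (rule AE_finite_allI) (auto intro: \<tau>_AE)
  then show ?thesis
  proof eventually_elim
    fix y assume *: "\<forall>j\<in>I. y \<in> \<tau> j \<longleftrightarrow> y \<in> T j"
    have "y \<in> (\<Union>j\<in>I. \<tau> j)" if "y \<in> D"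
      using that closure_subset[of D] part by (auto simp: partition_of_def)
    then show "y \<in> D \<longleftrightarrow> y \<in> (\<Union>j\<in>I. T j)" using * \<tau>_facts(2) by blast
  qed
qed

lemma T_disjoint: "i \<in> I \<Longrightarrow> j \<in> I \<Longrightarrow> i \<noteq> j \<Longrightarrow> T i \<inter> T j = {}"
  using part unfolding partition_of_def by blast

lemma integral_split:
  assumes f: "set_integrable lebesgue (D \<inter> S) f" and S: "S \<in> sets lebesgue"
  shows "(LINT y:D \<inter> S|lebesgue. f y :: real) = (\<Sum>j\<in>I. LINT y:T j \<inter> S|lebesgue. f y)"
proof -
  have "(LINT y:D \<inter> S|lebesgue. f y) = (LINT y:(\<Union>j\<in>I. T j \<inter> S)|lebesgue. f y)"
    by (rule set_integral_cong_AE_sets) (use D_AE in eventually_elim, auto)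
  also have "\<dots> = (\<Sum>j\<in>I. LINT y:T j \<inter> S|lebesgue. f y)"
  proof (rule set_integral_finite_Union)
    show "disjoint_family_on (\<lambda>j. T j \<inter> S) I"
      using T_disjoint by (fastforce simp: disjoint_family_on_def)
    show "set_integrable lebesgue (T j \<inter> S) f" if "j \<in> I" for j
      by (rule set_integrable_subset[OF f]) (use S \<tau>_facts(2,6)[OF that] in auto)
  qed (use S \<tau>_facts(6) in auto)
  finally show ?thesis .
qed

lemma E_split:
  assumes U: "sqf D U" "sqf D V"
  shows "E D U V = (\<Sum>j\<in>I. E (T j) U V)"
proof -
  have "(LINT y:D|lebesgue. a \<sigma> \<gamma> y * U \<sigma> y * V \<gamma> y) = (\<Sum>j\<in>I. LINT y:T j|lebesgue. a \<sigma> \<gamma> y * U \<sigma> y * V \<gamma> y)"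
    if "\<sigma> \<in> MI" "\<gamma> \<in> MI" for \<sigma> \<gamma>
    using integral_split[of UNIV "\<lambda>y. a \<sigma> \<gamma> y * U \<sigma> y * V \<gamma> y"] term_integrable[OF D_sets order_refl U that] by simp
  then have "E D U V = (\<Sum>\<sigma>\<in>MI. \<Sum>\<gamma>\<in>MI. \<Sum>j\<in>I. LINT y:T j|lebesgue. a \<sigma> \<gamma> y * U \<sigma> y * V \<gamma> y)"
    by (simp add: energy_form_def)
  also have "\<dots> = (\<Sum>\<sigma>\<in>MI. \<Sum>j\<in>I. \<Sum>\<gamma>\<in>MI. LINT y:T j|lebesgue. a \<sigma> \<gamma> y * U \<sigma> y * V \<gamma> y)"
    by (intro sum.cong refl sum.swap)
  also have "\<dots> = (\<Sum>j\<in>I. E (T j) U V)"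
    unfolding energy_form_def by (rule sum.swap)
  finally show ?thesis .
qed

lemma Es_split:
  assumes U: "sqf D U" "sqf D V"
  shows "Es D U V = (\<Sum>j\<in>I. Es (T j) U V)"
  unfolding Es_def E_split[OF U] E_split[OF U(2,1)] by (simp add: sum.distrib flip: sum_divide_distrib)

section \<open>Basis polynomials, moments and Lagrange multipliers\<close>

definition P where "P j q = (SOME p. p \<in> polys (k - 1) \<and> \<phi> j q = (\<lambda>y. if y \<in> \<tau> j then p y else 0))"

lemma P:
  assumes "j \<in> I" "q \<in> Q"
  shows "P j q \<in> polys (k - 1)" "\<phi> j q = (\<lambda>y. if y \<in> \<tau> j then P j q y else 0)"
proof -
  have "\<exists>p. p \<in> polys (k - 1) \<and> \<phi> j q = (\<lambda>y. if y \<in> \<tau> j then p y else 0)"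
    using basis assms unfolding local_poly_basis_def Let_def nQ by blast
  from someI_ex[OF this] show "P j q \<in> polys (k - 1)" "\<phi> j q = (\<lambda>y. if y \<in> \<tau> j then P j q y else 0)"
    unfolding P_def by blast+
qed

lemma basis_span:
  assumes "j \<in> I" "p \<in> polys (k - 1)"
  obtains c where "\<And>y. y \<in> \<tau> j \<Longrightarrow> p y = (\<Sum>q\<in>Q. c q * P j q y)"
proof -
  obtain c where "\<forall>y\<in>\<tau> j. p y = (\<Sum>q\<in>Q. c q * \<phi> j q y)"
    using basis assms unfolding local_poly_basis_def Let_def nQ by blast
  then have "p y = (\<Sum>q\<in>Q. c q * P j q y)" if "y \<in> \<tau> j" for y
    using that P(2)[OF assms(1)] by (auto intro!: sum.cong)
  then show ?thesis by (rule that)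
qed

lemma poly_sq: "j \<in> I \<Longrightarrow> p \<in> polys n \<Longrightarrow> square_integrable_on (T j) p"
  using \<tau>_facts by (intro sq_continuous polys_continuous)

lemma sq_T: "square_integrable_on D u \<Longrightarrow> j \<in> I \<Longrightarrow> square_integrable_on (T j) u"
  using \<tau>_facts(2,6) by (blast intro: sq_subset)

lemma sqf_T: "sqf D U \<Longrightarrow> j \<in> I \<Longrightarrow> sqf (T j) U"
  by (auto simp: sqf_def intro: sq_T)

lemma moment_eq:
  assumes j: "j \<in> I" "q \<in> Q"
  shows "(LINT y:D|lebesgue. v y * \<phi> j q y) = (LINT y:T j|lebesgue. v y * P j q y)"
  unfolding set_lebesgue_integral_def
proof (rule lebesgue_integral_cong_AE)
  show "AE y in lebesgue. indicator D y *\<^sub>R (v y * \<phi> j q y) = indicator (T j) y *\<^sub>R (v y * P j q y)"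
    using \<tau>_AE[OF j(1)]
  proof eventually_elim
    fix y assume "y \<in> \<tau> j \<longleftrightarrow> y \<in> T j"
    then show "indicator D y *\<^sub>R (v y * \<phi> j q y) = indicator (T j) y *\<^sub>R (v y * P j q y)"
      using \<tau>_facts(2)[OF j(1)] by (auto simp: P(2)[OF j] split: split_indicator)
  qed
qed

lemma moment_add:
  assumes j: "j \<in> I" and p: "p \<in> polys n" and u: "square_integrable_on D u" and v: "square_integrable_on D v"
  shows "(LINT y:T j|lebesgue. (u y + t * v y) * p y) = (LINT y:T j|lebesgue. u y * p y) + t * (LINT y:T j|lebesgue. v y * p y)"
proof -
  have i: "set_integrable lebesgue (T j) (\<lambda>y. u y * p y)" "set_integrable lebesgue (T j) (\<lambda>y. v y * p y)"
    using sq_mult_integrable[OF sq_T[OF u j] poly_sq[OF j p]] sq_mult_integrable[OF sq_T[OF v j] poly_sq[OF j p]] by auto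
  have "(LINT y:T j|lebesgue. (u y + t * v y) * p y) = (LINT y:T j|lebesgue. u y * p y + t * (v y * p y))"
    by (simp add: algebra_simps)
  also have "\<dots> = (LINT y:T j|lebesgue. u y * p y) + t * (LINT y:T j|lebesgue. v y * p y)"
    using set_integral_add(2)[OF i(1) set_integrable_mult_right[OF i(2), of t]] by simp
  finally show ?thesis .
qed

lemma H0_sq: "u \<in> sobolev_space_0 k D \<Longrightarrow> square_integrable_on D u"
  by (simp add: sobolev_space_0_def sobolev_space_def)

lemma \<psi>_facts:
  assumes "i \<in> I" "q \<in> Q"
  shows "\<psi> i q \<in> sobolev_space_0 k D"
    "\<And>j q'. j \<in> I \<Longrightarrow> q' \<in> Q \<Longrightarrow> (LINT y:T j|lebesgue. \<psi> i q y * P j q' y) = (if i = j \<and> q = q' then 1 else 0)"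
    "\<And>v. v \<in> sobolev_space_0 k D \<Longrightarrow>
       (\<And>j q'. j \<in> I \<Longrightarrow> q' \<in> Q \<Longrightarrow> (LINT y:T j|lebesgue. v y * P j q' y) = (if i = j \<and> q = q' then 1 else 0)) \<Longrightarrow>
       bilinear_form k D a (\<psi> i q) (\<psi> i q) \<le> bilinear_form k D a v v"
  using minimizer[OF assms] by (auto simp: is_basis_minimizer_def admissible_def moment_eq[symmetric] nQ[symmetric])

text \<open>The three claims are proved in one induction: additivity of the form and of the moments
  at the next summand presupposes that the partial sum lies in H_0^k.\<close>

lemma lincomb_family:
  assumes F: "finite F" and v: "v \<in> sobolev_space_0 k D" and \<Psi>: "\<And>c. c \<in> F \<Longrightarrow> \<Psi> c \<in> sobolev_space_0 k D"
    and u: "u \<in> sobolev_space_0 k D"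
  shows "(\<lambda>y. v y + (\<Sum>c\<in>F. t c * \<Psi> c y)) \<in> sobolev_space_0 k D"
    "bilinear_form k D a u (\<lambda>y. v y + (\<Sum>c\<in>F. t c * \<Psi> c y))
      = bilinear_form k D a u v + (\<Sum>c\<in>F. t c * bilinear_form k D a u (\<Psi> c))"
    "\<And>j p n. j \<in> I \<Longrightarrow> p \<in> polys n \<Longrightarrow> (LINT y:T j|lebesgue. (v y + (\<Sum>c\<in>F. t c * \<Psi> c y)) * p y)
      = (LINT y:T j|lebesgue. v y * p y) + (\<Sum>c\<in>F. t c * (LINT y:T j|lebesgue. \<Psi> c y * p y))"
proof -
  have "(\<lambda>y. v y + (\<Sum>c\<in>F. t c * \<Psi> c y)) \<in> sobolev_space_0 k D \<and>
    bilinear_form k D a u (\<lambda>y. v y + (\<Sum>c\<in>F. t c * \<Psi> c y))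
      = bilinear_form k D a u v + (\<Sum>c\<in>F. t c * bilinear_form k D a u (\<Psi> c)) \<and>
    (\<forall>j p n. j \<in> I \<longrightarrow> p \<in> polys n \<longrightarrow> (LINT y:T j|lebesgue. (v y + (\<Sum>c\<in>F. t c * \<Psi> c y)) * p y)
      = (LINT y:T j|lebesgue. v y * p y) + (\<Sum>c\<in>F. t c * (LINT y:T j|lebesgue. \<Psi> c y * p y)))"
    using F \<Psi>
  proof (induction F)
    case (insert d F)
    let ?w = "\<lambda>y. v y + (\<Sum>c\<in>F. t c * \<Psi> c y)"
    have eq: "v y + (\<Sum>c\<in>insert d F. t c * \<Psi> c y) = ?w y + t d * \<Psi> d y" for y
      using insert.hyps by (simp add: algebra_simps)
    have w: "?w \<in> sobolev_space_0 k D" and d: "\<Psi> d \<in> sobolev_space_0 k D" using insert by auto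
    have "(LINT y:T j|lebesgue. (?w y + t d * \<Psi> d y) * p y)
      = (LINT y:T j|lebesgue. v y * p y) + (\<Sum>c\<in>insert d F. t c * (LINT y:T j|lebesgue. \<Psi> c y * p y))"
      if "j \<in> I" "p \<in> polys n" for j p n
    proof -
      have "(LINT y:T j|lebesgue. ?w y * p y) = (LINT y:T j|lebesgue. v y * p y) + (\<Sum>c\<in>F. t c * (LINT y:T j|lebesgue. \<Psi> c y * p y))"
        using insert.IH insert.prems that by blast
      then show ?thesis
        unfolding moment_add[OF that H0_sq[OF w] H0_sq[OF d]] using insert.hyps by simp
    qed
    moreover have "bilinear_form k D a u (\<lambda>y. ?w y + t d * \<Psi> d y)
      = bilinear_form k D a u v + (\<Sum>c\<in>insert d F. t c * bilinear_form k D a u (\<Psi> c))"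
      unfolding bilinear_add_right[OF u w d] using insert by simp
    ultimately show ?case
      unfolding eq using sobolev_space_0_lincomb(1)[OF D(1) w d, of "t d"] by blast
  qed (use v in simp)
  then show "(\<lambda>y. v y + (\<Sum>c\<in>F. t c * \<Psi> c y)) \<in> sobolev_space_0 k D"
    "bilinear_form k D a u (\<lambda>y. v y + (\<Sum>c\<in>F. t c * \<Psi> c y))
      = bilinear_form k D a u v + (\<Sum>c\<in>F. t c * bilinear_form k D a u (\<Psi> c))"
    "\<And>j p n. j \<in> I \<Longrightarrow> p \<in> polys n \<Longrightarrow> (LINT y:T j|lebesgue. (v y + (\<Sum>c\<in>F. t c * \<Psi> c y)) * p y)
      = (LINT y:T j|lebesgue. v y * p y) + (\<Sum>c\<in>F. t c * (LINT y:T j|lebesgue. \<Psi> c y * p y))"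
    by blast+
qed

text \<open>For \<open>u\<close> one of the \<open>\<psi> i q\<close>, this polynomial is the value
  of the operator at \<open>u\<close> on element \<open>j\<close>; its coefficients are the
  multipliers of the moment constraints.\<close>

definition pj where "pj u j y = (\<Sum>q\<in>Q. bilinear_form k D a u (\<psi> j q) * P j q y)"

lemma pj_poly:
  assumes "j \<in> I" shows "pj u j \<in> polys (k - 1)"
  unfolding pj_def[abs_def] by (rule polys_sum[OF finite_atLeastAtMost P(1)[OF assms]])

text \<open>The \<open>\<psi> j q\<close> form a dual basis of the constraints, which makes their values under the form the Lagrange
  multipliers.\<close>

lemma euler_lagrange:
  assumes i: "i \<in> I" "q \<in> Q" and v: "v \<in> sobolev_space_0 k D"
  shows "bilinear_form k D a (\<psi> i q) v = (\<Sum>j\<in>I. LINT y:T j|lebesgue. v y * pj (\<psi> i q) j y)"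
proof -
  let ?u = "\<psi> i q"
  let ?B = "bilinear_form k D a"
  let ?F = "I \<times> Q"
  define \<alpha> where "\<alpha> c = (LINT y:T (fst c)|lebesgue. v y * P (fst c) (snd c) y)" for c
  define \<Psi> where "\<Psi> c = \<psi> (fst c) (snd c)" for c
  \<comment> \<open>Subtracting from v its moments, expanded in the dual family, leaves a function
    with all moments 0, hence a perturbation that preserves the constraints.\<close>
  define z where "z y = v y + (\<Sum>c\<in>?F. - \<alpha> c * \<Psi> c y)" for y
  have u: "?u \<in> sobolev_space_0 k D" by (rule \<psi>_facts(1)[OF i])
  have fin: "finite ?F" by simp
  have \<Psi>: "\<Psi> c \<in> sobolev_space_0 k D" if "c \<in> ?F" for c
    using that \<psi>_facts(1) by (auto simp: \<Psi>_def)
  have z: "z \<in> sobolev_space_0 k D"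
    unfolding z_def[abs_def] by (rule lincomb_family(1)[OF fin v _ u]) (rule \<Psi>)
  have Bz: "?B ?u z = ?B ?u v + (\<Sum>c\<in>?F. - \<alpha> c * ?B ?u (\<Psi> c))"
    unfolding z_def[abs_def] by (rule lincomb_family(2)[OF fin v _ u]) (rule \<Psi>)
  have mz: "(LINT y:T j|lebesgue. z y * P j q' y) = 0" if j: "j \<in> I" "q' \<in> Q" for j q'
  proof -
    have "(LINT y:T j|lebesgue. z y * P j q' y) = (LINT y:T j|lebesgue. v y * P j q' y)
       + (\<Sum>c\<in>?F. - \<alpha> c * (LINT y:T j|lebesgue. \<Psi> c y * P j q' y))"
      unfolding z_def by (rule lincomb_family(3)[OF fin v _ u j(1) P(1)[OF j]]) (rule \<Psi>)
    also have "(\<Sum>c\<in>?F. - \<alpha> c * (LINT y:T j|lebesgue. \<Psi> c y * P j q' y)) = (\<Sum>c\<in>?F. if c = (j, q') then - \<alpha> c else 0)"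
    proof (rule sum.cong[OF refl])
      fix c assume "c \<in> ?F"
      then have "(LINT y:T j|lebesgue. \<Psi> c y * P j q' y) = (if fst c = j \<and> snd c = q' then 1 else 0)"
        using \<psi>_facts(2)[OF _ _ j, of "fst c" "snd c"] by (auto simp: \<Psi>_def)
      then show "- \<alpha> c * (LINT y:T j|lebesgue. \<Psi> c y * P j q' y) = (if c = (j, q') then - \<alpha> c else 0)"
        by (cases c) auto
    qed
    also have "\<dots> = - \<alpha> (j, q')" using j by (simp add: sum.delta')
    finally show ?thesis by (simp add: \<alpha>_def)
  qed
  \<comment> \<open>Minimality along u + t z in both directions of t forces the cross term B(u, z)
    to vanish.\<close>
  have "0 \<le> 0 + t * (2 * ?B ?u z) + t\<^sup>2 * ?B z z" for t
  proof -
    have "?B ?u ?u \<le> ?B (\<lambda>y. ?u y + t * z y) (\<lambda>y. ?u y + t * z y)"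
    proof (rule \<psi>_facts(3)[OF i sobolev_space_0_lincomb(1)[OF D(1) u z]])
      fix j q' assume j: "j \<in> I" "q' \<in> Q"
      show "(LINT y:T j|lebesgue. (?u y + t * z y) * P j q' y) = (if i = j \<and> q = q' then 1 else 0)"
        unfolding moment_add[OF j(1) P(1)[OF j] H0_sq[OF u] H0_sq[OF z]] mz[OF j] \<psi>_facts(2)[OF i j] by simp
    qed
    then show ?thesis unfolding bilinear_lincomb[OF u z] by simp
  qed
  from quadratic_discriminant_le[OF this bilinear_nonneg[OF z]] have "?B ?u z = 0" by simp
  then have "?B ?u v = (\<Sum>c\<in>?F. \<alpha> c * ?B ?u (\<Psi> c))"
    using Bz by (simp add: sum_negf)
  also have "\<dots> = (\<Sum>j\<in>I. \<Sum>q'\<in>Q. \<alpha> (j, q') * ?B ?u (\<psi> j q'))"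
    by (simp add: sum.cartesian_product \<Psi>_def case_prod_beta)
  also have "\<dots> = (\<Sum>j\<in>I. LINT y:T j|lebesgue. v y * pj ?u j y)"
  proof (rule sum.cong[OF refl])
    fix j assume j: "j \<in> I"
    have i: "set_integrable lebesgue (T j) (\<lambda>y. ?B ?u (\<psi> j q') * (v y * P j q' y))" if "q' \<in> Q" for q'
      by (intro set_integrable_mult_right sq_mult_integrable sq_T[OF H0_sq[OF v] j] poly_sq[OF j P(1)[OF j that]])
    have "(LINT y:T j|lebesgue. v y * pj ?u j y) = (LINT y:T j|lebesgue. \<Sum>q'\<in>Q. ?B ?u (\<psi> j q') * (v y * P j q' y))"
      by (simp add: pj_def sum_distrib_left mult.left_commute)
    also have "\<dots> = (\<Sum>q'\<in>Q. ?B ?u (\<psi> j q') * (LINT y:T j|lebesgue. v y * P j q' y))"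
      by (subst set_lint_sum(1)) (use i in simp_all)
    finally show "(\<Sum>q'\<in>Q. \<alpha> (j, q') * ?B ?u (\<psi> j q')) = (LINT y:T j|lebesgue. v y * pj ?u j y)"
      by (simp add: \<alpha>_def mult.commute)
  qed
  finally show ?thesis .
qed

lemma moment_poly:
  assumes j: "j \<in> I" and p: "p \<in> polys (k - 1)" and v: "square_integrable_on D v"
  obtains c where "(LINT y:T j|lebesgue. v y * p y) = (\<Sum>q\<in>Q. c q * (LINT y:T j|lebesgue. v y * P j q y))"
    "\<And>y. y \<in> \<tau> j \<Longrightarrow> p y = (\<Sum>q\<in>Q. c q * P j q y)"
proof -
  obtain c where c: "\<And>y. y \<in> \<tau> j \<Longrightarrow> p y = (\<Sum>q\<in>Q. c q * P j q y)" using basis_span[OF j p] by blast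
  have i: "set_integrable lebesgue (T j) (\<lambda>y. c q' * (v y * P j q' y))" if "q' \<in> Q" for q'
    by (intro set_integrable_mult_right sq_mult_integrable sq_T[OF v j] poly_sq[OF j P(1)[OF j that]])
  have "(LINT y:T j|lebesgue. v y * p y) = (LINT y:T j|lebesgue. \<Sum>q\<in>Q. c q * (v y * P j q y))"
    by (rule set_integral_cong_AE_sets(1), rule AE_I2)
      (use interior_subset[of "\<tau> j"] c in \<open>auto simp: sum_distrib_left mult.left_commute\<close>)
  also have "\<dots> = (\<Sum>q\<in>Q. c q * (LINT y:T j|lebesgue. v y * P j q y))"
    by (subst set_lint_sum(1)) (use i in simp_all)
  finally show ?thesis using that c by blast
qed

lemma \<psi>_orthogonal:
  assumes i: "i \<in> I" "q \<in> Q" and j: "j \<in> I" "j \<noteq> i" and p: "p \<in> polys (k - 1)"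
  shows "(LINT y:T j|lebesgue. \<psi> i q y * p y) = 0"
proof -
  obtain c where "(LINT y:T j|lebesgue. \<psi> i q y * p y) = (\<Sum>q'\<in>Q. c q' * (LINT y:T j|lebesgue. \<psi> i q y * P j q' y))"
    using moment_poly[OF j(1) p H0_sq[OF \<psi>_facts(1)[OF i]]] by blast
  also have "\<dots> = 0" using \<psi>_facts(2)[OF i j(1)] j(2) by (intro sum.neutral) auto
  finally show ?thesis .
qed

section \<open>Element seminorms and the constants of the two estimates\<close>

definition N where "N p j u = sqrt (\<Sum>\<sigma>\<in>multiindices p. LINT y:T j|lebesgue. (W u \<sigma> y)\<^sup>2)"

lemma seminorm_eq:
  assumes "j \<in> I" shows "sobolev_seminorm D p (\<tau> j) u = N p j u"
  unfolding sobolev_seminorm_def N_def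
  by (intro arg_cong[where f = sqrt] sum.cong refl set_integral_cong_AE_sets(1))
    (use \<tau>_AE[OF assms] in eventually_elim, auto)

lemma N_nonneg: "0 \<le> N p j u"
  by (simp add: N_def sum_nonneg sqint_nonneg)

text \<open>On an element other than \<open>i\<close> all moments of \<open>\<psi> i q\<close>
  vanish, so its projection is 0 and the projection estimate applies to the function itself.\<close>

lemma projection_le:
  assumes i: "i \<in> I" "q \<in> Q" and j: "j \<in> I" "j \<noteq> i" and p: "p \<le> k"
  shows "N p j (\<psi> i q) \<le> Cp * h j ^ (k - p) * N k j (\<psi> i q)"
proof -
  have "is_L2_projection (k - 1) (\<tau> j) (\<psi> i q) (\<lambda>y. 0)"
    unfolding is_L2_projection_def
  proof (intro conjI ballI polys_const)
    fix g :: "real^'n \<Rightarrow> real" assume g: "g \<in> polys (k - 1)"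
    have "(LINT y:\<tau> j|lebesgue. (\<psi> i q y - 0) * g y) = (LINT y:T j|lebesgue. \<psi> i q y * g y)"
      by (rule set_integral_cong_AE_sets(1)) (use \<tau>_AE[OF j(1)] in eventually_elim, auto)
    then show "(LINT y:\<tau> j|lebesgue. (\<psi> i q y - 0) * g y) = 0" using \<psi>_orthogonal[OF i j g] by simp
  qed
  then have "sobolev_seminorm D p (\<tau> j) (\<lambda>y. \<psi> i q y - 0) \<le> Cp * h j ^ (k - p) * sobolev_seminorm D k (\<tau> j) (\<psi> i q)"
    using proj sobolev_0_imp[OF \<psi>_facts(1)[OF i]] j(1) p unfolding projection_constant_def by blast
  then show ?thesis by (simp add: seminorm_eq[OF j(1)])
qed

text \<open>On its own element the projection of \<open>\<psi> i q\<close> is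
  \<open>\<phi> i q\<close> divided by the measure of the element. The estimate of order 0 bounds a
  nonnegative seminorm by \<open>Cp\<close> times a positive number.\<close>

lemma Cp_nonneg_center:
  assumes i: "i \<in> I" "q \<in> Q" and pos: "N k i (\<psi> i q) > 0"
  shows "0 \<le> Cp"
proof -
  let ?V = "measure lebesgue (\<tau> i)"
  let ?p = "\<lambda>y. (1 / ?V) * P i q y"
  have "?V > 0"
  proof -
    have "T i \<in> lmeasurable" "\<tau> i \<in> lmeasurable"
      using \<tau>_facts[OF i(1)] by (auto simp: lmeasurable_open lmeasurable_compact)
    then have "measure lebesgue (T i) \<le> ?V" using interior_subset by (intro measure_mono_fmeasurable) (auto dest: fmeasurableD)
    moreover have "0 < measure lebesgue (T i)"
      using sq_int_pos[OF \<tau>_facts(4,5)[OF i(1)] T_nonempty[OF i(1)]] \<open>T i \<in> lmeasurable\<close>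
      by (simp add: set_lebesgue_integral_def fmeasurableD)
    ultimately show ?thesis by simp
  qed
  note V = this
  have p: "?p \<in> polys (k - 1)" using polys_lincomb[OF P(1)[OF i] P(1)[OF i], of "1 / ?V" 0] by simp
  note u = \<psi>_facts(1)[OF i]
  have diff: "(LINT y:T i|lebesgue. (\<psi> i q y - ?p y) * P i q' y) = 0" if q': "q' \<in> Q" for q'
  proof -
    have "(LINT y:T i|lebesgue. (\<psi> i q y - ?p y) * P i q' y)
       = (LINT y:T i|lebesgue. \<psi> i q y * P i q' y - (1 / ?V) * (P i q y * P i q' y))"
      by (simp add: algebra_simps)
    also have "\<dots> = (LINT y:T i|lebesgue. \<psi> i q y * P i q' y) - (1 / ?V) * (LINT y:T i|lebesgue. P i q y * P i q' y)"
      using set_integral_diff(2)[OF sq_mult_integrable[OF sq_T[OF H0_sq[OF u] i(1)] poly_sq[OF i(1) P(1)[OF i(1) q']]]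
          set_integrable_mult_right[OF sq_mult_integrable[OF poly_sq[OF i(1) P(1)[OF i]] poly_sq[OF i(1) P(1)[OF i(1) q']]], of "1 / ?V"]]
      by simp
    also have "(LINT y:T i|lebesgue. P i q y * P i q' y) = (LINT y:\<tau> i|lebesgue. \<phi> i q y * \<phi> i q' y)"
      by (rule set_integral_cong_AE_sets(1))
        (use \<tau>_AE[OF i(1)] in eventually_elim, auto simp: P(2)[OF i] P(2)[OF i(1) q'])
    also have "\<dots> = (if q = q' then ?V else 0)"
      using basis i q' unfolding local_poly_basis_def Let_def nQ by blast
    finally show ?thesis using \<psi>_facts(2)[OF i i(1) q'] V by auto
  qed
  have sqd: "square_integrable_on D (\<lambda>y. \<psi> i q y - ?p y)"
    by (rule sq_diff[OF H0_sq[OF u] sq_continuous[OF polys_continuous[OF p] D(2) D_sets]])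
  have "is_L2_projection (k - 1) (\<tau> i) (\<psi> i q) ?p"
    unfolding is_L2_projection_def
  proof (intro conjI ballI p)
    fix g :: "real^'n \<Rightarrow> real" assume g: "g \<in> polys (k - 1)"
    obtain c where c: "(LINT y:T i|lebesgue. (\<psi> i q y - ?p y) * g y) = (\<Sum>q'\<in>Q. c q' * (LINT y:T i|lebesgue. (\<psi> i q y - ?p y) * P i q' y))"
      using moment_poly[OF i(1) g sqd] by blast
    have "(LINT y:\<tau> i|lebesgue. (\<psi> i q y - ?p y) * g y) = (LINT y:T i|lebesgue. (\<psi> i q y - ?p y) * g y)"
      by (rule set_integral_cong_AE_sets(1)) (use \<tau>_AE[OF i(1)] in eventually_elim, auto)
    also have "\<dots> = 0" unfolding c using diff by (intro sum.neutral) auto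
    finally show "(LINT y:\<tau> i|lebesgue. (\<psi> i q y - ?p y) * g y) = 0" .
  qed
  then have "sobolev_seminorm D 0 (\<tau> i) (\<lambda>y. \<psi> i q y - ?p y) \<le> Cp * h i ^ (k - 0) * sobolev_seminorm D k (\<tau> i) (\<psi> i q)"
    using proj sobolev_0_imp[OF u] i(1) unfolding projection_constant_def by blast
  then have "0 \<le> Cp * (h i ^ k * N k i (\<psi> i q))"
    using N_nonneg[of 0 i "\<lambda>y. \<psi> i q y - ?p y"] by (simp add: seminorm_eq[OF i(1)] mult.assoc)
  moreover have "0 < h i ^ k * N k i (\<psi> i q)" using pos \<tau>_facts(7)[OF i(1)] by simp
  ultimately show ?thesis by (simp add: zero_le_mult_iff)
qed

text \<open>The projection estimate of order k bounds the seminorm by \<open>Cp\<close> times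
  itself.\<close>

lemma Cp_ge_1:
  assumes i: "i \<in> I" "q \<in> Q" and j: "j \<in> I" "j \<noteq> i" and pos: "N k j (\<psi> i q) > 0"
  shows "1 \<le> Cp"
  using projection_le[OF i j order_refl] pos by simp

lemma N_energy: "i \<in> I \<Longrightarrow> q \<in> Q \<Longrightarrow> j \<in> I \<Longrightarrow> N k j (\<psi> i q) \<le> sqrt (E (T j) (W (\<psi> i q)) (W (\<psi> i q)) / \<theta>min)"
  using E_bounds(1)[OF \<tau>_facts(6,2) sqf_T[OF W_sqf[OF \<psi>_facts(1)]]] min0
  unfolding N_def by (intro real_sqrt_le_mono) (simp add: pos_le_divide_eq mult.commute)

lemma inverse_estimate:
  assumes j: "j \<in> I" and w: "w \<in> sobolev_space_0 k (T j)" and p: "p \<in> polys (k - 1)"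
    and eq: "weak_polyharmonic_eq k (T j) w p"
  shows "sqrt (LINT y:T j|lebesgue. (p y)\<^sup>2) \<le> C / h j ^ k * sobolev_seminorm (T j) k (T j) w"
proof -
  have "diameter (T j) \<le> h j"
    using compact_imp_bounded[OF \<tau>_facts(1)[OF j]] by (intro diameter_subset interior_subset)
  moreover have "ball (x j) (\<delta> * h j / 2) \<subseteq> T j"
    using centers[OF j] by (intro interior_maximal) auto
  ultimately show ?thesis
    using inv w p eq \<tau>_facts[OF j] unfolding inverse_estimate_constant_def by blast
qed

text \<open>The inverse estimate is applied to the solution with right-hand side 1, whose norm on
  the left is positive.\<close>

lemma C_pos: "I \<noteq> {} \<Longrightarrow> 0 < C"
proof -
  assume "I \<noteq> {}"
  then obtain j where j: "j \<in> I" by blast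
  note T = \<tau>_facts(4,5)[OF j]
  obtain w where w: "w \<in> sobolev_space_0 k (T j)" "weak_polyharmonic_eq k (T j) w (\<lambda>y. 1)"
    using polyharmonic_solution[OF T poly_sq[OF j polys_const], of k 1] by metis
  have "0 < sqrt (LINT y:T j|lebesgue. (1::real)\<^sup>2)" using sq_int_pos[OF T T_nonempty[OF j]] by simp
  also have "\<dots> \<le> C / h j ^ k * sobolev_seminorm (T j) k (T j) w"
    by (rule inverse_estimate[OF j w(1) polys_const w(2)])
  finally have "0 < C * (sobolev_seminorm (T j) k (T j) w / h j ^ k)" by simp
  moreover have "0 \<le> sobolev_seminorm (T j) k (T j) w / h j ^ k"
    using \<tau>_facts(7)[OF j] by (simp add: sobolev_seminorm_def sum_nonneg sqint_nonneg)
  ultimately show ?thesis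
    using mult_nonpos_nonneg[of C "sobolev_seminorm (T j) k (T j) w / h j ^ k"] by argo
qed

text \<open>The approximants \<xi> of the auxiliary solution are compactly supported in the element,
  so they are admissible in both the Euler-Lagrange identity on D and the equation on the element.
  The bound on the energy of the solution is the limit of what these tests give.\<close>

lemma poly_estimate:
  assumes i: "i \<in> I" "q \<in> Q" and j: "j \<in> I"
  shows "sqrt (LINT y:T j|lebesgue. (pj (\<psi> i q) j y)\<^sup>2) \<le> C / h j ^ k * (sqrt \<theta>max * sqrt (E (T j) (W (\<psi> i q)) (W (\<psi> i q))))"
proof -
  let ?u = "\<psi> i q" and ?p = "pj (\<psi> i q) j"
  let ?e = "sqrt (E (T j) (W ?u) (W ?u))"
  note T = \<tau>_facts[OF j] and u = \<psi>_facts(1)[OF i] and p = pj_poly[OF j, of ?u]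
  note up = sqf_T[OF W_sqf[OF u] j]
  obtain w \<xi> where w: "w \<in> sobolev_space_0 k (T j)" "weak_polyharmonic_eq k (T j) w ?p"
    "\<And>n. \<xi> n \<in> test_functions (T j)" "l2conv (T j) \<xi> w"
    "\<And>\<sigma>. mi_order \<sigma> \<le> k \<Longrightarrow> l2conv (T j) (\<lambda>n. mi_deriv \<sigma> (\<xi> n)) (weak_deriv (T j) \<sigma> w)"
    by (rule polyharmonic_solution[OF T(4,5) poly_sq[OF j p], of k]) blast
  define G where "G = (\<Sum>\<sigma>\<in>MI. LINT y:T j|lebesgue. (weak_deriv (T j) \<sigma> w y)\<^sup>2)"
  define Gn where "Gn n = (\<Sum>\<sigma>\<in>MI. LINT y:T j|lebesgue. (mi_deriv \<sigma> (\<xi> n) y)\<^sup>2)" for n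
  define Mn where "Mn n = (LINT y:T j|lebesgue. ?p y * \<xi> n y)" for n
  have order: "mi_order \<sigma> \<le> k" if "\<sigma> \<in> MI" for \<sigma> using that by (simp add: multiindices_def)
  have "Gn \<longlonglongrightarrow> G"
    unfolding Gn_def[abs_def] G_def power2_eq_square
    by (intro tendsto_sum l2conv_inner w(5) order)
  \<comment> \<open>Testing the equation of \<open>w\<close> with its own approximants rewrites
    \<open>Mn\<close> as a pairing of derivatives, whose limit is the squared seminorm of
    \<open>w\<close>.\<close>
  have "Mn \<longlonglongrightarrow> G"
  proof -
    have "(\<lambda>n. \<Sum>\<sigma>\<in>MI. LINT y:T j|lebesgue. mi_deriv \<sigma> (\<xi> n) y * weak_deriv (T j) \<sigma> w y) \<longlonglongrightarrow> G"
      unfolding G_def power2_eq_square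
      by (intro tendsto_sum l2conv_inner1 w(5) order l2convD(2)[OF w(5)])
    moreover have "(\<Sum>\<sigma>\<in>MI. LINT y:T j|lebesgue. mi_deriv \<sigma> (\<xi> n) y * weak_deriv (T j) \<sigma> w y) = Mn n" for n
      using w(2,3) unfolding weak_polyharmonic_eq_def Mn_def by (simp add: mult.commute)
    ultimately show ?thesis by simp
  qed
  have Mle: "Mn n \<le> ?e * sqrt (\<theta>max * Gn n)" for n
  proof -
    \<comment> \<open>Compact support inside the element makes extension by zero immediate, and both
      sides of the identity on D reduce to the single element \<open>j\<close>.\<close>
    have t: "\<xi> n \<in> test_functions D" by (rule test_function_mono[OF w(3) T(2)])
    let ?V = "\<lambda>\<sigma>. mi_deriv \<sigma> (\<xi> n)"
    have v: "\<xi> n \<in> sobolev_space_0 k D" by (rule test_function_sobolev_space_0(1)[OF D(1) t])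
    have Vae: "AE y in lebesgue. y \<in> D \<longrightarrow> W (\<xi> n) \<sigma> y = ?V \<sigma> y" for \<sigma>
      by (rule test_function_sobolev_space_0(2)[OF D(1) t])
    have VD: "sqf D ?V"
      by (auto simp: sqf_def intro: sq_test_function[OF D_sets test_function_mi_deriv[OF t]])
    have zero: "\<xi> n y = 0" "?V \<sigma> y = 0" if "y \<notin> T j" for y \<sigma>
      using test_function_outside[OF w(3) that] test_function_outside[OF test_function_mi_deriv[OF w(3)] that] by auto
    have T0: "y \<notin> T j" if "j' \<in> I" "j' \<noteq> j" "y \<in> T j'" for y j'
      using T_disjoint[OF that(1) j that(2)] that(3) by blast
    have "bilinear_form k D a ?u (\<xi> n) = Es D (W ?u) (W (\<xi> n))" by (rule bilinear_eq_Es[OF u v])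
    also have "\<dots> = Es D (W ?u) ?V"
      unfolding Es_def using Vae by (intro arg_cong2[where f = "\<lambda>s t. (s + t) / 2"] energy_form_cong_AE) auto
    also have "\<dots> = (\<Sum>j'\<in>I. if j' = j then Es (T j) (W ?u) ?V else 0)"
      unfolding Es_split[OF W_sqf[OF u] VD]
    proof (rule sum.cong[OF refl])
      fix j' assume j': "j' \<in> I"
      show "Es (T j') (W ?u) ?V = (if j' = j then Es (T j) (W ?u) ?V else 0)"
      proof (cases "j' = j")
        case False
        have "E (T j') (W ?u) ?V = E (T j') (W ?u) (\<lambda>\<sigma> y. 0)" "E (T j') ?V (W ?u) = E (T j') (\<lambda>\<sigma> y. 0) (W ?u)"
          using zero(2)[OF T0[OF j' False]] by (auto intro!: energy_form_cong_AE)
        then show ?thesis using False by (simp add: Es_def energy_form_def set_lebesgue_integral_def)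
      qed simp
    qed
    also have "\<dots> = Es (T j) (W ?u) ?V" using j by simp
    finally have 1: "bilinear_form k D a ?u (\<xi> n) = Es (T j) (W ?u) ?V" .
    have "bilinear_form k D a ?u (\<xi> n) = (\<Sum>j'\<in>I. LINT y:T j'|lebesgue. \<xi> n y * pj ?u j' y)"
      by (rule euler_lagrange[OF i v])
    also have "\<dots> = (\<Sum>j'\<in>I. if j' = j then Mn n else 0)"
    proof (rule sum.cong[OF refl])
      fix j' assume j': "j' \<in> I"
      show "(LINT y:T j'|lebesgue. \<xi> n y * pj ?u j' y) = (if j' = j then Mn n else 0)"
      proof (cases "j' = j")
        case False
        have "(LINT y:T j'|lebesgue. \<xi> n y * pj ?u j' y) = (LINT y:T j'|lebesgue. 0)"
          by (rule set_integral_cong_AE_sets(1), rule AE_I2) (use zero(1)[OF T0[OF j' False]] in auto)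
        then show ?thesis using False by (simp add: set_lebesgue_integral_def)
      qed (simp add: Mn_def mult.commute)
    qed
    also have "\<dots> = Mn n" using j by simp
    finally have "Mn n = Es (T j) (W ?u) ?V" using 1 by simp
    also have "\<dots> \<le> ?e * sqrt (E (T j) ?V ?V)"
      using Es_Cauchy_Schwarz[OF T(6,2) up sqf_T[OF VD j]] by linarith
    also have "\<dots> \<le> ?e * sqrt (\<theta>max * Gn n)"
      using E_bounds(2)[OF T(6,2) sqf_T[OF VD j]] E_bounds(3)[OF T(6,2) up]
      by (intro mult_left_mono real_sqrt_le_mono) (auto simp: Gn_def)
    finally show ?thesis .
  qed
  have "(\<lambda>n. ?e * sqrt (\<theta>max * Gn n)) \<longlonglongrightarrow> ?e * sqrt (\<theta>max * G)"
    by (intro tendsto_intros \<open>Gn \<longlonglongrightarrow> G\<close>)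
  then have "G \<le> ?e * sqrt (\<theta>max * G)"
    by (rule LIMSEQ_le[OF \<open>Mn \<longlonglongrightarrow> G\<close>]) (use Mle in auto)
  moreover have G0: "0 \<le> G" by (simp add: G_def sum_nonneg sqint_nonneg)
  ultimately have le: "sqrt G * sqrt G \<le> (sqrt \<theta>max * ?e) * sqrt G"
    by (simp add: real_sqrt_mult mult.commute mult.left_commute)
  have nn: "0 \<le> sqrt \<theta>max * ?e" using max0 E_bounds(3)[OF T(6,2) up] by simp
  have G1: "sqrt G \<le> sqrt \<theta>max * ?e"
  \<comment> \<open>Dividing by the root of G requires G to be positive; for G = 0 the bound is
    trivial.\<close>
  proof (cases "G = 0")
    case False
    then have "0 < sqrt G" using G0 by simp
    then show ?thesis by (rule mult_right_le_imp_le[OF le])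
  qed (use nn in simp)
  have "sqrt (LINT y:T j|lebesgue. (?p y)\<^sup>2) \<le> C / h j ^ k * sqrt G"
    using inverse_estimate[OF j w(1) p w(2)] by (simp add: G_def sobolev_seminorm_def)
  also have "\<dots> \<le> C / h j ^ k * (sqrt \<theta>max * ?e)"
    using C_pos j T(7) G1 by (intro mult_left_mono) auto
  finally show ?thesis .
qed

end

section \<open>Exponential decay\<close>

lemma length_splits: "length (splits is) = 2 ^ length is"
  by (induction "is") auto

text \<open>Expanding the derivative in coordinates bounds its operator norm by the number of
  coordinates times \<open>B\<close>, which is the source of \<open>CARD('n)\<close> in
  \<open>K1\<close>.\<close>

lemma smooth_Lipschitz:
  fixes \<eta> :: "real^'n::finite \<Rightarrow> real"
  assumes \<eta>: "smooth \<eta>" and B: "\<And>i y. \<bar>partial_deriv i \<eta> y\<bar> \<le> B"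
  shows "\<bar>\<eta> y - \<eta> z\<bar> \<le> real CARD('n) * B * dist y z"
proof -
  have B0: "0 \<le> B" using B[of undefined undefined] by linarith
  have der: "(\<eta> has_derivative frechet_derivative \<eta> (at u)) (at u)" for u
    using smooth_diffable[OF \<eta>] diffableD by blast
  have "onorm (frechet_derivative \<eta> (at u)) \<le> real CARD('n) * B" for u
  proof (rule onorm_le)
    fix v :: "real^'n"
    let ?f = "frechet_derivative \<eta> (at u)"
    have lin: "linear ?f" by (rule has_derivative_linear[OF der])
    have "v = (\<Sum>i\<in>UNIV. (v $ i) *\<^sub>R axis i 1)"
      using basis_expansion[of v] by (simp add: scalar_mult_eq_scaleR)
    then have "?f v = (\<Sum>i\<in>UNIV. (v $ i) * partial_deriv i \<eta> u)"
      using linear_sum[OF lin, of "\<lambda>i. (v $ i) *\<^sub>R axis i 1" UNIV] linear_scale[OF lin] by (simp add: partial_deriv_def)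
    also have "norm \<dots> \<le> (\<Sum>i\<in>(UNIV::'n set). norm v * B)"
      using component_le_norm_cart[of v] B
      by (intro sum_norm_le) (auto simp: abs_mult intro!: mult_mono)
    finally show "norm (?f v) \<le> real CARD('n) * B * norm v" by (simp add: mult.commute mult.left_commute)
  qed
  then have "norm (\<eta> y - \<eta> z) \<le> real CARD('n) * B * norm (y - z)"
    using der by (intro differentiable_bound[of UNIV]) auto
  then show ?thesis by (simp add: dist_norm)
qed

lemma set_lint_mono_set:
  fixes f :: "'a \<Rightarrow> real"
  assumes f: "set_integrable M B f" and A: "A \<in> sets M" "A \<subseteq> B" and nn: "\<And>y. y \<in> B \<Longrightarrow> 0 \<le> f y"
  shows "(LINT y:A|M. f y) \<le> (LINT y:B|M. f y)"
  unfolding set_lebesgue_integral_def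
proof (rule integral_mono)
  show "integrable M (\<lambda>y. indicator A y *\<^sub>R f y)" "integrable M (\<lambda>y. indicator B y *\<^sub>R f y)"
    using set_integrable_subset[OF f A] f by (simp_all add: set_integrable_def)
  show "indicator A y *\<^sub>R f y \<le> indicator B y *\<^sub>R f y" for y
    using A(2) nn[of y] by (auto split: split_indicator)
qed

context partition_form
begin

definition hm where "hm = mesh_size m \<tau>"

lemma I_nonempty: "I \<noteq> {}"
proof
  assume I: "I = {}"
  have "(\<Union>j\<in>I. \<tau> j) = closure D" using part unfolding partition_of_def by blast
  then show False using D(3) closure_subset[of D] unfolding I by auto
qed

lemma h_le_hm: "j \<in> I \<Longrightarrow> h j \<le> hm"
  unfolding hm_def mesh_size_def by (rule Max_ge) auto

lemma hm_pos: "0 < hm"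
  using I_nonempty h_le_hm \<tau>_facts(7) less_le_trans by (metis all_not_in_conv)

lemma dist_le_hm: "j \<in> I \<Longrightarrow> y \<in> \<tau> j \<Longrightarrow> z \<in> \<tau> j \<Longrightarrow> dist y z \<le> h j"
  using diameter_bounded_bound compact_imp_bounded \<tau>_facts(1) by blast

text \<open>The first summand counts the commutator terms, at most 2^k for each multi-index; the
  second is the Lipschitz factor of the cutoff.\<close>

definition K1 :: "real \<Rightarrow> real" where "K1 K = K * (real (card MI) * 2 ^ k + real CARD('n))"

text \<open>The transition of width \<open>H\<close> is flanked by two layers of width
  \<open>hm\<close>. No element is wider than a layer, so one that meets the ball of radius R or
  leaves the ball of radius R + 2 hm + H sees a constant cutoff. The condition
  \<open>hm \<le> H\<close> lets every derivative of the cutoff pay at least one factor hm /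
  H.\<close>

lemma decay_step:
  fixes R H K :: real
  assumes i: "i \<in> I" "q \<in> Q" and R: "0 \<le> R" and H: "hm \<le> H" and K: "K > 0" and k1: "k \<ge> 1" and Cp: "0 \<le> Cp"
    and \<eta>: "smooth \<eta>" "\<And>y. 0 \<le> \<eta> y" "\<And>y. \<eta> y \<le> 1"
    and \<eta>0: "\<And>y. dist y (x i) \<le> R + hm \<Longrightarrow> \<eta> y = 0"
    and \<eta>1: "\<And>y. dist y (x i) \<ge> R + hm + H \<Longrightarrow> \<eta> y = 1"
    and \<eta>d: "\<And>is y. is \<noteq> [] \<Longrightarrow> length is \<le> k \<Longrightarrow> \<bar>pderivs is \<eta> y\<bar> \<le> K / H ^ length is"
  defines "U \<equiv> W (\<psi> i q)" and "Eo \<equiv> \<lambda>r. E (D \<inter> - ball (x i) r) (W (\<psi> i q)) (W (\<psi> i q))"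
  shows "Eo (R + 2 * hm + H) \<le> K1 K * (hm / H) * Cp * (1 + C) * sqrt (\<theta>max / \<theta>min) * (Eo R - Eo (R + 2 * hm + H))"
proof -
  let ?u = "\<psi> i q" and ?\<rho> = "sqrt (\<theta>max / \<theta>min)"
  let ?R3 = "R + 2 * hm + H"
  let ?p = "\<lambda>j. pj ?u j"
  have H0: "0 < H" using hm_pos H by linarith
  have C0: "0 < C" by (rule C_pos[OF I_nonempty])
  note u = \<psi>_facts(1)[OF i]
  have U: "sqf D U" unfolding U_def by (rule W_sqf[OF u])
  have Usq: "square_integrable_on D (U \<sigma>)" if "mi_order \<sigma> \<le> k" for \<sigma>
    unfolding U_def by (rule W_sq[OF u that])
  define ss where "ss \<sigma> = butlast (splits (mi_list \<sigma>))" for \<sigma> :: "'n multiindex"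
  \<comment> \<open>The commutator: D^\<sigma>(\<eta> \<psi>) minus \<eta> D^\<sigma> \<psi>, as
    \<open>butlast\<close> has removed the term with undifferentiated cutoff.\<close>
  define Rf where "Rf \<sigma> y = (\<Sum>c\<leftarrow>ss \<sigma>. pderivs (fst c) \<eta> y * U (count_list (snd c)) y)" for \<sigma> y
  have splits_ss: "splits (mi_list \<sigma>) = ss \<sigma> @ [([], mi_list \<sigma>)]"
    and ss_len: "c \<in> set (ss \<sigma>) \<Longrightarrow> fst c \<noteq> [] \<and> length (fst c) + length (snd c) = mi_order \<sigma>" for \<sigma> c
  proof -
    obtain ss' where "splits (mi_list \<sigma>) = ss' @ [([], mi_list \<sigma>)]"
      "\<forall>c\<in>set ss'. fst c \<noteq> [] \<and> length (fst c) + length (snd c) = length (mi_list \<sigma>)"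
      using splits_head[of "mi_list \<sigma>"] by (auto simp: case_prod_beta)
    then show "splits (mi_list \<sigma>) = ss \<sigma> @ [([], mi_list \<sigma>)]"
      "c \<in> set (ss \<sigma>) \<Longrightarrow> fst c \<noteq> [] \<and> length (fst c) + length (snd c) = mi_order \<sigma>"
      by (simp_all add: ss_def length_mi_list)
  qed
  have card_ss: "length (ss \<sigma>) \<le> 2 ^ k" if "\<sigma> \<in> MI" for \<sigma>
    using that by (simp add: ss_def length_splits length_mi_list multiindices_def)
  have meas: "set_borel_measurable lebesgue S (\<lambda>y. pderivs is \<eta> y - c)" if "S \<in> sets lebesgue" for S "is" c
  proof -
    have "(\<lambda>y. pderivs is \<eta> y - c) \<in> borel_measurable lebesgue"
      using smooth_measurable[OF smooth_diff[OF smooth_pderivs[OF \<eta>(1)] smooth_const]] by (intro measurable_completion) simp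
    from borel_measurable_times[OF borel_measurable_indicator[OF that] this]
    show ?thesis by (simp add: set_borel_measurable_def)
  qed
  have bd0: "\<bar>pderivs [] \<eta> y\<bar> \<le> 1" for y using \<eta>(2,3)[of y] by simp
  have bdd: "\<exists>B. \<forall>y. \<bar>pderivs is \<eta> y\<bar> \<le> B" if "length is \<le> k" for "is"
    using \<eta>d[OF _ that] bd0 by (cases "is = []") blast+
  have prod_sq: "square_integrable_on S (\<lambda>y. pderivs is \<eta> y * f y)"
    and prod_le: "(LINT y:S|lebesgue. (pderivs is \<eta> y * f y)\<^sup>2) \<le> B\<^sup>2 * (LINT y:S|lebesgue. (f y)\<^sup>2)"
    if "S \<in> sets lebesgue" "square_integrable_on S f" "\<And>y. \<bar>pderivs is \<eta> y\<bar> \<le> B" for S "is" f B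
    using sq_bounded_mult[OF that(2) meas[OF that(1), of "is" 0], of B] that(3) by auto
  have Rf_sq: "square_integrable_on D (Rf \<sigma>)" if \<sigma>: "\<sigma> \<in> MI" for \<sigma>
    unfolding Rf_def[abs_def]
  proof (rule sq_Minkowski_list(1))
    fix c assume "c \<in> set (ss \<sigma>)"
    then have "fst c \<noteq> []" "length (fst c) \<le> k" "length (snd c) \<le> k"
      using ss_len[of c \<sigma>] \<sigma> by (auto simp: multiindices_def)
    then show "square_integrable_on D (\<lambda>y. pderivs (fst c) \<eta> y * U (count_list (snd c)) y)"
      by (intro prod_sq[OF D_sets Usq \<eta>d]) (auto simp: mi_order_count_list)
  qed
  have Rf: "sqf D Rf" using Rf_sq by (simp add: sqf_def)
  have \<eta>U: "sqf D (\<lambda>\<sigma> y. \<eta> y * U \<sigma> y)"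
    using prod_sq[OF D_sets _ bd0] U by (simp add: sqf_def)
  note v = sobolev_space_0_smooth_mult[OF D(1) u \<eta>(1) bdd]
  let ?v = "\<lambda>y. \<eta> y * ?u y"
  have v0: "?v \<in> sobolev_space_0 k D" by (rule v(1))
  have Vae: "AE y in lebesgue. y \<in> D \<longrightarrow> W ?v \<sigma> y = \<eta> y * U \<sigma> y + Rf \<sigma> y" if \<sigma>: "\<sigma> \<in> MI" for \<sigma>
  proof -
    have "AE y in lebesgue. y \<in> D \<longrightarrow> W ?v \<sigma> y
        = (\<Sum>(a, b)\<leftarrow>splits (mi_list \<sigma>). pderivs a \<eta> y * W ?u (count_list b) y)"
      by (rule v(2)) (use \<sigma> in \<open>simp_all add: multiindices_def\<close>)
    then show ?thesis
      by eventually_elim (simp add: splits_ss Rf_def U_def count_mi_list case_prod_beta')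
  qed
  \<comment> \<open>The share of element \<open>j\<close> once the \<eta>-weighted energy is
    isolated: the multiplier term minus the commutator term.\<close>
  define X where "X j = (LINT y:T j|lebesgue. ?v y * ?p j y) - Es (T j) U Rf" for j
  have main: "(LINT y:D|lebesgue. \<eta> y * dens U y) = (\<Sum>j\<in>I. X j)"
  proof -
    have "(\<Sum>j\<in>I. LINT y:T j|lebesgue. ?v y * ?p j y) = bilinear_form k D a ?u ?v"
      by (rule euler_lagrange[OF i v0, symmetric])
    also have "\<dots> = Es D U (W ?v)" unfolding U_def by (rule bilinear_eq_Es[OF u v0])
    also have "\<dots> = Es D U (\<lambda>\<sigma> y. \<eta> y * U \<sigma> y + Rf \<sigma> y)"
      unfolding Es_def using Vae by (intro arg_cong2[where f = "\<lambda>s t. (s + t) / 2"] energy_form_cong_AE) auto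
    also have "\<dots> = Es D U (\<lambda>\<sigma> y. \<eta> y * U \<sigma> y) + Es D U Rf"
      by (rule Es_add_right[OF D_sets order_refl U \<eta>U Rf])
    also have "Es D U (\<lambda>\<sigma> y. \<eta> y * U \<sigma> y) = (LINT y:D|lebesgue. \<eta> y * dens U y)"
      by (rule Es_mult(1)[OF D_sets order_refl U \<eta>U])
    also have "Es D U Rf = (\<Sum>j\<in>I. Es (T j) U Rf)" by (rule Es_split[OF U Rf])
    finally show ?thesis by (simp add: X_def sum_subtractf)
  qed
  \<comment> \<open>The elements that lie wholly in the annulus; only they can contribute. The
    central element is excluded since orthogonality fails on it.\<close>
  define J where "J = {j \<in> I. j \<noteq> i \<and> (\<forall>y\<in>\<tau> j. R \<le> dist y (x i) \<and> dist y (x i) < ?R3)}"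
  have const: "\<exists>c. (\<forall>y\<in>\<tau> j. \<eta> y = c) \<and> (c = 0 \<or> c = 1 \<and> j \<noteq> i)" if j: "j \<in> I" "j \<notin> J" for j
  proof (cases "j = i")
    case True
    have "\<eta> y = 0" if "y \<in> \<tau> j" for y
    proof (rule \<eta>0)
      have "dist y (x i) \<le> h i" using that True centers[OF i(1)] by (intro dist_le_hm[OF i(1)]) auto
      then show "dist y (x i) \<le> R + hm" using h_le_hm[OF i(1)] R by linarith
    qed
    then show ?thesis by blast
  next
    case False
    then obtain z where z: "z \<in> \<tau> j" "\<not> (R \<le> dist z (x i) \<and> dist z (x i) < ?R3)" using j by (auto simp: J_def)
    have d: "\<bar>dist y (x i) - dist z (x i)\<bar> \<le> hm" if "y \<in> \<tau> j" for y
      using dist_le_hm[OF j(1) that z(1)] h_le_hm[OF j(1)] abs_dist_diff_le[of y "x i" z]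
      by (simp add: dist_commute)
    show ?thesis
    proof (cases "R \<le> dist z (x i)")
      case True
      then have "\<eta> y = 1" if "y \<in> \<tau> j" for y using z(2) d[OF that] by (intro \<eta>1) linarith
      then show ?thesis using False by blast
    next
      case z': False
      then have "\<eta> y = 0" if "y \<in> \<tau> j" for y using d[OF that] by (intro \<eta>0) linarith
      then show ?thesis by blast
    qed
  qed
  \<comment> \<open>On a constant cutoff the commutator vanishes, and the multiplier term vanishes
    by orthogonality, or because the constant is 0 on the central element.\<close>
  have X0: "X j = 0" if j: "j \<in> I" "j \<notin> J" for j
  proof -
    obtain c where c: "\<And>y. y \<in> \<tau> j \<Longrightarrow> \<eta> y = c" "c = 0 \<or> c = 1 \<and> j \<noteq> i" using const[OF j] by blast
    have cT: "\<eta> y = c" if "y \<in> T j" for y using c(1) that interior_subset by blast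
    have "Rf \<sigma> y = 0" if y: "y \<in> T j" for \<sigma> y
    proof -
      have "pderivs (fst e) \<eta> y = 0" if "e \<in> set (ss \<sigma>)" for e
        using ss_len[OF that] by (intro pderivs_locally_const[OF open_interior cT y]) auto
      then have "map (\<lambda>e. pderivs (fst e) \<eta> y * U (count_list (snd e)) y) (ss \<sigma>) = map (\<lambda>e. 0) (ss \<sigma>)" by simp
      then have "Rf \<sigma> y = sum_list (map (\<lambda>e. 0) (ss \<sigma>))" unfolding Rf_def by (rule arg_cong)
      then show ?thesis by simp
    qed
    then have "Es (T j) U Rf = Es (T j) U (\<lambda>\<sigma> y. 0)"
      unfolding Es_def by (intro arg_cong2[where f = "\<lambda>s t. (s + t) / 2"] energy_form_cong_AE) auto
    then have e: "Es (T j) U Rf = 0" by (simp add: Es_def energy_form_def set_lebesgue_integral_def)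
    have "(LINT y:T j|lebesgue. ?v y * ?p j y) = (LINT y:T j|lebesgue. c * (?u y * ?p j y))"
      by (rule set_integral_cong_AE_sets(1), rule AE_I2) (auto simp: cT)
    also have "\<dots> = c * (LINT y:T j|lebesgue. ?u y * ?p j y)" by simp
    also have "\<dots> = 0" using c(2) \<psi>_orthogonal[OF i j(1) _ pj_poly[OF j(1)]] by auto
    finally show ?thesis using e by (simp add: X_def)
  qed
  have XJ: "X j \<le> K1 K * (hm / H) * Cp * (1 + C) * ?\<rho> * E (T j) U U" if jJ: "j \<in> J" for j
  proof -
    have j: "j \<in> I" "j \<noteq> i" using jJ by (auto simp: J_def)
    note Tj = \<tau>_facts[OF j(1)]
    let ?Ej = "E (T j) U U" and ?N = "N k j ?u"
    have Uj: "sqf (T j) U" by (rule sqf_T[OF U j(1)])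
    have Ej0: "0 \<le> ?Ej" by (rule E_bounds(3)[OF Tj(6,2) Uj])
    have hH: "0 \<le> h j / H" "h j / H \<le> hm / H" "h j / H \<le> 1"
      using Tj(7) H0 h_le_hm[OF j(1)] H by (auto simp: divide_le_eq_1 intro!: divide_right_mono)
    have NE: "?N \<le> sqrt (?Ej / \<theta>min)" using N_energy[OF i j(1)] by (simp add: U_def)
    \<comment> \<open>Both estimates below end in this product: \<open>\<theta>max\<close> enters
      through an upper energy bound, \<open>\<theta>min\<close> through the passage from the
      seminorm to the energy.\<close>
    have \<rho>: "sqrt \<theta>max * sqrt ?Ej * sqrt (?Ej / \<theta>min) = ?\<rho> * ?Ej"
      using Ej0 by (simp add: real_sqrt_divide)
    have Np: "sqrt (LINT y:T j|lebesgue. (U \<sigma> y)\<^sup>2) \<le> Cp * h j ^ (k - mi_order \<sigma>) * ?N" if "mi_order \<sigma> \<le> k" for \<sigma>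
    proof -
      have "(LINT y:T j|lebesgue. (U \<sigma> y)\<^sup>2) \<le> (\<Sum>\<gamma>\<in>multiindices (mi_order \<sigma>). LINT y:T j|lebesgue. (U \<gamma> y)\<^sup>2)"
        by (rule member_le_sum) (auto simp: finite_multiindices sqint_nonneg, simp add: multiindices_def)
      then have "sqrt (LINT y:T j|lebesgue. (U \<sigma> y)\<^sup>2) \<le> N (mi_order \<sigma>) j ?u"
        unfolding N_def U_def by (rule real_sqrt_le_mono)
      also have "\<dots> \<le> Cp * h j ^ (k - mi_order \<sigma>) * ?N" by (rule projection_le[OF i j that])
      finally show ?thesis .
    qed
    define Z where "Z = K * (hm / H) * Cp * ?N"
    have Z0: "0 \<le> Z" using K hm_pos H0 Cp N_nonneg by (simp add: Z_def)
    have Rf_le: "sqrt (LINT y:T j|lebesgue. (Rf \<sigma> y)\<^sup>2) \<le> 2 ^ k * Z" if \<sigma>: "\<sigma> \<in> MI" for \<sigma>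
    proof -
      have c: "square_integrable_on (T j) (\<lambda>y. pderivs (fst c) \<eta> y * U (count_list (snd c)) y) \<and>
         sqrt (LINT y:T j|lebesgue. (pderivs (fst c) \<eta> y * U (count_list (snd c)) y)\<^sup>2) \<le> Z"
        if "c \<in> set (ss \<sigma>)" for c
      proof -
        have l: "fst c \<noteq> []" "length (fst c) \<le> k" "length (snd c) \<le> k" "k - length (snd c) = length (fst c)"
          using ss_len[OF that] \<sigma> by (auto simp: multiindices_def)
        have sq: "square_integrable_on (T j) (U (count_list (snd c)))"
          using Usq[of "count_list (snd c)"] l(3) by (intro sq_T[OF _ j(1)]) (simp add: mi_order_count_list)
        let ?n = "length (fst c)"
        note pl = prod_sq[OF Tj(6) sq \<eta>d[OF l(1,2)]] prod_le[OF Tj(6) sq \<eta>d[OF l(1,2)]]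
        have "sqrt (LINT y:T j|lebesgue. (pderivs (fst c) \<eta> y * U (count_list (snd c)) y)\<^sup>2)
            \<le> sqrt ((K / H ^ ?n)\<^sup>2 * (LINT y:T j|lebesgue. (U (count_list (snd c)) y)\<^sup>2))"
          by (rule real_sqrt_le_mono[OF pl(2)])
        also have "\<dots> = (K / H ^ ?n) * sqrt (LINT y:T j|lebesgue. (U (count_list (snd c)) y)\<^sup>2)"
          using K H0 by (simp add: real_sqrt_mult)
        \<comment> \<open>The n derivatives on the cutoff cost H^-n, and the projection estimate for
          the remaining k - n returns h^n.\<close>
        also have "\<dots> \<le> (K / H ^ ?n) * (Cp * h j ^ ?n * ?N)"
          using Np[of "count_list (snd c)"] l(3,4) K H0
          by (intro mult_left_mono) (auto simp: mi_order_count_list)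
        also have "\<dots> = K * (h j / H) ^ ?n * Cp * ?N" by (simp add: power_divide)
        also have "\<dots> \<le> K * (hm / H) * Cp * ?N"
        proof -
          \<comment> \<open>Since h / H is at most 1 and n is at least 1, all orders are dominated
            by the first power.\<close>
          have "(h j / H) ^ ?n \<le> (h j / H) ^ 1"
            using hH l(1) by (intro power_decreasing) (auto simp: Suc_le_eq)
          then have "(h j / H) ^ ?n \<le> hm / H" using hH(2) by simp
          then show ?thesis using K Cp N_nonneg by (intro mult_right_mono mult_left_mono) auto
        qed
        finally show ?thesis using pl(1) by (simp add: Z_def)
      qed
      have "sqrt (LINT y:T j|lebesgue. (Rf \<sigma> y)\<^sup>2)
          \<le> (\<Sum>c\<leftarrow>ss \<sigma>. sqrt (LINT y:T j|lebesgue. (pderivs (fst c) \<eta> y * U (count_list (snd c)) y)\<^sup>2))"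
        unfolding Rf_def using c by (intro sq_Minkowski_list(2)) blast
      also have "\<dots> \<le> (\<Sum>c\<leftarrow>ss \<sigma>. Z)" using c by (intro sum_list_mono) blast
      also have "\<dots> = real (length (ss \<sigma>)) * Z" by (simp add: sum_list_triv)
      also have "\<dots> \<le> 2 ^ k * Z"
      proof (rule mult_right_mono[OF _ Z0])
        show "real (length (ss \<sigma>)) \<le> 2 ^ k" using card_ss[OF \<sigma>] by (simp flip: of_nat_le_iff)
      qed
      finally show ?thesis .
    qed
    have first: "\<bar>Es (T j) U Rf\<bar> \<le> real (card MI) * 2 ^ k * K * (hm / H) * Cp * (?\<rho> * ?Ej)"
    proof -
      have Rfj: "sqf (T j) Rf" by (rule sqf_T[OF Rf j(1)])
      have Y0: "0 \<le> 2 ^ k * Z" using Z0 by simp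
      have sq_le: "(LINT y:T j|lebesgue. (Rf \<sigma> y)\<^sup>2) \<le> (2 ^ k * Z)\<^sup>2" if "\<sigma> \<in> MI" for \<sigma>
        using Rf_le[OF that] by (rule sqrt_le_D)
      have "E (T j) Rf Rf \<le> \<theta>max * (\<Sum>\<sigma>\<in>MI. LINT y:T j|lebesgue. (Rf \<sigma> y)\<^sup>2)"
        by (rule E_bounds(2)[OF Tj(6,2) Rfj])
      also have "\<dots> \<le> \<theta>max * (\<Sum>\<sigma>\<in>MI. (2 ^ k * Z)\<^sup>2)"
        using sq_le max0 by (intro mult_left_mono sum_mono) auto
      also have "\<dots> = \<theta>max * (real (card MI) * (2 ^ k * Z)\<^sup>2)" by simp
      \<comment> \<open>The count of multi-indices is squared so that it leaves the square root as
        an integer.\<close>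
      also have "\<dots> \<le> \<theta>max * ((real (card MI))\<^sup>2 * (2 ^ k * Z)\<^sup>2)"
      proof (intro mult_left_mono mult_right_mono)
        show "real (card MI) \<le> (real (card MI))\<^sup>2"
          using multiindices_nonempty[of k, where ?'n = 'n] finite_multiindices[of k, where ?'a = 'n]
          by (auto simp: power2_eq_square card_gt_0_iff Suc_le_eq)
      qed (use max0 in auto)
      finally have "sqrt (E (T j) Rf Rf) \<le> sqrt (\<theta>max * (real (card MI) * (2 ^ k * Z))\<^sup>2)"
        by (simp add: power_mult_distrib)
      also have "\<dots> = sqrt \<theta>max * (real (card MI) * (2 ^ k * Z))"
        using Y0 by (simp add: real_sqrt_mult)
      finally have s: "sqrt (E (T j) Rf Rf) \<le> sqrt \<theta>max * (real (card MI) * (2 ^ k * Z))" .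
      have "\<bar>Es (T j) U Rf\<bar> \<le> sqrt ?Ej * sqrt (E (T j) Rf Rf)"
        by (rule Es_Cauchy_Schwarz[OF Tj(6,2) Uj Rfj])
      also have "\<dots> \<le> sqrt ?Ej * (sqrt \<theta>max * (real (card MI) * (2 ^ k * Z)))"
        using s Ej0 by (intro mult_left_mono) auto
      also have "\<dots> = (real (card MI) * 2 ^ k * K * (hm / H) * Cp) * (sqrt \<theta>max * sqrt ?Ej * ?N)"
        by (simp add: Z_def)
      also have "\<dots> \<le> (real (card MI) * 2 ^ k * K * (hm / H) * Cp) * (sqrt \<theta>max * sqrt ?Ej * sqrt (?Ej / \<theta>min))"
        using NE K hm_pos H0 Cp Ej0 max0 by (intro mult_left_mono) auto
      finally show ?thesis unfolding \<rho> .
    qed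
    have second: "\<bar>LINT y:T j|lebesgue. ?v y * ?p j y\<bar> \<le> real CARD('n) * K * (hm / H) * Cp * C * (?\<rho> * ?Ej)"
    proof -
      \<comment> \<open>Orthogonality of the basis function to its multiplier polynomial allows a
        constant to be subtracted from the cutoff; what is left is at most its oscillation
        \<open>?L\<close> on the element.\<close>
      let ?c = "\<eta> (x j)" and ?L = "real CARD('n) * (K / H) * h j"
      have L0: "0 \<le> ?L" using K H0 Tj(7) by simp
      have uT: "square_integrable_on (T j) ?u" by (rule sq_T[OF H0_sq[OF u] j(1)])
      have pT: "square_integrable_on (T j) (?p j)" by (rule poly_sq[OF j(1) pj_poly[OF j(1)]])
      have dev: "\<bar>\<eta> y - ?c\<bar> \<le> ?L" if "y \<in> T j" for y
      proof -
        have "\<bar>\<eta> y - ?c\<bar> \<le> real CARD('n) * (K / H) * dist y (x j)"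
          using \<eta>d[of "[_]"] k1 by (intro smooth_Lipschitz[OF \<eta>(1)]) simp
        also have "\<dots> \<le> ?L"
          using that interior_subset[of "\<tau> j"] centers[OF j(1)] K H0
          by (intro mult_left_mono dist_le_hm[OF j(1)]) auto
        finally show ?thesis .
      qed
      have m: "set_borel_measurable lebesgue (T j) (\<lambda>y. \<eta> y - ?c)" using meas[OF Tj(6), of "[]" ?c] by simp
      have ae: "AE y in lebesgue. y \<in> T j \<longrightarrow> \<bar>\<eta> y - ?c\<bar> \<le> ?L" using dev by (intro AE_I2) simp
      note wb = sq_bounded_mult[OF uT m ae]
      have "(LINT y:T j|lebesgue. ?v y * ?p j y)
          = (LINT y:T j|lebesgue. ((\<eta> y - ?c) * ?u y) * ?p j y + ?c * (?u y * ?p j y))"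
        by (simp add: algebra_simps)
      also have "\<dots> = (LINT y:T j|lebesgue. ((\<eta> y - ?c) * ?u y) * ?p j y) + ?c * (LINT y:T j|lebesgue. ?u y * ?p j y)"
        using set_integral_add(2)[OF sq_mult_integrable[OF wb(1) pT] set_integrable_mult_right[OF sq_mult_integrable[OF uT pT], of ?c]]
        by simp
      also have "(LINT y:T j|lebesgue. ?u y * ?p j y) = 0"
        by (rule \<psi>_orthogonal[OF i j pj_poly[OF j(1)]])
      finally have eq: "(LINT y:T j|lebesgue. ?v y * ?p j y) = (LINT y:T j|lebesgue. ((\<eta> y - ?c) * ?u y) * ?p j y)" by simp
      have u0: "sqrt (LINT y:T j|lebesgue. (?u y)\<^sup>2) \<le> Cp * h j ^ k * ?N"
      proof -
        have z: "AE y in lebesgue. y \<in> D \<longrightarrow> weak_deriv D (\<lambda>_. 0) ?u y = ?u y"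
          by (rule weak_deriv_zero[OF D(1) sq_locally_integrable[OF H0_sq[OF u]]])
        have "(LINT y:T j|lebesgue. (?u y)\<^sup>2) = (LINT y:T j|lebesgue. (U (\<lambda>_. 0) y)\<^sup>2)"
          by (rule set_integral_cong_AE_sets(1)) (use z in eventually_elim, use Tj(2) in \<open>auto simp: U_def\<close>)
        then show ?thesis using Np[of "\<lambda>_. 0"] by (simp add: mi_order_def)
      qed
      have "sqrt (LINT y:T j|lebesgue. ((\<eta> y - ?c) * ?u y)\<^sup>2) \<le> sqrt (?L\<^sup>2 * (LINT y:T j|lebesgue. (?u y)\<^sup>2))"
        by (rule real_sqrt_le_mono[OF wb(2)])
      also have "\<dots> = ?L * sqrt (LINT y:T j|lebesgue. (?u y)\<^sup>2)" by (simp only: real_sqrt_mult real_sqrt_abs abs_of_nonneg[OF L0])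
      also have "\<dots> \<le> ?L * (Cp * h j ^ k * ?N)" by (rule mult_left_mono[OF u0 L0])
      finally have A: "sqrt (LINT y:T j|lebesgue. ((\<eta> y - ?c) * ?u y)\<^sup>2) \<le> ?L * (Cp * h j ^ k * ?N)" .
      have B: "sqrt (LINT y:T j|lebesgue. (?p j y)\<^sup>2) \<le> C / h j ^ k * (sqrt \<theta>max * sqrt ?Ej)"
        using poly_estimate[OF i j(1)] by (simp add: U_def)
      have "\<bar>LINT y:T j|lebesgue. ?v y * ?p j y\<bar>
          \<le> sqrt (LINT y:T j|lebesgue. ((\<eta> y - ?c) * ?u y)\<^sup>2) * sqrt (LINT y:T j|lebesgue. (?p j y)\<^sup>2)"
        unfolding eq by (rule sq_Cauchy_Schwarz_sqrt[OF wb(1) pT])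
      also have "\<dots> \<le> (?L * (Cp * h j ^ k * ?N)) * (C / h j ^ k * (sqrt \<theta>max * sqrt ?Ej))"
      proof (rule mult_mono[OF A B])
        have "0 \<le> Cp * h j ^ k * ?N" using Cp Tj(7) N_nonneg by simp
        with L0 show "0 \<le> ?L * (Cp * h j ^ k * ?N)" by (rule mult_nonneg_nonneg)
      qed (simp add: sqint_nonneg)
      \<comment> \<open>The h^k of the projection estimate of order 0 cancels against the h^-k of
        the inverse estimate; one factor h / H remains from the oscillation.\<close>
      also have "\<dots> = (real CARD('n) * K * Cp * C) * (h j / H) * (sqrt \<theta>max * sqrt ?Ej * ?N)"
        using Tj(7) H0 by (simp add: field_simps)
      also have "\<dots> \<le> (real CARD('n) * K * Cp * C) * (hm / H) * (sqrt \<theta>max * sqrt ?Ej * sqrt (?Ej / \<theta>min))"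
        using NE hH K Cp C0 Ej0 max0 N_nonneg hm_pos H0 by (intro mult_mono mult_left_mono) auto
      also have "\<dots> = real CARD('n) * K * (hm / H) * Cp * C * (?\<rho> * ?Ej)" unfolding \<rho> by simp
      finally show ?thesis .
    qed
    have "X j \<le> real (card MI) * 2 ^ k * K * (hm / H) * Cp * (?\<rho> * ?Ej) + real CARD('n) * K * (hm / H) * Cp * C * (?\<rho> * ?Ej)"
      using first second unfolding X_def by linarith
    also have "\<dots> = (real (card MI) * 2 ^ k + real CARD('n) * C) * (K * (hm / H) * Cp * (?\<rho> * ?Ej))"
      by (simp add: algebra_simps add_divide_distrib)
    \<comment> \<open>The commutator term carries no \<open>C\<close> and the multiplier term
      carries one; a common factor 1 + C covers both, which fixes C1 = 1.\<close>
    also have "\<dots> \<le> ((real (card MI) * 2 ^ k + real CARD('n)) * (1 + C)) * (K * (hm / H) * Cp * (?\<rho> * ?Ej))"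
    proof (rule mult_right_mono)
      show "real (card MI) * 2 ^ k + real CARD('n) * C \<le> (real (card MI) * 2 ^ k + real CARD('n)) * (1 + C)"
        using C0 by (simp add: algebra_simps)
      show "0 \<le> K * (hm / H) * Cp * (?\<rho> * ?Ej)"
        using K hm_pos H0 Cp Ej0 max0 min0 by simp
    qed
    also have "\<dots> = K1 K * (hm / H) * Cp * (1 + C) * ?\<rho> * ?Ej" by (simp add: K1_def mult.assoc mult.left_commute)
    finally show ?thesis .
  qed
  define M where "M = K1 K * (hm / H) * Cp * (1 + C) * ?\<rho>"
  have M0: "0 \<le> M" using K hm_pos H0 Cp C0 max0 min0 by (simp add: M_def K1_def)
  have ball_sets: "- ball (x i) r \<in> sets lebesgue" for r by auto
  have Dr: "D \<inter> - ball (x i) r \<in> sets lebesgue" for r using D_sets ball_sets[of r] by (rule sets.Int)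
  have Eo: "Eo r = (LINT y:D \<inter> - ball (x i) r|lebesgue. dens U y)"
    "set_integrable lebesgue (D \<inter> - ball (x i) r) (dens U)" for r
    unfolding Eo_def U_def[symmetric]
    using E_eq_integral[OF Dr _ sqf_subset[OF U Dr]] by auto
  have Eo_sum: "Eo r = (\<Sum>j\<in>I. LINT y:T j \<inter> - ball (x i) r|lebesgue. dens U y)" for r
    unfolding Eo(1) by (rule integral_split[OF Eo(2) ball_sets])
  have Tr: "T j \<inter> - ball (x i) r \<in> sets lebesgue" "T j \<inter> - ball (x i) r \<subseteq> D" if "j \<in> I" for j r
    using \<tau>_facts(2,6)[OF that] ball_sets[of r] by auto
  have Tnn: "0 \<le> (LINT y:T j \<inter> - ball (x i) r|lebesgue. dens U y)" if "j \<in> I" for j r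
    using E_bounds(3)[OF Tr[OF that] sqf_subset[OF U Tr[OF that]]] E_eq_integral(1)[OF Tr[OF that] sqf_subset[OF U Tr[OF that]]] by simp
  have R3: "R \<le> ?R3" using hm_pos H0 by linarith
  have mono: "(LINT y:T j \<inter> - ball (x i) ?R3|lebesgue. dens U y) \<le> (LINT y:T j \<inter> - ball (x i) R|lebesgue. dens U y)"
    if j: "j \<in> I" for j
  proof (rule set_lint_mono_set)
    show "set_integrable lebesgue (T j \<inter> - ball (x i) R) (dens U)"
      by (rule E_eq_integral(2)[OF Tr[OF j] sqf_subset[OF U Tr[OF j]]])
    show "0 \<le> dens U y" if "y \<in> T j \<inter> - ball (x i) R" for y
      using that dens_bounds(3) \<tau>_facts(2)[OF j] by blast
    have "ball (x i) R \<subseteq> ball (x i) ?R3" by (rule subset_ball[OF R3])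
    then show "T j \<inter> - ball (x i) ?R3 \<subseteq> T j \<inter> - ball (x i) R" by blast
  qed (rule Tr(1)[OF j])
  have JI: "J \<subseteq> I" by (auto simp: J_def)
  \<comment> \<open>Elements of J lie between the two radii and count in full on the right, where
    every other element adds a nonnegative difference.\<close>
  have "(\<Sum>j\<in>J. E (T j) U U) \<le> (\<Sum>j\<in>I. (LINT y:T j \<inter> - ball (x i) R|lebesgue. dens U y) - (LINT y:T j \<inter> - ball (x i) ?R3|lebesgue. dens U y))"
  proof (rule sum_le_included[where i = "\<lambda>j. j"])
    show "\<forall>j\<in>J. \<exists>j'\<in>I. j' = j \<and> E (T j) U U \<le> (LINT y:T j' \<inter> - ball (x i) R|lebesgue. dens U y) - (LINT y:T j' \<inter> - ball (x i) ?R3|lebesgue. dens U y)"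
    proof
      fix j assume jJ: "j \<in> J"
      then have j: "j \<in> I" using JI by blast
      have dd: "R \<le> dist y (x i)" "dist y (x i) < ?R3" if "y \<in> T j" for y
        using jJ that interior_subset[of "\<tau> j"] by (auto simp: J_def)
      have 1: "T j \<inter> - ball (x i) R = T j" using dd(1) by (force simp: dist_commute)
      have 2: "T j \<inter> - ball (x i) ?R3 = {}" using dd(2) by (force simp: dist_commute)
      have "E (T j) U U = (LINT y:T j|lebesgue. dens U y)"
        by (rule E_eq_integral(1)[OF \<tau>_facts(6,2)[OF j] sqf_T[OF U j]])
      then show "\<exists>j'\<in>I. j' = j \<and> E (T j) U U \<le> (LINT y:T j' \<inter> - ball (x i) R|lebesgue. dens U y) - (LINT y:T j' \<inter> - ball (x i) ?R3|lebesgue. dens U y)"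
        using j by (intro bexI[of _ j]) (simp_all add: 1 2 set_lebesgue_integral_def)
    qed
  qed (use mono finite_subset[OF JI] in auto)
  then have sumJ: "(\<Sum>j\<in>J. E (T j) U U) \<le> Eo R - Eo ?R3" by (simp add: Eo_sum sum_subtractf)
  \<comment> \<open>The cutoff is 1 beyond the outer radius; enlarging the domain of the weighted
    integral to D only adds nonnegative density.\<close>
  have "Eo ?R3 = (LINT y:D \<inter> - ball (x i) ?R3|lebesgue. \<eta> y * dens U y)"
    unfolding Eo(1)
  proof (rule set_integral_cong_AE_sets(1), rule AE_I2)
    fix y
    have "\<eta> y = 1" if "y \<notin> ball (x i) ?R3"
      using that hm_pos by (intro \<eta>1) (simp add: dist_commute)
    then show "(y \<in> D \<inter> - ball (x i) ?R3) = (y \<in> D \<inter> - ball (x i) ?R3) \<and>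
        (y \<in> D \<inter> - ball (x i) ?R3 \<longrightarrow> dens U y = \<eta> y * dens U y)" by simp
  qed
  also have "\<dots> \<le> (LINT y:D|lebesgue. \<eta> y * dens U y)"
  proof (rule set_lint_mono_set)
    show "set_integrable lebesgue D (\<lambda>y. \<eta> y * dens U y)" by (rule Es_mult(2)[OF D_sets order_refl U \<eta>U])
    show "0 \<le> \<eta> y * dens U y" if "y \<in> D" for y
      using dens_bounds(3)[OF that] \<eta>(2) by simp
  qed (use Dr in auto)
  also have "\<dots> = (\<Sum>j\<in>I. X j)" by (rule main)
  also have "\<dots> = (\<Sum>j\<in>J. X j)"
    using X0 JI by (intro sum.mono_neutral_right) auto
  also have "\<dots> \<le> (\<Sum>j\<in>J. M * E (T j) U U)"
    using XJ by (intro sum_mono) (simp add: M_def)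
  also have "\<dots> = M * (\<Sum>j\<in>J. E (T j) U U)" by (simp add: sum_distrib_left)
  also have "\<dots> \<le> M * (Eo R - Eo ?R3)" by (rule mult_left_mono[OF sumJ M0])
  finally show ?thesis by (simp add: M_def)
qed

end

text \<open>For l \<ge> 4 one has l \<le> 2 (l - 2), so the factor 2 in front of \<open>K\<close>
  pays for the loss from l to l - 2.\<close>

lemma bound_transfer:
  fixes e :: real
  assumes "e \<ge> 2" "l \<ge> 4" "0 \<le> A" "0 \<le> K" "sqrt (l\<^sup>2 - 1) \<ge> (e - 1) * (2 * K + 4) * A"
  shows "(e - 1) * (K * (1 / (l - 2)) * A) \<le> 1"
proof -
  have l: "sqrt (l\<^sup>2 - 1) \<le> l" using assms(2) by (intro real_le_lsqrt) auto
  have "(e - 1) * (2 * K) * A \<le> (e - 1) * (2 * K + 4) * A"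
    using assms by (intro mult_right_mono mult_left_mono) auto
  also have "\<dots> \<le> l" using assms(5) l by linarith
  finally have 1: "(e - 1) * K * A \<le> l / 2" by simp
  have "(e - 1) * (K * (1 / (l - 2)) * A) = ((e - 1) * K * A) / (l - 2)" by simp
  also have "\<dots> \<le> (l / 2) / (l - 2)" using 1 assms(2) by (intro divide_right_mono) auto
  also have "\<dots> \<le> 1" using assms(2) by simp
  finally show ?thesis .
qed

context partition_form
begin

text \<open>The summand \<open>4\<close> forces \<open>4 \<le> l\<close>, which leaves room in the annulus for a layer of elements on either
  side of the transition of the cutoff.\<close>

lemma exponential_decay:
  fixes l r K :: real
  assumes k1: "k \<ge> 1" and K: "K > 0"
    and cut: "\<forall>c R R'. 0 \<le> R \<longrightarrow> R < R' \<longrightarrow> (\<exists>\<eta> :: real^'n \<Rightarrow> real. smooth \<eta> \<and>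
       (\<forall>y. 0 \<le> \<eta> y \<and> \<eta> y \<le> 1) \<and> (\<forall>y. dist y c \<le> R \<longrightarrow> \<eta> y = 0) \<and> (\<forall>y. dist y c \<ge> R' \<longrightarrow> \<eta> y = 1) \<and>
       (\<forall>is y. is \<noteq> [] \<longrightarrow> length is \<le> k \<longrightarrow> \<bar>pderivs is \<eta> y\<bar> \<le> K / (R' - R) ^ length is))"
    and i: "i \<in> I" "q \<in> Q" and r: "r > 0"
    and l: "sqrt (l\<^sup>2 - 1) \<ge> (exp 1 - 1) * (2 * K1 K + 4) * Cp * (1 + C) * sqrt (\<theta>max / \<theta>min)"
  shows "local_energy k D a (D \<inter> - ball (x i) r) (\<psi> i q)
    \<le> exp (1 - r / (l * mesh_size m \<tau>)) * local_energy k D a D (\<psi> i q)"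
proof -
  define U where "U = W (\<psi> i q)"
  define Eo where "Eo s = E (D \<inter> - ball (x i) s) U U" for s
  note u = \<psi>_facts(1)[OF i]
  have U: "sqf D U" unfolding U_def by (rule W_sqf[OF u])
  let ?tot = "E D U U" and ?\<rho> = "sqrt (\<theta>max / \<theta>min)"
  have ball_sets: "- ball (x i) s \<in> sets lebesgue" for s by auto
  have Ds: "D \<inter> - ball (x i) s \<in> sets lebesgue" for s using D_sets ball_sets[of s] by (rule sets.Int)
  have Us: "sqf (D \<inter> - ball (x i) s) U" for s by (rule sqf_subset[OF U Ds]) auto
  have Eoi: "Eo s = (LINT y:D \<inter> - ball (x i) s|lebesgue. dens U y)"
    "set_integrable lebesgue (D \<inter> - ball (x i) s) (dens U)" for s
    unfolding Eo_def by (rule E_eq_integral[OF Ds _ Us], blast)+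
  have toti: "?tot = (LINT y:D|lebesgue. dens U y)" "set_integrable lebesgue D (dens U)"
    by (rule E_eq_integral[OF D_sets order_refl U])+
  have mono: "Eo t \<le> Eo s" if "s \<le> t" for s t
    unfolding Eoi(1)
  proof (rule set_lint_mono_set[OF Eoi(2) Ds])
    show "D \<inter> - ball (x i) t \<subseteq> D \<inter> - ball (x i) s" using subset_ball[OF that, of "x i"] by blast
  qed (use dens_bounds(3) in auto)
  have Eo_tot: "Eo s \<le> ?tot" for s
    unfolding Eoi(1) toti(1) by (rule set_lint_mono_set[OF toti(2) Ds]) (use dens_bounds(3) in auto)
  have Eo0: "0 \<le> Eo s" for s unfolding Eo_def by (rule E_bounds(3)[OF Ds _ Us]) auto
  have tot0: "0 \<le> ?tot" by (rule E_bounds(3)[OF D_sets order_refl U])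
  have C0: "0 < C" by (rule C_pos[OF I_nonempty])
  have K10: "0 \<le> K1 K" using K by (simp add: K1_def)
  have e2: "exp 1 \<ge> (2::real)" using exp_ge_add_one_self[of 1] by simp
  have \<rho>1: "1 \<le> ?\<rho>" using min_le_max min0 by simp
  \<comment> \<open>If the quotient is at most 1 the factor is at least 1 and monotonicity suffices.
    This case also absorbs every nonpositive \<open>l\<close>, with quotient 0 at l = 0.\<close>
  have "Eo r \<le> exp (1 - r / (l * hm)) * ?tot"
  proof (cases "r / (l * hm) \<le> 1")
    case True
    have "1 * ?tot \<le> exp (1 - r / (l * hm)) * ?tot"
      using True tot0 by (intro mult_right_mono) auto
    then show ?thesis using Eo_tot[of r] by linarith
  next
    case far: False
    have Ej: "E (T j) U U \<le> \<theta>max * (N k j (\<psi> i q))\<^sup>2" if "j \<in> I" for j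
      using E_bounds(2)[OF \<tau>_facts(6,2)[OF that] sqf_T[OF U that]]
      by (simp add: N_def U_def sum_nonneg sqint_nonneg)
    show ?thesis
    \<comment> \<open>The sign of \<open>Cp\<close> can be read off only where the seminorm is
      positive; if it vanishes on all elements, so does the energy.\<close>
    proof (cases "\<exists>j\<in>I. N k j (\<psi> i q) > 0")
      case False
      then have "E (T j) U U \<le> 0" if "j \<in> I" for j
        using Ej[OF that] N_nonneg[of k j "\<psi> i q"] that by force
      then have "?tot \<le> 0" unfolding E_split[OF U U] by (intro sum_nonpos) auto
      then have "?tot = 0" using tot0 by simp
      then show ?thesis using Eo_tot[of r] by simp
    next
      case ex: True
      have Cp0: "0 \<le> Cp"
        using ex Cp_nonneg_center[OF i] Cp_ge_1[OF i] by force
      have A0: "0 \<le> Cp * (1 + C) * ?\<rho>" using Cp0 C0 \<rho>1 by simp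
      have l': "sqrt (l\<^sup>2 - 1) \<ge> (exp 1 - 1) * (2 * K1 K + 4) * (Cp * (1 + C) * ?\<rho>)"
        using l by (simp add: mult.assoc)
      have "0 \<le> (exp 1 - 1) * (2 * K1 K + 4) * (Cp * (1 + C) * ?\<rho>)"
        by (rule mult_nonneg_nonneg[OF mult_nonneg_nonneg A0]) (use K10 e2 in auto)
      then have "0 \<le> sqrt (l\<^sup>2 - 1)" using l' by linarith
      \<comment> \<open>The real square root is odd, so it is nonnegative only at nonnegative
        arguments.\<close>
      then have l2: "1 \<le> l\<^sup>2" by simp
      have "0 < l"
      proof (rule ccontr)
        assume "\<not> 0 < l"
        then have "r / (l * hm) \<le> 0" using hm_pos r by (intro divide_nonneg_nonpos mult_nonpos_nonneg) auto
        then show False using far by simp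
      qed
      then have l1: "1 \<le> l" using l2 power2_le_imp_le[of 1 l] by simp
      have lh: "l * hm < r" using far hm_pos \<open>0 < l\<close> by (simp add: field_simps)
      show ?thesis
      \<comment> \<open>If only the central element carries energy, none is left outside the ball,
        because r exceeds the mesh size.\<close>
      proof (cases "\<exists>j\<in>I. j \<noteq> i \<and> N k j (\<psi> i q) > 0")
        case False
        have z: "(LINT y:T j \<inter> - ball (x i) r|lebesgue. dens U y) \<le> 0" if j: "j \<in> I" for j
        proof (cases "j = i")
          case True
          have "T j \<inter> - ball (x i) r = {}"
          proof -
            have "dist y (x i) < r" if "y \<in> T i" for y
            proof -
              have "dist y (x i) \<le> h i"
                using that interior_subset[of "\<tau> i"] centers[OF i(1)] by (intro dist_le_hm[OF i(1)]) auto
              moreover have "1 * hm \<le> l * hm" using l1 hm_pos by (intro mult_right_mono) auto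
              ultimately show ?thesis using h_le_hm[OF i(1)] lh by linarith
            qed
            then show ?thesis using True by (force simp: dist_commute)
          qed
          then show ?thesis by (simp add: set_lebesgue_integral_def)
        next
          case jn: False
          have "N k j (\<psi> i q) = 0" using False jn j N_nonneg[of k j "\<psi> i q"] by force
          then have "E (T j) U U \<le> 0" using Ej[OF j] by simp
          moreover have "(LINT y:T j \<inter> - ball (x i) r|lebesgue. dens U y) \<le> E (T j) U U"
            unfolding E_eq_integral(1)[OF \<tau>_facts(6,2)[OF j] sqf_T[OF U j]]
          proof (rule set_lint_mono_set)
            show "set_integrable lebesgue (T j) (dens U)"
              by (rule E_eq_integral(2)[OF \<tau>_facts(6,2)[OF j] sqf_T[OF U j]])
            show "T j \<inter> - ball (x i) r \<in> sets lebesgue" using \<tau>_facts(6)[OF j] ball_sets by (rule sets.Int)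
          qed (use dens_bounds(3) \<tau>_facts(2)[OF j] in auto)
          ultimately show ?thesis by linarith
        qed
        have "Eo r \<le> 0"
          unfolding Eoi(1) integral_split[OF Eoi(2) ball_sets] using z by (intro sum_nonpos) auto
        moreover have "0 \<le> exp (1 - r / (l * hm)) * ?tot" using tot0 by simp
        ultimately show ?thesis by linarith
      next
        case True
        then have Cp1: "1 \<le> Cp" using Cp_ge_1[OF i] by blast
        \<comment> \<open>The factors e - 1, Cp, 1 + C and the root of the ellipticity ratio are at
          least 1, and the summand 4 supplies the rest.\<close>
        have "4 \<le> l"
        proof -
          have "1 * 4 * (1 * 1 * 1) \<le> (exp 1 - 1) * (2 * K1 K + 4) * (Cp * (1 + C) * ?\<rho>)"
            using e2 K10 Cp1 C0 \<rho>1 by (intro mult_mono mult_nonneg_nonneg) auto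
          then have "4 \<le> sqrt (l\<^sup>2 - 1)" using l' by linarith
          also have "\<dots> \<le> l" using l1 by (intro real_le_lsqrt) auto
          finally show ?thesis .
        qed
        \<comment> \<open>With this \<open>?H\<close> the transition and its two layers together
          have width exactly l times the mesh size.\<close>
        let ?L = "l * hm" and ?H = "(l - 2) * hm"
        have H: "hm \<le> ?H"
        proof -
          have "1 * hm \<le> (l - 2) * hm" using \<open>4 \<le> l\<close> hm_pos by (intro mult_right_mono) auto
          then show ?thesis by simp
        qed
        have step: "Eo (R + ?L) \<le> exp (- 1) * Eo R" if R: "0 \<le> R" for R
        proof -
          have "R + hm < R + hm + ?H" "0 \<le> R + hm" using H hm_pos R by auto
          from cut[rule_format, OF this(2,1), of "x i"]
          obtain \<eta> where \<eta>: "smooth \<eta>" "\<And>y. 0 \<le> \<eta> y" "\<And>y. \<eta> y \<le> 1"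
            "\<And>y. dist y (x i) \<le> R + hm \<Longrightarrow> \<eta> y = 0" "\<And>y. dist y (x i) \<ge> R + hm + ?H \<Longrightarrow> \<eta> y = 1"
            "\<And>is y. is \<noteq> [] \<Longrightarrow> length is \<le> k \<Longrightarrow> \<bar>pderivs is \<eta> y\<bar> \<le> K / ?H ^ length is"
            by auto
          have RL: "R + 2 * hm + ?H = R + ?L" by (simp add: algebra_simps)
          define M where "M = K1 K * (1 / (l - 2)) * (Cp * (1 + C) * ?\<rho>)"
          have hH: "hm / ?H = 1 / (l - 2)" using hm_pos by simp
          have "Eo (R + ?L) \<le> M * (Eo R - Eo (R + ?L))"
            using decay_step[OF i R H K k1 Cp0 \<eta>]
            unfolding RL hH Eo_def U_def M_def by (simp add: mult.assoc)
          \<comment> \<open>Hole filling: (e - 1) M \<le> 1, so the energy of the exterior appears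
            on the left e times in total.\<close>
          then have "(exp 1 - 1) * Eo (R + ?L) \<le> (exp 1 - 1) * (M * (Eo R - Eo (R + ?L)))"
            using e2 by (intro mult_left_mono) auto
          also have "\<dots> = ((exp 1 - 1) * M) * (Eo R - Eo (R + ?L))" by simp
          also have "\<dots> \<le> 1 * (Eo R - Eo (R + ?L))"
          proof (rule mult_right_mono)
            show "(exp 1 - 1) * M \<le> 1"
              unfolding M_def by (rule bound_transfer[OF e2 \<open>4 \<le> l\<close> A0 K10 l'])
            show "0 \<le> Eo R - Eo (R + ?L)" using mono[of R "R + ?L"] \<open>4 \<le> l\<close> hm_pos by simp
          qed
          finally have "exp 1 * Eo (R + ?L) \<le> Eo R" by (simp add: algebra_simps)
          then have "exp (- 1) * (exp 1 * Eo (R + ?L)) \<le> exp (- 1) * Eo R" by (intro mult_left_mono) auto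
          then show ?thesis by (simp add: mult.assoc[symmetric] exp_add[symmetric])
        qed
        have iter: "Eo (real n * ?L) \<le> exp (- real n) * ?tot" for n
        proof (induction n)
          case 0
          then show ?case using Eo_tot[of 0] by simp
        next
          case (Suc n)
          have "Eo (real (Suc n) * ?L) = Eo (real n * ?L + ?L)" by (simp add: algebra_simps)
          also have "\<dots> \<le> exp (- 1) * Eo (real n * ?L)"
            using \<open>0 < l\<close> hm_pos by (intro step) auto
          also have "\<dots> \<le> exp (- 1) * (exp (- real n) * ?tot)" using Suc by (intro mult_left_mono) auto
          also have "\<dots> = exp (- real (Suc n)) * ?tot"
            by (simp add: mult.assoc[symmetric] exp_add[symmetric])
          finally show ?case .
        qed
        \<comment> \<open>Rounding the number of full steps down loses less than one step, which
          accounts for the 1 in the exponent.\<close>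
        define n where "n = nat \<lfloor>r / ?L\<rfloor>"
        have pos: "0 < r / ?L" using r \<open>0 < l\<close> hm_pos by simp
        have n: "real n \<le> r / ?L" "r / ?L < real n + 1"
          using pos unfolding n_def by (auto simp: of_nat_nat floor_less_iff)
        have "Eo r \<le> Eo (real n * ?L)"
          using n(1) \<open>0 < l\<close> hm_pos by (intro mono) (simp add: pos_le_divide_eq)
        also have "\<dots> \<le> exp (- real n) * ?tot" by (rule iter)
        also have "\<dots> \<le> exp (1 - r / ?L) * ?tot"
          using n(2) tot0 by (intro mult_right_mono) auto
        finally show ?thesis .
      qed
    qed
  qed
  then show ?thesis
    by (simp add: local_energy_eq Eo_def U_def hm_def)
qed

end

theorem theorem6p3:
  fixes k :: nat
  assumes "k \<ge> 1"
  shows "\<exists>C1>0. \<exists>C\<^sub>\<eta>>0.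
    \<forall>(D :: (real^'n::finite) set) (a :: 'n coeffs) (\<theta>max :: real) (\<theta>min :: real)
      (\<delta> :: real) (m :: nat) (\<tau> :: nat \<Rightarrow> (real^'n) set) (x :: nat \<Rightarrow> real^'n)
      (\<phi> :: nat \<Rightarrow> nat \<Rightarrow> real^'n \<Rightarrow> real) (\<psi> :: nat \<Rightarrow> nat \<Rightarrow> real^'n \<Rightarrow> real)
      (Cp :: real) (C :: real).
      open D \<and> connected D \<and> bounded D \<and> D \<noteq> {} \<and>
      (\<forall>\<sigma>\<in>multiindices k. \<forall>\<gamma>\<in>multiindices k. essentially_bounded_on D (a \<sigma> \<gamma>)) \<and>
      self_adjoint_form k D a \<and>
      \<theta>max \<ge> 0 \<and> bounded_above_form k D a \<theta>max \<and>
      \<theta>min > 0 \<and> strongly_elliptic k D a \<theta>min \<and>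
      \<delta> > 0 \<and> regular_partition D m \<tau> \<delta> \<and>
      (\<forall>i\<in>{1..m}. x i \<in> \<tau> i \<and> ball (x i) (\<delta> * diameter (\<tau> i) / 2) \<subseteq> \<tau> i) \<and>
      local_poly_basis k m \<tau> \<phi> \<and>
      (\<forall>i\<in>{1..m}. \<forall>q\<in>{1..poly_dim TYPE('n) k}. is_basis_minimizer k D a m \<phi> i q (\<psi> i q)) \<and>
      projection_constant k D m \<tau> Cp \<and>
      inverse_estimate_constant TYPE('n) k \<delta> C
      \<longrightarrow>
      (\<forall>i\<in>{1..m}. \<forall>q\<in>{1..poly_dim TYPE('n) k}. \<forall>r>0. \<forall>l::real.
        sqrt (l\<^sup>2 - 1) \<ge> (exp 1 - 1) * C\<^sub>\<eta> * Cp * (C1 + C) * sqrt (\<theta>max / \<theta>min) \<longrightarrow>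
        local_energy k D a (D \<inter> - ball (x i) r) (\<psi> i q)
          \<le> exp (1 - r / (l * mesh_size m \<tau>)) * local_energy k D a D (\<psi> i q))"
proof -
  obtain K :: real where K: "K > 0" "\<forall>c R R'. 0 \<le> R \<longrightarrow> R < R' \<longrightarrow> (\<exists>\<eta> :: real^'n \<Rightarrow> real. smooth \<eta> \<and>
       (\<forall>y. 0 \<le> \<eta> y \<and> \<eta> y \<le> 1) \<and> (\<forall>y. dist y c \<le> R \<longrightarrow> \<eta> y = 0) \<and> (\<forall>y. dist y c \<ge> R' \<longrightarrow> \<eta> y = 1) \<and>
       (\<forall>is y. is \<noteq> [] \<longrightarrow> length is \<le> k \<longrightarrow> \<bar>pderivs is \<eta> y\<bar> \<le> K / (R' - R) ^ length is))"
    using cutoff_exists[of k] by blast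
  \<comment> \<open>Twice \<open>K1 K\<close> plus 4, as \<open>exponential_decay\<close> requires,
    written out since the locale is interpreted only below. It depends on \<open>k\<close> and the
    dimension alone.\<close>
  define C\<^sub>\<eta> where "C\<^sub>\<eta> = 2 * (K * (real (card (multiindices k :: 'n multiindex set)) * 2 ^ k + real CARD('n))) + 4"
  have "C\<^sub>\<eta> > 0" using K(1) by (auto simp: C\<^sub>\<eta>_def intro!: add_nonneg_pos)
  show ?thesis
  proof (rule exI[of _ 1], rule conjI[OF zero_less_one], rule exI[of _ C\<^sub>\<eta>],
      rule conjI[OF \<open>C\<^sub>\<eta> > 0\<close>], intro allI impI ballI, elim conjE)
    fix D :: "(real^'n) set" and a :: "'n coeffs" and \<theta>max \<theta>min \<delta> m \<tau> and x :: "nat \<Rightarrow> real^'n"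
      and \<phi> \<psi> :: "nat \<Rightarrow> nat \<Rightarrow> real^'n \<Rightarrow> real" and Cp C :: real and i q and r l :: real
    assume as: "open D" "bounded D" "D \<noteq> {}"
      "\<forall>\<sigma>\<in>multiindices k. \<forall>\<gamma>\<in>multiindices k. essentially_bounded_on D (a \<sigma> \<gamma>)"
      "self_adjoint_form k D a" "\<theta>max \<ge> 0" "bounded_above_form k D a \<theta>max"
      "\<theta>min > 0" "strongly_elliptic k D a \<theta>min" "\<delta> > 0" "regular_partition D m \<tau> \<delta>"
      "\<forall>i\<in>{1..m}. x i \<in> \<tau> i \<and> ball (x i) (\<delta> * diameter (\<tau> i) / 2) \<subseteq> \<tau> i"
      "local_poly_basis k m \<tau> \<phi>"
      "\<forall>i\<in>{1..m}. \<forall>q\<in>{1..poly_dim TYPE('n) k}. is_basis_minimizer k D a m \<phi> i q (\<psi> i q)"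
      "projection_constant k D m \<tau> Cp" "inverse_estimate_constant TYPE('n) k \<delta> C"
      and i: "i \<in> {1..m}" and q: "q \<in> {1..poly_dim TYPE('n) k}" and r: "r > 0"
      and l: "sqrt (l\<^sup>2 - 1) \<ge> (exp 1 - 1) * C\<^sub>\<eta> * Cp * (1 + C) * sqrt (\<theta>max / \<theta>min)"
    interpret partition_form k D a \<theta>max \<theta>min \<delta> m \<tau> x \<phi> \<psi> Cp C "poly_dim TYPE('n) k"
      by unfold_locales (use as in blast)+
    have "C\<^sub>\<eta> = 2 * K1 K + 4" by (simp add: C\<^sub>\<eta>_def K1_def)
    with l show "local_energy k D a (D \<inter> - ball (x i) r) (\<psi> i q)
          \<le> exp (1 - r / (l * mesh_size m \<tau>)) * local_energy k D a D (\<psi> i q)"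
      by (intro exponential_decay[OF assms K i q r]) simp_all
  qed
qed

end
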